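(* Let $r\in(1,3)$ be fixed, $m=m(n)=\lfloor rn\rfloor$, and $P=P(n,m)$ chosen uniformly at random from $\mathcal P(n,m)$. If $I=I(n)\subseteq[n]$ is such that with high probability $\Delta(P)\in I$, then $|I(n)|\to\infty$ as $n\to\infty$.
   Context: $\mathcal P(n,m)$ denotes the class of all simple vertex-labelled planar graphs on vertex set $[n]$ with exactly $m$ edges; $\Delta$ denotes maximum degree; "with high probability" means with probability tending to $1$ as $n\to\infty$. *)

theory Defs
  imports "HOL-Probability.Probability"
begin

definition simple_graph :: "'a set \<Rightarrow> 'a set set \<Rightarrow> bool" where
  "simple_graph V E \<longleftrightarrow> (\<forall>e\<in>E. e \<subseteq> V \<and> card e = 2)"

text \<open>The set \<^term>\<open>path_image (\<gamma> e) - p ` e\<close> is the interior of the edge \<^term>\<open>e\<close>.\<close>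

definition plane_drawing ::
    "'a set \<Rightarrow> 'a set set \<Rightarrow> ('a \<Rightarrow> complex) \<Rightarrow> ('a set \<Rightarrow> real \<Rightarrow> complex) \<Rightarrow> bool" where
  "plane_drawing V E p \<gamma> \<longleftrightarrow>
     inj_on p V \<and>
     (\<forall>e\<in>E. arc (\<gamma> e) \<and> {pathstart (\<gamma> e), pathfinish (\<gamma> e)} = p ` e) \<and>
     (\<forall>e\<in>E. (path_image (\<gamma> e) - p ` e) \<inter> p ` V = {}) \<and>
     (\<forall>e\<in>E. \<forall>f\<in>E. e \<noteq> f \<longrightarrow> (path_image (\<gamma> e) - p ` e) \<inter> path_image (\<gamma> f) = {})"

definition planar :: "'a set \<Rightarrow> 'a set set \<Rightarrow> bool" where
  "planar V E \<longleftrightarrow> (\<exists>p \<gamma>. plane_drawing V E p \<gamma>)"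

definition planar_graphs :: "nat \<Rightarrow> nat \<Rightarrow> nat set set set" where
  "planar_graphs n m = {E. simple_graph {1..n} E \<and> planar {1..n} E \<and> card E = m}"

definition vertex_degree :: "'a set set \<Rightarrow> 'a \<Rightarrow> nat" where
  "vertex_degree E v = card {e\<in>E. v \<in> e}"

definition max_degree :: "'a set \<Rightarrow> 'a set set \<Rightarrow> nat" where
  "max_degree V E = Max (vertex_degree E ` V)"

lemma finite_planar_graphs: "finite (planar_graphs n m)"
proof (rule finite_subset)
  show "planar_graphs n m \<subseteq> Pow (Pow {1..n})"
    by (auto simp: planar_graphs_def simple_graph_def)
qed simp

text \<open>\<^term>\<open>pmf_of_set\<close> is unspecified on the empty set.\<close>

definition random_planar_graph :: "nat \<Rightarrow> nat \<Rightarrow> nat set set pmf" where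
  "random_planar_graph n m = pmf_of_set (planar_graphs n m)"

end

theory Submission
  imports Defs
begin

text \<open>
  Call a triangle \<open>abc\<close> attached to the rest of the graph by a single edge \<open>xa\<close> a coin at \<open>x\<close>.

  Most graphs carry linearly many coins. Indeed, suppose that half of the graphs on \<open>n\<close> vertices carry at
  most \<open>\<delta>n\<close> of them. Attaching \<open>\<delta>n\<close> further coins hardly creates repetitions, so for small \<open>\<delta>\<close> the
  number of planar graphs divided by \<open>n!\<close> gets an unexpectedly large exponential growth rate near \<open>n\<close>.
  Connecting the components costs only a subexponential factor, and connected counts are supermultiplicative, so the
  larger growth rate persists for all much larger \<open>n\<close>. As there are at most \<open>n! C\<^sup>n\<close> planar graphs, the
  growth rate can increase only finitely often.

  If \<open>|I(n)|\<close> stays bounded along a subsequence, some maximum degree \<open>d\<close> has probability bounded below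
  together with many coins. Take \<open>b\<close> coins away, append their \<open>3b\<close> vertices to the longest path component of
  the graph minus a vertex \<open>v\<close> of degree \<open>d\<close>, and join \<open>b\<close> or \<open>b + 1\<close> of them to \<open>v\<close>. This keeps the
  numbers of vertices and edges, and the coins can be chosen in about as many ways as there are reconstructions. Hence \<open>d + b\<close> or
  \<open>d + b + 1\<close> also has probability bounded below, for each of arbitrarily many \<open>b\<close>, and these
  values do not all fit into \<open>I(n)\<close>.
\<close>

section \<open>Plane drawings\<close>

text \<open>Planarity is given topologically, so the combinatorics is drawn from three operations on
  drawings: contracting an edge, joining two drawings by an edge, gluing them at a vertex. Together
  with the Jordan curve theorem they exclude the complete graph on five vertices; closure under
  minors then gives linearly many edges and at most n! C^n graphs. The arithmetic of the switch:
  \<open>b\<close> coins free \<open>4 b\<close> edges. A path through their \<open>3 b\<close>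
  vertices takes \<open>3 b - 1\<close> of them and its link to an old path one more, which leaves
  \<open>b\<close> edges for \<open>v\<close>; without an old path there is no link and
  \<open>b + 1\<close> are left. The obstacle is that the switch must be undone with boundedly many
  candidates, although a graph may have many path components and many vertices of maximum degree.
  Raising the degree by at least 4 makes \<open>v\<close> the only vertex of maximum degree, and
  extending the longest path makes the new one strictly longest, so only its reading direction stays
  open. A removed coin is put back by naming its vertex \<open>x\<close>, a factor \<open>n\<close>
  that is compensated by the linearly many coins available for removal.\<close>

definition arc_on :: "complex set \<Rightarrow> complex \<Rightarrow> complex \<Rightarrow> bool" where
  "arc_on S a b \<longleftrightarrow> (\<exists>g. arc g \<and> path_image g = S \<and> pathstart g = a \<and> pathfinish g = b)"

text \<open>Edges are point sets here rather than parametrised paths: an arc can be reversed, so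
  both orders of \<open>u\<close> and \<open>w\<close> can be demanded at once, and surgery on an
  edge does not have to name a parametrisation. Edges may meet only in images of common vertices,
  which replaces the edge interiors of \<open>plane_drawing\<close>.\<close>

definition drawing ::
    "'a set \<Rightarrow> 'a set set \<Rightarrow> ('a \<Rightarrow> complex) \<Rightarrow> ('a set \<Rightarrow> complex set) \<Rightarrow> bool" where
  "drawing V E p K \<longleftrightarrow>
     inj_on p V \<and>
     (\<forall>u w. {u, w} \<in> E \<longrightarrow> arc_on (K {u, w}) (p u) (p w)) \<and>
     (\<forall>e\<in>E. K e \<inter> p ` V \<subseteq> p ` e) \<and>
     (\<forall>e\<in>E. \<forall>f\<in>E. e \<noteq> f \<longrightarrow> K e \<inter> K f \<subseteq> p ` (e \<inter> f))"

lemma drawing_inj: "drawing V E p K \<Longrightarrow> inj_on p V"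
  by (simp add: drawing_def)

lemma drawing_arc: "drawing V E p K \<Longrightarrow> {u, w} \<in> E \<Longrightarrow> arc_on (K {u, w}) (p u) (p w)"
  by (simp add: drawing_def)

lemma drawing_vertices: "drawing V E p K \<Longrightarrow> e \<in> E \<Longrightarrow> K e \<inter> p ` V \<subseteq> p ` e"
  by (simp add: drawing_def)

lemma drawing_edges: "drawing V E p K \<Longrightarrow> e \<in> E \<Longrightarrow> f \<in> E \<Longrightarrow> e \<noteq> f \<Longrightarrow> K e \<inter> K f \<subseteq> p ` (e \<inter> f)"
  by (simp add: drawing_def)

text \<open>Loops produced by \<open>f\<close> are dropped by the cardinality condition, and
  parallel edges merge because edges form a set. With \<open>f = id(y := x)\<close> this is the
  contraction of the edge \<open>{x, y}\<close> into \<open>x\<close>.\<close>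

definition image_graph :: "('a \<Rightarrow> 'b) \<Rightarrow> 'a set set \<Rightarrow> 'b set set" where
  "image_graph f E = {f ` e |e. e \<in> E \<and> card (f ` e) = 2}"

lemma arc_on_sym: "arc_on S a b \<Longrightarrow> arc_on S b a"
  unfolding arc_on_def
  by (metis arc_reversepath path_image_reversepath pathfinish_reversepath pathstart_reversepath)

lemma arc_on_ends: "arc_on S a b \<Longrightarrow> a \<in> S \<and> b \<in> S \<and> a \<noteq> b"
  unfolding arc_on_def using arc_distinct_ends by fastforce

lemma arc_on_compact: "arc_on S a b \<Longrightarrow> compact S"
  unfolding arc_on_def using compact_arc_image by blast

lemma arc_on_connected: "arc_on S a b \<Longrightarrow> connected S"
  unfolding arc_on_def using arc_imp_path connected_path_image by blast

lemma arc_on_segment: "a \<noteq> b \<Longrightarrow> arc_on (closed_segment a b) a b"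
  unfolding arc_on_def by (metis arc_linepath path_image_linepath pathfinish_linepath pathstart_linepath)

lemma arc_on_join:
  assumes "arc_on S a b" "arc_on T b c" "S \<inter> T \<subseteq> {b}"
  shows "arc_on (S \<union> T) a c"
proof -
  obtain g h where gh: "arc g" "path_image g = S" "pathstart g = a" "pathfinish g = b"
    "arc h" "path_image h = T" "pathstart h = b" "pathfinish h = c"
    using assms unfolding arc_on_def by blast
  then have "arc (g +++ h)" using assms by (intro arc_join) auto
  moreover have "path_image (g +++ h) = S \<union> T"
    using gh by (simp add: path_image_join)
  ultimately show ?thesis using gh unfolding arc_on_def
    by (metis pathfinish_join pathstart_join)
qed

lemma arc_on_image:
  assumes "arc_on S a b" "continuous_on S f" "inj_on f S"
  shows "arc_on (f ` S) (f a) (f b)"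
proof -
  obtain g where g: "arc g" "path_image g = S" "pathstart g = a" "pathfinish g = b"
    using assms unfolding arc_on_def by blast
  have "arc (f \<circ> g)"
    using g assms unfolding arc_def
    by (auto intro!: path_continuous_image comp_inj_on simp: path_image_def)
  moreover have "path_image (f \<circ> g) = f ` S"
    using g by (simp add: path_image_compose)
  ultimately show ?thesis using g unfolding arc_on_def
    by (metis pathfinish_compose pathstart_compose)
qed

lemma simple_graph_edgeE:
  assumes "simple_graph V E" "e \<in> E"
  obtains u w where "e = {u, w}" "u \<noteq> w" "u \<in> V" "w \<in> V"
  using assms unfolding simple_graph_def card_2_iff by (metis insert_subset)

lemma finite_edges: "simple_graph V E \<Longrightarrow> finite V \<Longrightarrow> finite E"
  unfolding simple_graph_def by (meson Pow_iff finite_Pow_iff finite_subset subsetI)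

lemma planar_iff_drawing:
  assumes "simple_graph V E"
  shows "planar V E \<longleftrightarrow> (\<exists>p K. drawing V E p K)"
proof
  assume "planar V E"
  then obtain p g where pg: "plane_drawing V E p g" unfolding planar_def by blast
  have 1: "inj_on p V" and 2: "\<And>e. e \<in> E \<Longrightarrow> arc (g e) \<and> {pathstart (g e), pathfinish (g e)} = p ` e"
    and 3: "\<And>e. e \<in> E \<Longrightarrow> (path_image (g e) - p ` e) \<inter> p ` V = {}"
    and 4: "\<And>e f. e \<in> E \<Longrightarrow> f \<in> E \<Longrightarrow> e \<noteq> f \<Longrightarrow> (path_image (g e) - p ` e) \<inter> path_image (g f) = {}"
    using pg unfolding plane_drawing_def by simp_all
  have sub: "e \<subseteq> V" if "e \<in> E" for e using assms that unfolding simple_graph_def by blast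
  have "drawing V E p (\<lambda>e. path_image (g e))"
    unfolding drawing_def
  proof (intro conjI allI impI ballI)
    fix u w assume e: "{u, w} \<in> E"
    then have "{pathstart (g {u, w}), pathfinish (g {u, w})} = {p u, p w}" using 2 by auto
    then have "pathstart (g {u, w}) = p u \<and> pathfinish (g {u, w}) = p w \<or>
          pathstart (g {u, w}) = p w \<and> pathfinish (g {u, w}) = p u"
      by (auto simp: doubleton_eq_iff)
    then show "arc_on (path_image (g {u, w})) (p u) (p w)"
      using 2[OF e] arc_on_sym unfolding arc_on_def by metis
  next
    fix e f assume ef: "e \<in> E" "f \<in> E" "e \<noteq> f"
    have "path_image (g e) \<inter> path_image (g f) \<subseteq> p ` e \<inter> p ` f"
      using 4[OF ef] 4[of f e] ef by blast
    then show "path_image (g e) \<inter> path_image (g f) \<subseteq> p ` (e \<inter> f)"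
      using inj_on_image_Int[OF 1 sub[OF ef(1)] sub[OF ef(2)]] by simp
  qed (use 1 3 in blast)+
  then show "\<exists>p K. drawing V E p K" by blast
next
  assume "\<exists>p K. drawing V E p K"
  then obtain p K where d: "drawing V E p K" by blast
  have "\<exists>h. arc h \<and> path_image h = K e \<and> {pathstart h, pathfinish h} = p ` e" if eE: "e \<in> E" for e
  proof -
    obtain u w where "e = {u, w}" using simple_graph_edgeE[OF assms eE] by metis
    then show ?thesis using drawing_arc[OF d] eE unfolding arc_on_def
      by (metis image_empty image_insert)
  qed
  then obtain g where g: "\<And>e. e \<in> E \<Longrightarrow> arc (g e) \<and> path_image (g e) = K e \<and> {pathstart (g e), pathfinish (g e)} = p ` e"
    by metis
  have "(K e - p ` e) \<inter> K f = {}" if "e \<in> E" "f \<in> E" "e \<noteq> f" for e f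
    using drawing_edges[OF d that] by blast
  moreover have "(K e - p ` e) \<inter> p ` V = {}" if "e \<in> E" for e
    using drawing_vertices[OF d that] by blast
  ultimately have "plane_drawing V E p g"
    unfolding plane_drawing_def using g d by (simp add: drawing_def)
  then show "planar V E" unfolding planar_def by blast
qed

lemma drawing_subgraph:
  assumes "drawing V E p K" "V' \<subseteq> V" "E' \<subseteq> E"
  shows "drawing V' E' p K"
proof -
  have "K e \<inter> p ` V' \<subseteq> p ` e" if "e \<in> E'" for e
    using drawing_vertices[OF assms(1)] assms(2,3) that by blast
  moreover have "inj_on p V'" using assms drawing_inj inj_on_subset by blast
  ultimately show ?thesis
    using assms(3) drawing_arc[OF assms(1)] drawing_edges[OF assms(1)] unfolding drawing_def
    by (simp add: subset_iff)
qed

lemma planar_subgraph: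
  assumes "simple_graph V E" "planar V E" "simple_graph V' E'" "V' \<subseteq> V" "E' \<subseteq> E"
  shows "planar V' E'"
  using assms drawing_subgraph planar_iff_drawing by metis

lemma drawing_map:
  assumes sg: "simple_graph V E" and d: "drawing V E p K"
    and cont: "continuous_on S f" and inj: "inj_on f S" and sub: "p ` V \<subseteq> S" "\<And>e. e \<in> E \<Longrightarrow> K e \<subseteq> S"
  shows "drawing V E (f \<circ> p) (\<lambda>e. f ` K e)"
  unfolding drawing_def
proof (intro conjI allI impI ballI)
  show "inj_on (f \<circ> p) V"
    using d sub inj by (meson comp_inj_on drawing_def inj_on_subset)
  fix u w assume "{u, w} \<in> E"
  then show "arc_on (f ` K {u, w}) ((f \<circ> p) u) ((f \<circ> p) w)"
    using arc_on_image[OF drawing_arc[OF d] continuous_on_subset[OF cont] inj_on_subset[OF inj]] sub(2)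
    by simp
next
  fix e assume e: "e \<in> E"
  have "f ` K e \<inter> f ` p ` V = f ` (K e \<inter> p ` V)"
    using inj_on_image_Int[OF inj sub(2)[OF e] sub(1)] by simp
  then show "f ` K e \<inter> (f \<circ> p) ` V \<subseteq> (f \<circ> p) ` e"
    using d e unfolding drawing_def by (metis image_comp image_mono)
next
  fix e e' assume e: "e \<in> E" "e' \<in> E" "e \<noteq> e'"
  have "f ` K e \<inter> f ` K e' = f ` (K e \<inter> K e')"
    using inj_on_image_Int[OF inj sub(2)[OF e(1)] sub(2)[OF e(2)]] by simp
  then show "f ` K e \<inter> f ` K e' \<subseteq> (f \<circ> p) ` (e \<inter> e')"
    using d e unfolding drawing_def by (metis image_comp image_mono)
qed

lemma planar_relabel:
  assumes sg: "simple_graph V E" and pl: "planar V E" and inj: "inj_on f V"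
  shows "simple_graph (f ` V) ((`) f ` E)" "planar (f ` V) ((`) f ` E)"
proof -
  have sub: "e \<subseteq> V" if "e \<in> E" for e using sg that unfolding simple_graph_def by blast
  show s2: "simple_graph (f ` V) ((`) f ` E)"
    using sg inj unfolding simple_graph_def
    by (auto simp: card_image inj_on_subset)
  obtain p K where d: "drawing V E p K" using planar_iff_drawing[OF sg] pl by blast
  define h where "h = the_inv_into V f"
  have h: "h (f v) = v" if "v \<in> V" for v unfolding h_def using that inj by (simp add: the_inv_into_f_f)
  have hi: "h ` f ` e = e" if "e \<subseteq> V" for e using h that by force
  have "drawing (f ` V) ((`) f ` E) (p \<circ> h) (\<lambda>e. K (h ` e))"
    unfolding drawing_def
  proof (intro conjI allI impI ballI)
    show "inj_on (p \<circ> h) (f ` V)"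
      using d h unfolding drawing_def inj_on_def by auto
    fix u w assume "{u, w} \<in> (`) f ` E"
    then obtain e where e: "e \<in> E" "{u, w} = f ` e" by auto
    then have *: "h ` {u, w} = e" using hi sub by simp
    then have "{h u, h w} \<in> E" using e(1) by simp
    then show "arc_on (K (h ` {u, w})) ((p \<circ> h) u) ((p \<circ> h) w)"
      using d unfolding drawing_def by simp
  next
    fix e assume "e \<in> (`) f ` E"
    then obtain e0 where e: "e0 \<in> E" "e = f ` e0" by auto
    have "(p \<circ> h) ` f ` V = p ` V" using hi[of V] by (metis image_comp order_refl)
    moreover have "(p \<circ> h) ` e = p ` e0" using hi[OF sub[OF e(1)]] e(2) by (metis image_comp)
    ultimately show "K (h ` e) \<inter> (p \<circ> h) ` f ` V \<subseteq> (p \<circ> h) ` e"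
      using d e hi[OF sub[OF e(1)]] unfolding drawing_def by simp
  next
    fix e e' assume "e \<in> (`) f ` E" "e' \<in> (`) f ` E" and ne: "e \<noteq> e'"
    then obtain e0 e1 where e: "e0 \<in> E" "e = f ` e0" "e1 \<in> E" "e' = f ` e1" by auto
    have "e \<inter> e' = f ` (e0 \<inter> e1)"
      using inj_on_image_Int[OF inj sub sub] e by simp
    then have "(p \<circ> h) ` (e \<inter> e') = p ` (e0 \<inter> e1)"
      using hi[of "e0 \<inter> e1"] sub e by (metis image_comp le_infI1)
    then show "K (h ` e) \<inter> K (h ` e') \<subseteq> (p \<circ> h) ` (e \<inter> e')"
      using drawing_edges[OF d e(1,3)] e ne hi[OF sub[OF e(1)]] hi[OF sub[OF e(3)]] by auto
  qed
  then show "planar (f ` V) ((`) f ` E)" using planar_iff_drawing[OF s2] by blast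
qed

section \<open>Collapsing a disc and contracting an edge\<close>

lemma arc_on_first_hit:
  assumes S: "arc_on S b c" and b: "b \<notin> cball a r" and c: "c \<in> ball a r"
  obtains h T where "arc_on T b h" "T \<subseteq> S" "dist a h = r" "T \<inter> cball a r = {h}"
proof -
  obtain g where g: "arc g" "path_image g = S" "pathstart g = b" "pathfinish g = c"
    using S unfolding arc_on_def by blast
  have "pathstart g \<in> closure (- cball a r)" "pathfinish g \<notin> - cball a r"
    using g b c closure_subset[of "- cball a r"] by auto
  then obtain u where u: "0 \<le> u" "u \<le> 1" "g u \<in> frontier (- cball a r)"
      "path_image (subpath 0 u g) - {g u} \<subseteq> interior (- cball a r)"
    using subpath_to_frontier[OF arc_imp_path[OF g(1)]] by metis
  have h: "dist a (g u) = r" using u(3) by (auto simp: frontier_complement)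
  have "u \<noteq> 0" using h b g(3) by (auto simp: pathstart_def)
  have "arc (subpath 0 u g)" using \<open>u \<noteq> 0\<close> u g by (intro arc_subpath_arc) auto
  moreover have "path_image (subpath 0 u g) \<subseteq> S"
    using u g by (metis atLeastAtMost_iff order_refl path_image_subpath_subset zero_le_one)
  moreover have "pathstart (subpath 0 u g) = b" "pathfinish (subpath 0 u g) = g u"
    using g by (auto simp: pathstart_def pathfinish_def subpath_def)
  moreover have "path_image (subpath 0 u g) \<inter> cball a r = {g u}"
  proof -
    have "g u \<in> path_image (subpath 0 u g)"
      by (metis pathfinish_in_path_image pathfinish_subpath)
    moreover have "g u \<in> cball a r" using h by simp
    moreover have "interior (- cball a r) \<inter> cball a r = {}" using interior_subset by fastforce
    ultimately show ?thesis using u(4) by blast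
  qed
  ultimately show ?thesis using that h unfolding arc_on_def by blast
qed

lemma radii_inter:
  fixes a :: complex
  assumes r: "r > 0" "dist a h = r" "dist a h' = r" and x: "x \<in> closed_segment a h" "x \<in> closed_segment a h'"
  shows "x = a \<or> h = h'"
proof -
  obtain s where s: "x = a + s *\<^sub>R (h - a)" "0 \<le> s"
    using x(1) by (auto simp: in_segment algebra_simps)
  obtain t where t: "x = a + t *\<^sub>R (h' - a)" "0 \<le> t"
    using x(2) by (auto simp: in_segment algebra_simps)
  have "dist a x = s * r" using s r by (auto simp: dist_norm norm_minus_commute)
  moreover have "dist a x = t * r" unfolding t(1) using t(2) r by (auto simp: dist_norm norm_minus_commute)
  ultimately
  have "s = t" using r by simp
  then show ?thesis using s t by auto
qed

lemma radius_subset: "dist a h = r \<Longrightarrow> closed_segment a h \<subseteq> cball a (r::real)" for a :: complex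
  by (intro closed_segment_subset) auto

text \<open>Every edge from outside to a vertex of \<^term>\<open>Y\<close> is kept until it first meets the disc and
  then continued along a radius.\<close>

lemma drawing_collapse:
  assumes sg: "simple_graph V E" and d: "drawing V E p K" and Y: "Y \<subseteq> V" "y0 \<in> Y"
    and inside: "\<And>y. y \<in> Y \<Longrightarrow> p y \<in> ball a r" and outs: "\<And>v. v \<in> V - Y \<Longrightarrow> p v \<notin> cball a r"
    and avoid: "\<And>e. e \<in> E \<Longrightarrow> e \<inter> Y = {} \<Longrightarrow> K e \<inter> cball a r = {}"
  obtains K' where
    "drawing (insert y0 (V - Y)) (image_graph (\<lambda>v. if v \<in> Y then y0 else v) E) (p(y0 := a)) K'"
    "\<And>e. e \<in> E \<Longrightarrow> e \<inter> Y = {} \<Longrightarrow> K' e = K e"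
    "\<And>e. e \<in> image_graph (\<lambda>v. if v \<in> Y then y0 else v) E \<Longrightarrow> y0 \<in> e \<Longrightarrow>
        \<exists>h. dist a h = r \<and> K' e \<inter> cball a r = closed_segment a h"
proof -
  let ?f = "\<lambda>v. if v \<in> Y then y0 else v"
  let ?E' = "image_graph ?f E"
  have r: "r > 0" using inside[OF Y(2)] by (metis ball_eq_empty empty_iff not_le)
  have inj: "inj_on p V" and arcs: "\<And>u w. {u, w} \<in> E \<Longrightarrow> arc_on (K {u, w}) (p u) (p w)"
    and KV: "\<And>e. e \<in> E \<Longrightarrow> K e \<inter> p ` V \<subseteq> p ` e"
    and KK: "\<And>e f. e \<in> E \<Longrightarrow> f \<in> E \<Longrightarrow> e \<noteq> f \<Longrightarrow> K e \<inter> K f \<subseteq> p ` (e \<inter> f)"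
    using drawing_inj[OF d] drawing_arc[OF d] drawing_vertices[OF d] drawing_edges[OF d] by simp_all
  have E'cases: "(e \<in> E \<and> e \<inter> Y = {}) \<or> (\<exists>w y. w \<in> V - Y \<and> y \<in> Y \<and> {y, w} \<in> E \<and> e = {y0, w})"
    if "e \<in> ?E'" for e
  proof -
    obtain e0 where e0: "e0 \<in> E" "e = ?f ` e0" "card (?f ` e0) = 2" using \<open>e \<in> ?E'\<close> unfolding image_graph_def by blast
    obtain u w where uw: "e0 = {u, w}" "u \<noteq> w" "u \<in> V" "w \<in> V" using simple_graph_edgeE[OF sg e0(1)] .
    then have e: "e = {?f u, ?f w}" "?f u \<noteq> ?f w" using e0 uw by auto
    show ?thesis
    proof (cases "u \<in> Y")
      case True
      then have "w \<notin> Y" using e by auto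
      then show ?thesis using True e uw e0 by auto
    next
      case False
      then show ?thesis
      proof (cases "w \<in> Y")
        case True
        then show ?thesis using False e uw e0 by (auto simp: insert_commute)
      next
        case nw: False
        then show ?thesis using False e uw e0 by auto
      qed
    qed
  qed
  \<comment> \<open>All edges from \<open>w\<close> into \<open>Y\<close> become parallel after the
    collapse, so for every outside neighbour \<open>w\<close> a single one of them, ending at
    \<open>Yf w\<close>, is selected and truncated.\<close>
  define N where "N = {w \<in> V - Y. \<exists>y\<in>Y. {y, w} \<in> E}"
  have "\<exists>y T h. y \<in> Y \<and> {y, w} \<in> E \<and> arc_on T (p w) h \<and> T \<subseteq> K {y, w} \<and> dist a h = r \<and> T \<inter> cball a r = {h}"
    if wN: "w \<in> N" for w
  proof -
    obtain y where y: "y \<in> Y" "{y, w} \<in> E" using wN unfolding N_def by blast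
    then have "arc_on (K {y, w}) (p w) (p y)" using arcs arc_on_sym by blast
    then show ?thesis using arc_on_first_hit[of "K {y, w}" "p w" "p y" a r] outs[of w] inside[OF y(1)] wN y
      unfolding N_def by (metis (no_types, lifting) mem_Collect_eq)
  qed
  then obtain Yf T h where yth: "\<And>w. w \<in> N \<Longrightarrow> Yf w \<in> Y \<and> {Yf w, w} \<in> E \<and> arc_on (T w) (p w) (h w)
      \<and> T w \<subseteq> K {Yf w, w} \<and> dist a (h w) = r \<and> T w \<inter> cball a r = {h w}"
    by metis
  define L where "L w = T w \<union> closed_segment (h w) a" for w
  define K' where "K' e = (if y0 \<in> e then L (THE w. e = {y0, w}) else K e)" for e
  have wne: "w \<noteq> y0" if "w \<in> N" for w using that Y unfolding N_def by auto
  have K'L: "K' {y0, w} = L w" if "w \<in> N" for w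
  proof -
    have "(THE w'. {y0, w} = {y0, w'}) = w"
      using wne[OF that] by (intro the_equality) (auto simp: doubleton_eq_iff)
    then show ?thesis unfolding K'_def by simp
  qed
  have K'K: "K' e = K e" if "e \<inter> Y = {}" for e
    using that Y unfolding K'_def by auto
  have E'cases: "(e \<in> E \<and> e \<inter> Y = {} \<and> y0 \<notin> e \<and> K' e = K e) \<or> (\<exists>w. w \<in> N \<and> e = {y0, w} \<and> K' e = L w)"
    if eE': "e \<in> ?E'" for e
  proof (cases "e \<in> E \<and> e \<inter> Y = {}")
    case True
    then show ?thesis using K'K Y by blast
  next
    case False
    then obtain w y where "w \<in> V - Y \<and> y \<in> Y \<and> {y, w} \<in> E \<and> e = {y0, w}" using E'cases[OF eE'] by metis
    then have "w \<in> N" "e = {y0, w}" unfolding N_def by blast+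
    then show ?thesis using K'L by blast
  qed
  have segc: "closed_segment (h w) a \<subseteq> cball a r" if "w \<in> N" for w
    using radius_subset[of a "h w" r] yth[OF that] by (simp add: closed_segment_commute)
  have Tball: "T w \<inter> ball a r = {}" if "w \<in> N" for w
    using yth[OF that] by (auto simp: set_eq_iff) (metis mem_cball order_less_imp_le order_less_irrefl)
  have Lc: "L w \<inter> cball a r = closed_segment a (h w)" if "w \<in> N" for w
  proof -
    have "T w \<inter> cball a r \<subseteq> closed_segment (h w) a" using yth[OF that] by simp
    then show ?thesis using segc[OF that] unfolding L_def by (auto simp: closed_segment_commute)
  qed
  \<comment> \<open>The full edges are distinct and can share only a vertex of \<open>Y\<close>,
    whose image lies in the open disc; the truncated arcs stay out of that disc.\<close>
  have TT: "T w \<inter> T w' = {}" if "w \<in> N" "w' \<in> N" "w \<noteq> w'" for w w'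
  proof -
    have "{Yf w, w} \<noteq> {Yf w', w'}" using that yth[of w] yth[of w'] unfolding N_def by (auto simp: doubleton_eq_iff)
    then have "T w \<inter> T w' \<subseteq> p ` ({Yf w, w} \<inter> {Yf w', w'})"
      using KK yth that by blast
    also have "\<dots> \<subseteq> p ` Y" using that yth[of w] yth[of w'] unfolding N_def by auto
    also have "\<dots> \<subseteq> ball a r" using inside by blast
    finally show ?thesis using Tball[OF that(1)] by blast
  qed
  have dr: "drawing (insert y0 (V - Y)) ?E' (p(y0 := a)) K'"
    unfolding drawing_def
  proof (intro conjI allI impI ballI)
    have "a \<in> cball a r" using r by simp
    then have "p v \<noteq> a" if "v \<in> V - Y" for v using outs[OF that] by auto
    then show "inj_on (p(y0 := a)) (insert y0 (V - Y))"
      using inj Y unfolding inj_on_def by auto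
  next
    fix u w assume uw: "{u, w} \<in> ?E'"
    have A: "arc_on (L w) (p w) a" if "w \<in> N" for w
      unfolding L_def
    proof (rule arc_on_join)
      show "arc_on (T w) (p w) (h w)" using yth that by blast
      have "h w \<noteq> a" using yth[OF that] r by auto
      then show "arc_on (closed_segment (h w) a) (h w) a" by (rule arc_on_segment)
      show "T w \<inter> closed_segment (h w) a \<subseteq> {h w}" using segc[OF that] yth[OF that] by blast
    qed
    from E'cases[OF uw] show "arc_on (K' {u, w}) ((p(y0 := a)) u) ((p(y0 := a)) w)"
    proof
      assume "{u, w} \<in> E \<and> {u, w} \<inter> Y = {} \<and> y0 \<notin> {u, w} \<and> K' {u, w} = K {u, w}"
      then show ?thesis using arcs by auto
    next
      assume "\<exists>w'. w' \<in> N \<and> {u, w} = {y0, w'} \<and> K' {u, w} = L w'"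
      then obtain w' where w': "w' \<in> N" "{u, w} = {y0, w'}" "K' {u, w} = L w'" by blast
      then consider "u = y0" "w = w'" | "u = w'" "w = y0" by (auto simp: doubleton_eq_iff)
      then show ?thesis
      proof cases
        case 1
        then show ?thesis using A[OF w'(1)] arc_on_sym wne[OF w'(1)] w'(3) by auto
      next
        case 2
        then show ?thesis using A[OF w'(1)] wne[OF w'(1)] w'(3) by auto
      qed
    qed
  next
    fix e assume e: "e \<in> ?E'"
    have sub: "(p(y0 := a)) ` insert y0 (V - Y) \<subseteq> insert a (p ` (V - Y))" by auto
    from E'cases[OF e] show "K' e \<inter> (p(y0 := a)) ` insert y0 (V - Y) \<subseteq> (p(y0 := a)) ` e"
    proof
      assume A: "e \<in> E \<and> e \<inter> Y = {} \<and> y0 \<notin> e \<and> K' e = K e"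
      then have "a \<notin> K e" using avoid[of e] r by auto
      moreover have "(p(y0 := a)) ` e = p ` e" using A by (auto simp: image_iff)
      ultimately show ?thesis using KV[of e] A sub by auto
    next
      assume "\<exists>w. w \<in> N \<and> e = {y0, w} \<and> K' e = L w"
      then obtain w where w: "w \<in> N" "e = {y0, w}" "K' e = L w" by blast
      have "T w \<inter> p ` (V - Y) \<subseteq> {p w}"
      proof -
        have "K {Yf w, w} \<inter> p ` V \<subseteq> p ` {Yf w, w}" "T w \<subseteq> K {Yf w, w}"
          using KV[of "{Yf w, w}"] yth[OF w(1)] by simp_all
        then have "T w \<inter> p ` (V - Y) \<subseteq> p ` {Yf w, w}" by blast
        moreover have "p (Yf w) \<notin> T w" using inside[of "Yf w"] yth[OF w(1)] Tball[OF w(1)] by (metis IntI empty_iff)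
        ultimately show ?thesis by auto
      qed
      moreover have "closed_segment (h w) a \<inter> p ` (V - Y) = {}" using segc[OF w(1)] outs by blast
      ultimately have "L w \<inter> insert a (p ` (V - Y)) \<subseteq> {a, p w}" unfolding L_def by auto
      moreover have "(p(y0 := a)) ` e = {a, p w}" using w wne by auto
      ultimately show ?thesis using Int_mono[OF eq_refl[OF w(3)] sub] by (simp only:)
    qed
  next
    fix e f assume e: "e \<in> ?E'" and f: "f \<in> ?E'" and ne: "e \<noteq> f"
    have mixed: "K e \<inter> L w \<subseteq> (p(y0 := a)) ` (e \<inter> {y0, w})" if "e \<in> E" "e \<inter> Y = {}" "w \<in> N" for e w
    proof -
      have "K e \<inter> closed_segment (h w) a = {}" using avoid[OF that(1,2)] segc[OF that(3)] by blast
      moreover have "K e \<inter> T w \<subseteq> p ` (e \<inter> {w})"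
      proof -
        have "e \<noteq> {Yf w, w}" using that yth[OF that(3)] by auto
        then have "K e \<inter> K {Yf w, w} \<subseteq> p ` (e \<inter> {Yf w, w})" using KK[of e "{Yf w, w}"] that yth[OF that(3)] by simp
        then have "K e \<inter> T w \<subseteq> p ` (e \<inter> {Yf w, w})" using yth[OF that(3)] by blast
        moreover have "Yf w \<notin> e" using that(2) yth[OF that(3)] by blast
        ultimately show ?thesis by simp
      qed
      moreover have "p ` (e \<inter> {w}) \<subseteq> (p(y0 := a)) ` (e \<inter> {y0, w})" using wne[OF that(3)] by auto
      ultimately show ?thesis unfolding L_def by blast
    qed
    from E'cases[OF e] E'cases[OF f]
    consider "e \<in> E" "e \<inter> Y = {}" "y0 \<notin> e" "K' e = K e" "f \<in> E" "f \<inter> Y = {}" "K' f = K f"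
      | w where "e \<in> E" "e \<inter> Y = {}" "K' e = K e" "w \<in> N" "f = {y0, w}" "K' f = L w"
      | w where "f \<in> E" "f \<inter> Y = {}" "K' f = K f" "w \<in> N" "e = {y0, w}" "K' e = L w"
      | w w' where "w \<in> N" "e = {y0, w}" "K' e = L w" "w' \<in> N" "f = {y0, w'}" "K' f = L w'"
      by blast
    then show "K' e \<inter> K' f \<subseteq> (p(y0 := a)) ` (e \<inter> f)"
    proof cases
      case 1
      moreover have "(p(y0 := a)) ` (e \<inter> f) = p ` (e \<inter> f)" using 1 by (auto simp: image_iff)
      ultimately show ?thesis using KK ne by simp
    next
      case 2
      then show ?thesis using mixed by simp
    next
      case 3
      then show ?thesis using mixed[of f w] by (simp add: Int_commute)
    next
      case 4
      then have ww: "w \<noteq> w'" using ne by auto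
      have hh: "h w \<noteq> h w'" using TT[OF 4(1,4) ww] yth[OF 4(1)] yth[OF 4(4)] by blast
      have "x = a" if x: "x \<in> L w" "x \<in> L w'" for x
      proof (cases "x \<in> cball a r")
        case True
        then have "x \<in> closed_segment a (h w)" "x \<in> closed_segment a (h w')" using Lc 4 x by blast+
        then show ?thesis using radii_inter r hh yth 4 by metis
      next
        case False
        then have "x \<in> T w \<inter> T w'" using x segc 4 unfolding L_def by blast
        then show ?thesis using TT 4 ww by blast
      qed
      then show ?thesis using 4 by auto
    qed
  qed
  show ?thesis
  proof (rule that[OF dr])
    show "\<And>e. e \<in> E \<Longrightarrow> e \<inter> Y = {} \<Longrightarrow> K' e = K e" using K'K by blast
    show "\<exists>h. dist a h = r \<and> K' e \<inter> cball a r = closed_segment a h" if e: "e \<in> ?E'" "y0 \<in> e" for e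
    proof -
      obtain w where "w \<in> N" "K' e = L w" using E'cases[OF e(1)] e(2) by blast
      then show ?thesis using Lc yth by metis
    qed
  qed
qed

text \<open>A collapse needs both ends of the edge in a disc that meets no edge avoiding them, so
  \<open>y\<close> is first dragged along the arc \<open>g\<close> towards \<open>x\<close>. The
  piece \<open>C\<close> of the arc away from \<open>p x\<close> is compact and disjoint from
  \<open>Z'\<close>, which is everything drawn that is not at \<open>y\<close>; hence there is a
  positive distance \<open>D\<close> between them, and discs of radius \<open>D / 2\<close> about
  points of \<open>C\<close> are harmless. Once \<open>y\<close> is within \<open>r0\<close> of
  \<open>p x\<close>, a collapse of \<open>{x, y}\<close> finishes, since that disc avoids
  \<open>Z\<close>.\<close>

lemma planar_contract:
  assumes sg: "simple_graph V E" and fin: "finite V" and pl: "planar V E" and xy: "{x, y} \<in> E"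
  shows "simple_graph (V - {y}) (image_graph (id(y := x)) E)"
    and "planar (V - {y}) (image_graph (id(y := x)) E)"
proof -
  have xyV: "x \<in> V" "y \<in> V" "x \<noteq> y" using sg xy unfolding simple_graph_def by auto
  show sg': "simple_graph (V - {y}) (image_graph (id(y := x)) E)"
    using sg xyV unfolding simple_graph_def image_graph_def by (auto split: if_splits)
  obtain p K where d: "drawing V E p K" using planar_iff_drawing[OF sg] pl by blast
  have finE: "finite E" using finite_edges sg fin by blast
  have Kcl: "closed (K e)" if eE: "e \<in> E" for e
  proof -
    obtain u w where "e = {u, w}" using simple_graph_edgeE[OF sg eE] by metis
    then show ?thesis using drawing_arc[OF d] eE arc_on_compact compact_imp_closed by metis
  qed
  have inj: "inj_on p V" using drawing_inj[OF d] .
  have sub: "e \<subseteq> V" if "e \<in> E" for e using sg that unfolding simple_graph_def by blast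
  have pK: "v \<in> e" if "p v \<in> K e" "e \<in> E" "v \<in> V" for v e
  proof -
    have "p v \<in> p ` e" using drawing_vertices[OF d that(2)] that by blast
    then show ?thesis using inj sub[OF that(2)] that(3) by (metis imageE inj_onD subsetD)
  qed
  obtain g where g: "arc g" "path_image g = K {x, y}" "pathstart g = p x" "pathfinish g = p y"
    using drawing_arc[OF d xy] unfolding arc_on_def by blast
  have g0: "g 0 = p x" and g1: "g 1 = p y" using g by (auto simp: pathstart_def pathfinish_def)
  have gcont: "continuous_on {0..1} g" using arc_imp_path[OF g(1)] path_def by blast
  define Z where "Z = \<Union> (K ` {e \<in> E. x \<notin> e \<and> y \<notin> e}) \<union> p ` (V - {x, y})"
  define Z' where "Z' = \<Union> (K ` {e \<in> E. y \<notin> e}) \<union> p ` (V - {y})"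
  have "closed Z" unfolding Z_def using finE fin Kcl
    by (intro closed_Un closed_Union finite_imp_closed) auto
  have "closed Z'" unfolding Z'_def using finE fin Kcl
    by (intro closed_Un closed_Union finite_imp_closed) auto
  have "p x \<notin> Z" unfolding Z_def using pK xyV inj by (auto simp: inj_on_def)
  then obtain r0 where r0: "r0 > 0" "cball (p x) r0 \<subseteq> - Z"
    using \<open>closed Z\<close> open_contains_cball[of "- Z"] by blast
  obtain \<delta> where \<delta>: "0 < \<delta>" "\<delta> \<le> 1" "g \<delta> \<in> ball (p x) r0"
  proof -
    obtain e where e: "e > 0" "\<And>t. t \<in> {0..1} \<Longrightarrow> dist t 0 < e \<Longrightarrow> dist (g t) (g 0) < r0"
      using gcont r0(1) unfolding continuous_on_iff by (metis atLeastAtMost_iff order_refl zero_le_one)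
    show thesis
      by (rule that[of "min 1 (e / 2)"]) (use e(1) e(2)[of "min 1 (e / 2)"] g0 in \<open>auto simp: dist_commute\<close>)
  qed
  define C where "C = g ` {\<delta>..1}"
  have gc: "continuous_on {\<delta>..1} g" using gcont \<delta> by (auto intro: continuous_on_subset)
  then have "compact C" unfolding C_def by (intro compact_continuous_image) auto
  have "p x \<notin> C"
  proof
    assume "p x \<in> C"
    then obtain t where "t \<in> {\<delta>..1}" "g t = g 0" using g0 unfolding C_def by auto
    moreover from this have "t = 0" using arc_imp_inj_on[OF g(1)] \<delta> by (auto simp: inj_on_def)
    ultimately show False using \<delta> by simp
  qed
  have CK: "C \<subseteq> K {x, y}" unfolding C_def using g(2) \<delta> by (auto simp: path_image_def)
  have "C \<inter> Z' = {}"
  proof -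
    have "c \<noteq> p v" if "c \<in> C" "v \<in> V - {y}" for c v
      using that \<open>p x \<notin> C\<close> CK pK[OF _ xy, of v] by auto
    moreover have "c \<notin> K e" if "c \<in> C" "e \<in> E" "y \<notin> e" for c e
    proof
      assume "c \<in> K e"
      moreover have "e \<noteq> {x, y}" using that by auto
      ultimately have "c \<in> p ` ({x, y} \<inter> e)" using drawing_edges[OF d xy that(2)] CK that by blast
      then show False using that \<open>p x \<notin> C\<close> by auto
    qed
    ultimately show ?thesis unfolding Z'_def by blast
  qed
  then obtain D where D: "D > 0" "\<And>c z. c \<in> C \<Longrightarrow> z \<in> Z' \<Longrightarrow> D \<le> dist c z"
    using separate_compact_closed[OF \<open>compact C\<close> \<open>closed Z'\<close>] by blast
  define \<rho> where "\<rho> = D / 2"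
  have \<rho>: "\<rho> > 0" using D unfolding \<rho>_def by simp
  have far: "cball c \<rho> \<inter> Z' = {}" if "c \<in> C" for c
    using D(2)[OF that] D(1) unfolding \<rho>_def by (force simp: set_eq_iff)
  \<comment> \<open>By uniform continuity a parameter step shorter than \<open>\<eta>\<close> moves
    \<open>y\<close> by less than \<open>\<rho>\<close>, so each step is a collapse of the single
    vertex \<open>y\<close> onto the centre of a disc.\<close>
  obtain \<eta> where \<eta>: "\<eta> > 0" "\<And>s t. s \<in> {\<delta>..1} \<Longrightarrow> t \<in> {\<delta>..1} \<Longrightarrow> dist t s < \<eta> \<Longrightarrow> dist (g t) (g s) < \<rho>"
    using compact_uniformly_continuous[OF gc] \<rho> unfolding uniformly_continuous_on_def
    by (metis compact_Icc)
  \<comment> \<open>Collapsing a single vertex changes the drawing but not the graph.\<close>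
  have imid: "image_graph (\<lambda>v. if v \<in> {y} then y else v) E = E"
  proof -
    have "(\<lambda>v. if v \<in> {y} then y else v) = id" by auto
    then show ?thesis using sg unfolding image_graph_def simple_graph_def by auto
  qed
  \<comment> \<open>move \<^term>\<open>y\<close> along the edge towards \<^term>\<open>x\<close> in small steps\<close>
  have move: "\<exists>K'. drawing V E (p(y := g (max \<delta> (1 - real k * \<eta> / 2)))) K' \<and> (\<forall>e\<in>E. y \<notin> e \<longrightarrow> K' e = K e)" for k
  proof (induction k)
    case 0
    have "p(y := g (max \<delta> (1 - real 0 * \<eta> / 2))) = p" using \<delta> g1 by (auto simp: max_def)
    then show ?case using d by auto
  next
    case (Suc k)
    define t where "t = max \<delta> (1 - real k * \<eta> / 2)"
    define t' where "t' = max \<delta> (1 - real (Suc k) * \<eta> / 2)"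
    have tt: "t \<in> {\<delta>..1}" "t' \<in> {\<delta>..1}" "dist t t' < \<eta>"
      using \<delta> \<eta>(1) unfolding t_def t'_def by (auto simp: dist_real_def max_def field_simps)
    obtain K' where K': "drawing V E (p(y := g t)) K'" "\<And>e. e \<in> E \<Longrightarrow> y \<notin> e \<Longrightarrow> K' e = K e"
      using Suc unfolding t_def by blast
    have t'C: "g t' \<in> C" using tt unfolding C_def by blast
    have A: "(p(y := g t)) v \<in> ball (g t') \<rho>" if "v \<in> {y}" for v
      using that \<eta>(2)[OF tt(2,1,3)] by (auto simp: dist_commute)
    have B: "(p(y := g t)) v \<notin> cball (g t') \<rho>" if "v \<in> V - {y}" for v
      using that far[OF t'C] unfolding Z'_def by (auto simp: set_eq_iff)
    have C': "K' e \<inter> cball (g t') \<rho> = {}" if "e \<in> E" "e \<inter> {y} = {}" for e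
      using that far[OF t'C] K'(2)[of e] unfolding Z'_def by auto
    obtain K2 where K2: "drawing (insert y (V - {y})) E (p(y := g t, y := g t')) K2"
        "\<And>e. e \<in> E \<Longrightarrow> e \<inter> {y} = {} \<Longrightarrow> K2 e = K' e"
      using drawing_collapse[OF sg K'(1), of "{y}" y "g t'" \<rho>] A B C' xyV unfolding imid by (metis (lifting) empty_subsetI insert_subset singletonI)
    have "insert y (V - {y}) = V" using xyV by auto
    then show ?case using K2 K'(2) unfolding t'_def by (metis Int_insert_right_if0 fun_upd_upd inf_bot_right)
  qed
  obtain k :: nat where k: "1 - real k * \<eta> / 2 \<le> \<delta>"
  proof -
    obtain k :: nat where "real k > 2 / \<eta>" using reals_Archimedean2 by blast
    then have "1 - real k * \<eta> / 2 \<le> \<delta>" using \<eta>(1) \<delta> by (simp add: field_simps)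
    then show ?thesis using that by blast
  qed
  then obtain K' where K': "drawing V E (p(y := g \<delta>)) K'" "\<And>e. e \<in> E \<Longrightarrow> y \<notin> e \<Longrightarrow> K' e = K e"
    using move[of k] by (auto simp: max_def split: if_splits)
  have A: "(p(y := g \<delta>)) v \<in> ball (p x) r0" if "v \<in> {x, y}" for v
    using that \<delta>(3) r0(1) by auto
  have B: "(p(y := g \<delta>)) v \<notin> cball (p x) r0" if "v \<in> V - {x, y}" for v
    using that r0(2) unfolding Z_def by (auto simp: subset_iff)
  have C': "K' e \<inter> cball (p x) r0 = {}" if "e \<in> E" "e \<inter> {x, y} = {}" for e
    using that r0(2) K'(2)[of e] unfolding Z_def by auto
  have eq: "image_graph (\<lambda>v. if v \<in> {x, y} then x else v) E = image_graph (id(y := x)) E"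
    by (rule arg_cong[where f = "\<lambda>f. image_graph f E"]) auto
  have xyY: "{x, y} \<subseteq> V" "x \<in> {x, y}" using xyV by auto
  obtain K2 where "drawing (insert x (V - {x, y})) (image_graph (id(y := x)) E) (p(y := g \<delta>, x := p x)) K2"
    using drawing_collapse[OF sg K'(1) xyY A B C'] unfolding eq by metis
  moreover have "insert x (V - {x, y}) = V - {y}" using xyV by auto
  ultimately show "planar (V - {y}) (image_graph (id(y := x)) E)"
    using planar_iff_drawing[OF sg'] by metis
qed

section \<open>Joining and gluing planar graphs\<close>

lemma drawing_image_closed:
  assumes "simple_graph V E" "finite V" "drawing V E p K"
  shows "compact (p ` V \<union> \<Union> (K ` E))"
proof -
  have "compact (K e)" if eE: "e \<in> E" for e
  proof -
    obtain u w where "e = {u, w}" using simple_graph_edgeE[OF assms(1) eE] by metis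
    then show ?thesis using drawing_arc[OF assms(3)] eE arc_on_compact by metis
  qed
  then show ?thesis using assms finite_edges[OF assms(1,2)]
    by (intro compact_Un compact_UN) (auto intro: finite_imp_compact)
qed

text \<open>A collapse of the single vertex \<open>x\<close> straightens its edges into radii of a
  small disc and keeps all other edges out of it. These are finitely many radii among infinitely
  many directions, so some radius is free.\<close>

lemma planar_free_direction:
  assumes sg: "simple_graph V E" and fin: "finite V" and pl: "planar V E" and x: "x \<in> V"
  obtains p K u where "drawing V E p K" "u \<noteq> 0"
    "closed_segment (p x) (p x + u) \<inter> (p ` V \<union> \<Union> (K ` E)) = {p x}"
proof -
  obtain p K where d: "drawing V E p K" using planar_iff_drawing[OF sg] pl by blast
  have finE: "finite E" using finite_edges sg fin by blast
  define Z where "Z = p ` (V - {x}) \<union> \<Union> (K ` {e \<in> E. x \<notin> e})"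
  have sub: "e \<subseteq> V" if "e \<in> E" for e using sg that unfolding simple_graph_def by blast
  have "closed Z"
    using drawing_image_closed[of "V - {x}" "{e \<in> E. x \<notin> e}" p K] sg fin drawing_subgraph[OF d]
    unfolding Z_def simple_graph_def by (auto simp: subset_insert intro!: compact_imp_closed)
  moreover have "p x \<notin> Z"
  proof -
    have "p x \<notin> K e" if "e \<in> E" "x \<notin> e" for e
    proof
      assume "p x \<in> K e"
      then have "p x \<in> p ` e" using drawing_vertices[OF d that(1)] x by blast
      then show False using drawing_inj[OF d] sub[OF that(1)] x that(2) by (metis imageE inj_onD subsetD)
    qed
    then show ?thesis unfolding Z_def using drawing_inj[OF d] x by (auto simp: inj_on_def)
  qed
  ultimately obtain r where r: "r > 0" "cball (p x) r \<subseteq> - Z"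
    using open_contains_cball[of "- Z"] by blast
  have A: "p y \<in> ball (p x) r" if "y \<in> {x}" for y using that r by simp
  have B: "p v \<notin> cball (p x) r" if "v \<in> V - {x}" for v using that r(2) unfolding Z_def by blast
  have C: "K e \<inter> cball (p x) r = {}" if "e \<in> E" "e \<inter> {x} = {}" for e
    using that r(2) unfolding Z_def by auto
  have eq: "image_graph (\<lambda>v. if v \<in> {x} then x else v) E = E"
  proof -
    have "(\<lambda>v. if v \<in> {x} then x else v) = id" by auto
    then show ?thesis using sg unfolding image_graph_def simple_graph_def by auto
  qed
  have Y: "{x} \<subseteq> V" "x \<in> {x}" using x by auto
  obtain K' where K': "drawing (insert x (V - {x})) E (p(x := p x)) K'"
      "\<And>e. e \<in> E \<Longrightarrow> e \<inter> {x} = {} \<Longrightarrow> K' e = K e"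
      "\<And>e. e \<in> E \<Longrightarrow> x \<in> e \<Longrightarrow> \<exists>h. dist (p x) h = r \<and> K' e \<inter> cball (p x) r = closed_segment (p x) h"
    using drawing_collapse[OF sg d Y A B C] unfolding eq by metis
  have d': "drawing V E p K'" using K'(1) x by (simp add: insert_absorb)
  obtain H where H: "\<And>e. e \<in> E \<Longrightarrow> x \<in> e \<Longrightarrow> dist (p x) (H e) = r \<and> K' e \<inter> cball (p x) r = closed_segment (p x) (H e)"
    using K'(3) by metis
  have "infinite (sphere (p x) r)"
  proof
    assume "finite (sphere (p x) r)"
    moreover have "connected (sphere (p x) r)" by (rule connected_sphere) simp
    moreover have "p x + of_real r \<in> sphere (p x) r" "p x - of_real r \<in> sphere (p x) r"
      using r by (auto simp: dist_norm)
    ultimately have "p x + of_real r = p x - of_real r" by (metis connected_finite_iff_sing empty_iff singletonD)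
    then show False using r by simp
  qed
  then obtain h where h: "h \<in> sphere (p x) r" "h \<notin> H ` E"
    using finE by (metis finite_imageI finite_subset subsetI)
  have hr: "dist (p x) h = r" using h by simp
  have seg: "closed_segment (p x) h \<subseteq> cball (p x) r" using radius_subset[OF hr] .
  have "z = p x" if z: "z \<in> closed_segment (p x) h" "z \<in> p ` V \<union> \<Union> (K' ` E)" for z
  proof (rule ccontr)
    assume ne: "z \<noteq> p x"
    have zc: "z \<in> cball (p x) r" using z seg by blast
    then have "z \<notin> p ` V" using B ne by auto
    then obtain e where e: "e \<in> E" "z \<in> K' e" using z by blast
    have "x \<in> e"
    proof (rule ccontr)
      assume "x \<notin> e"
      then show False using C[OF e(1)] K'(2)[OF e(1)] e zc by auto
    qed
    then have "z \<in> closed_segment (p x) (H e)" using H[OF e(1)] e zc by blast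
    then have "h = H e" using radii_inter[OF r(1) hr _ z(1)] H[OF e(1) \<open>x \<in> e\<close>] ne by blast
    then show False using h e by blast
  qed
  moreover have "p x \<in> p ` V" using x by blast
  ultimately have "closed_segment (p x) h \<inter> (p ` V \<union> \<Union> (K' ` E)) = {p x}" by auto
  then show thesis using that[OF d', of "h - p x"] hr r by auto
qed

text \<open>Inversion about the far end \<open>q\<close> of a free segment at \<open>x\<close> sends
  \<open>q\<close> to infinity and the segment to a ray in direction \<open>- 1 / u\<close>.\<close>

lemma planar_free_ray:
  assumes sg: "simple_graph V E" and fin: "finite V" and pl: "planar V E" and x: "x \<in> V"
  obtains p K w where "drawing V E p K" "w \<noteq> 0" "\<forall>s>0. p x + of_real s * w \<notin> p ` V \<union> \<Union> (K ` E)"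
proof -
  obtain p K u where d: "drawing V E p K" and u: "u \<noteq> 0"
    and free: "closed_segment (p x) (p x + u) \<inter> (p ` V \<union> \<Union> (K ` E)) = {p x}"
    using planar_free_direction[OF assms] .
  define q where "q = p x + u"
  let ?S = "p ` V \<union> \<Union> (K ` E)"
  define f where "f z = 1 / (z - q)" for z :: complex
  have "q \<in> closed_segment (p x) (p x + u)" "q \<noteq> p x" unfolding q_def using u by auto
  then have qS: "q \<notin> ?S" using free by blast
  have cont: "continuous_on (- {q}) f" unfolding f_def by (intro continuous_intros) auto
  have inj: "inj_on f (- {q})" unfolding f_def inj_on_def by (auto simp: field_simps)
  have d': "drawing V E (f \<circ> p) (\<lambda>e. f ` K e)"
    using drawing_map[OF sg d cont inj] qS by blast
  have S': "(f \<circ> p) ` V \<union> \<Union> ((\<lambda>e. f ` K e) ` E) = f ` ?S" by auto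
  have fx: "f (p x) = - 1 / u" unfolding f_def q_def using u by simp
  have "(f \<circ> p) x + of_real s * (- 1 / u) \<notin> f ` ?S" if s: "s > 0" for s
  proof
    assume "(f \<circ> p) x + of_real s * (- 1 / u) \<in> f ` ?S"
    then obtain z where z: "z \<in> ?S" "f z = (f \<circ> p) x + of_real s * (- 1 / u)" by (metis imageE)
    have "f z = - 1 / u + of_real s * (- 1 / u)" using z(2) fx by simp
    also have "\<dots> = - (1 + of_real s) / u" using u by (simp add: divide_simps)
    finally have fz: "f z = - (1 + of_real s) / u" .
    have zq: "z \<noteq> q" using z qS by blast
    have ne: "(1 + of_real s :: complex) \<noteq> 0" using s by (metis add_pos_pos less_irrefl of_real_0 of_real_1 of_real_add of_real_eq_iff zero_less_one)
    have "z - q = - u / (1 + of_real s)"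
      using fz zq ne u unfolding f_def by (simp add: field_simps)
    then have zz: "z = p x + of_real (s / (1 + s)) * u"
      using ne unfolding q_def by (simp add: field_simps)
    then have "z \<in> closed_segment (p x) (p x + u)"
      unfolding in_segment using s
      by (intro exI[of _ "s / (1 + s)"]) (simp add: scaleR_conv_of_real algebra_simps add_divide_distrib)
    moreover have "z \<noteq> p x" using zz u s ne by simp
    ultimately show False using free z(1) by blast
  qed
  then show thesis using that[OF d', of "- 1 / u"] u unfolding S' by auto
qed

text \<open>The first drawing offers a free segment from \<open>p1 x\<close> to \<open>q\<close>,
  the second a free ray at \<open>y\<close>. A similarity \<open>f\<close> shrinks the second
  drawing into a disc about \<open>q\<close> that the first one misses, puts \<open>y\<close> at
  \<open>q\<close> and turns the free ray back along the segment, which then serves as the new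
  edge.\<close>

lemma planar_bridge:
  assumes s1: "simple_graph V1 E1" "finite V1" "planar V1 E1" and s2: "simple_graph V2 E2" "finite V2" "planar V2 E2"
    and dj: "V1 \<inter> V2 = {}" and xy: "x \<in> V1" "y \<in> V2"
  shows "simple_graph (V1 \<union> V2) (insert {x, y} (E1 \<union> E2))"
    and "planar (V1 \<union> V2) (insert {x, y} (E1 \<union> E2))"
proof -
  have xney: "x \<noteq> y" using dj xy by blast
  show sg: "simple_graph (V1 \<union> V2) (insert {x, y} (E1 \<union> E2))"
    using s1 s2 xy xney unfolding simple_graph_def by auto
  obtain p1 K1 u where d1: "drawing V1 E1 p1 K1" and u: "u \<noteq> 0"
    and free1: "closed_segment (p1 x) (p1 x + u) \<inter> (p1 ` V1 \<union> \<Union> (K1 ` E1)) = {p1 x}"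
    using planar_free_direction[OF s1 xy(1)] .
  obtain p2 K2 w where d2: "drawing V2 E2 p2 K2" and w: "w \<noteq> 0"
    and free2: "\<forall>s>0. p2 y + of_real s * w \<notin> p2 ` V2 \<union> \<Union> (K2 ` E2)"
    using planar_free_ray[OF s2 xy(2)] .
  let ?S1 = "p1 ` V1 \<union> \<Union> (K1 ` E1)" and ?S2 = "p2 ` V2 \<union> \<Union> (K2 ` E2)"
  define q where "q = p1 x + u"
  have "q \<in> closed_segment (p1 x) (p1 x + u)" "q \<noteq> p1 x" unfolding q_def using u by auto
  then have "q \<notin> ?S1" using free1 by blast
  moreover have "closed ?S1" using drawing_image_closed[OF s1(1,2) d1] compact_imp_closed by blast
  ultimately obtain r where r: "r > 0" "ball q r \<subseteq> - ?S1"
    using open_contains_ball[of "- ?S1"] by blast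
  obtain B where B: "B > 0" "\<And>z. z \<in> ?S2 \<Longrightarrow> cmod (z - p2 y) < B"
  proof -
    have "bounded ((\<lambda>z. z - p2 y) ` ?S2)"
      using drawing_image_closed[OF s2(1,2) d2] compact_imp_bounded bounded_translation_minus by blast
    then obtain B where "B > 0" "\<forall>z\<in>(\<lambda>z. z - p2 y) ` ?S2. cmod z < B"
      by (metis bounded_pos_less)
    then show thesis using that by blast
  qed
  \<comment> \<open>The factor \<open>l\<close> turns the direction \<open>w\<close> into that of
    \<open>- u\<close>, and \<open>k\<close> makes \<open>cmod l\<close> times \<open>B\<close>
    equal to \<open>r\<close>, so that the second drawing lands in the disc of radius
    \<open>r\<close>.\<close>
  define k where "k = r / (B * cmod u / cmod w)"
  have k: "k > 0" using r B u w unfolding k_def by simp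
  define l where "l = - of_real k * u / w"
  have l: "l \<noteq> 0" using k u w unfolding l_def by simp
  have lB: "cmod l * B = r" using k u w B(1) r(1) unfolding l_def by (simp add: norm_mult norm_divide k_def)
  define f where "f z = q + l * (z - p2 y)" for z
  have cont: "continuous_on UNIV f" unfolding f_def by (intro continuous_intros)
  have inj: "inj_on f UNIV" unfolding f_def inj_on_def using l by auto
  have d2': "drawing V2 E2 (f \<circ> p2) (\<lambda>e. f ` K2 e)"
    using drawing_map[OF s2(1) d2 cont inj] by blast
  have fS2: "f ` ?S2 \<subseteq> ball q r"
  proof
    fix z assume "z \<in> f ` ?S2"
    then obtain z' where z': "z' \<in> ?S2" "z = f z'" by blast
    have "cmod l * cmod (z' - p2 y) < cmod l * B" using B(2)[OF z'(1)] l by simp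
    then show "z \<in> ball q r" using lB z'(2) unfolding f_def by (simp add: dist_norm norm_mult)
  qed
  have fy: "f (p2 y) = q" unfolding f_def by simp
  \<comment> \<open>A point of the segment other than \<open>q\<close> pulls back under
    \<open>f\<close> to a point of the free ray at \<open>p2 y\<close>, so the second drawing does
    not cover it.\<close>
  have segf: "closed_segment (p1 x) q \<inter> f ` ?S2 \<subseteq> {q}"
  proof
    fix z assume z: "z \<in> closed_segment (p1 x) q \<inter> f ` ?S2"
    then have "z \<in> closed_segment (p1 x) (p1 x + u)" unfolding q_def by blast
    then obtain t where t: "t \<le> 1" "z = q - of_real (1 - t) * u"
      unfolding in_segment q_def by (auto simp: scaleR_conv_of_real algebra_simps)
    obtain z' where z': "z' \<in> ?S2" "z = q + l * (z' - p2 y)" using z unfolding f_def by blast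
    have "t = 1"
    proof (rule ccontr)
      assume "t \<noteq> 1"
      then have pos: "(1 - t) / k > 0" using t k by simp
      have "l * (z' - p2 y) = - of_real (1 - t) * u" using t z' by (metis add_diff_cancel_left' diff_conv_add_uminus mult_minus_left)
      then have "z' - p2 y = (- of_real (1 - t) * u) / l" using l by (metis nonzero_mult_div_cancel_left)
      also have "\<dots> = of_real ((1 - t) / k) * w"
        using u w k unfolding l_def by (simp add: divide_simps) (simp add: algebra_simps)
      finally have "z' - p2 y = of_real ((1 - t) / k) * w" .
      then have "z' = p2 y + of_real ((1 - t) / k) * w" by (simp add: algebra_simps)
      then show False using free2 pos z'(1) by blast
    qed
    then show "z \<in> {q}" using t by simp
  qed
  define p where "p v = (if v \<in> V1 then p1 v else f (p2 v))" for v
  define K where "K e = (if e \<in> E1 then K1 e else if e \<in> E2 then f ` K2 e else closed_segment (p1 x) q)" for e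
  have p1: "p v = p1 v" if "v \<in> V1" for v using that unfolding p_def by simp
  have p2: "p v = f (p2 v)" if "v \<in> V2" for v using that dj unfolding p_def by auto
  have e1: "e \<subseteq> V1" "e \<noteq> {}" if "e \<in> E1" for e using that s1(1) unfolding simple_graph_def by auto
  have e2: "e \<subseteq> V2" "e \<noteq> {}" if "e \<in> E2" for e using that s2(1) unfolding simple_graph_def by auto
  have E12: "e \<notin> E2" if "e \<in> E1" for e using e1[OF that] e2[of e] dj by blast
  have xyE: "{x, y} \<notin> E1" "{x, y} \<notin> E2" using e1[of "{x, y}"] e2[of "{x, y}"] xy dj by auto
  have KE1: "K e = K1 e" if "e \<in> E1" for e using that unfolding K_def by simp
  have KE2: "K e = f ` K2 e" if "e \<in> E2" for e using that E12 unfolding K_def by auto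
  have Kxy: "K {x, y} = closed_segment (p1 x) q" using xyE unfolding K_def by simp
  have pe1: "p ` e = p1 ` e" if "e \<subseteq> V1" for e using that p1 by (auto simp: subset_iff image_iff)
  have pe2: "p ` e = (f \<circ> p2) ` e" if "e \<subseteq> V2" for e using that p2 by (auto simp: subset_iff image_iff)
  have px: "p x = p1 x" "p y = q" using p1 p2 xy fy by auto
  have in1: "p ` V1 \<subseteq> ?S1" "\<And>e. e \<in> E1 \<Longrightarrow> K e \<subseteq> ?S1" using pe1[of V1] KE1 by auto
  have in2: "p ` V2 \<subseteq> f ` ?S2" "\<And>e. e \<in> E2 \<Longrightarrow> K e \<subseteq> f ` ?S2"
    using pe2[of V2] KE2 by (auto simp: image_image)
  have S12: "?S1 \<inter> f ` ?S2 = {}" using fS2 r(2) by blast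
  have free1': "closed_segment (p1 x) q \<inter> ?S1 = {p1 x}" using free1 unfolding q_def .
  have dr: "drawing (V1 \<union> V2) (insert {x, y} (E1 \<union> E2)) p K"
    unfolding drawing_def
  proof (intro conjI allI impI ballI)
    have "inj_on p V1" using drawing_inj[OF d1] p1 by (simp add: inj_on_def)
    moreover have "inj_on p V2" using drawing_inj[OF d2'] p2 by (simp add: inj_on_def)
    moreover have "p ` V1 \<inter> p ` V2 = {}" using in1(1) in2(1) S12 by blast
    ultimately show "inj_on p (V1 \<union> V2)" by (simp add: inj_on_Un) blast
  next
    fix a b assume ab: "{a, b} \<in> insert {x, y} (E1 \<union> E2)"
    then consider "{a, b} = {x, y}" | "{a, b} \<in> E1" | "{a, b} \<in> E2" by blast
    then show "arc_on (K {a, b}) (p a) (p b)"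
    proof cases
      case 1
      have A: "arc_on (K {x, y}) (p x) (p y)" using Kxy px \<open>q \<noteq> p1 x\<close> arc_on_segment by metis
      from 1 have "a = x \<and> b = y \<or> a = y \<and> b = x" by (auto simp: doubleton_eq_iff)
      then show ?thesis using A arc_on_sym 1 by auto
    next
      case 2
      then show ?thesis using drawing_arc[OF d1 2] KE1 p1 e1(1)[OF 2] by simp
    next
      case 3
      then show ?thesis using drawing_arc[OF d2' 3] KE2 p2 e2(1)[OF 3] by simp
    qed
  next
    fix e assume "e \<in> insert {x, y} (E1 \<union> E2)"
    then consider "e = {x, y}" | "e \<in> E1" | "e \<in> E2" by blast
    then show "K e \<inter> p ` (V1 \<union> V2) \<subseteq> p ` e"
    proof cases
      case 1
      have "closed_segment (p1 x) q \<inter> p ` V1 \<subseteq> {p1 x}" using free1' in1(1) by blast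
      moreover have "closed_segment (p1 x) q \<inter> p ` V2 \<subseteq> {q}" using segf in2(1) by blast
      ultimately show ?thesis using 1 Kxy px by auto
    next
      case 2
      have "K e \<inter> p ` V2 = {}" using in1(2)[OF 2] in2(1) S12 by blast
      then show ?thesis using drawing_vertices[OF d1 2] KE1[OF 2] pe1[of V1] pe1[OF e1(1)[OF 2]]
        by (simp add: image_Un Int_Un_distrib)
    next
      case 3
      have "K e \<inter> p ` V1 = {}" using in2(2)[OF 3] in1(1) S12 by blast
      then show ?thesis using drawing_vertices[OF d2' 3] KE2[OF 3] pe2[of V2] pe2[OF e2(1)[OF 3]]
        by (simp add: image_Un Int_Un_distrib)
    qed
  next
    fix e g assume "e \<in> insert {x, y} (E1 \<union> E2)" "g \<in> insert {x, y} (E1 \<union> E2)" and ne: "e \<noteq> g"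
    have c1: "K {x, y} \<inter> K e \<subseteq> p ` ({x, y} \<inter> e)" if "e \<in> E1" for e
    proof -
      have A: "K {x, y} \<inter> K e \<subseteq> {p1 x}" using free1' Kxy in1(2)[OF that] by blast
      have "x \<in> e" if "p1 x \<in> K e"
      proof -
        have "p1 x \<in> p1 ` e"
          using subsetD[OF drawing_vertices[OF d1 \<open>e \<in> E1\<close>]] KE1[OF \<open>e \<in> E1\<close>] that xy(1) by (metis IntI imageI)
        then show ?thesis using inj_on_image_mem_iff[OF drawing_inj[OF d1] xy(1) e1(1)[OF \<open>e \<in> E1\<close>]] by blast
      qed
      then show ?thesis using A px by auto
    qed
    have c2: "K {x, y} \<inter> K e \<subseteq> p ` ({x, y} \<inter> e)" if "e \<in> E2" for e
    proof -
      have A: "K {x, y} \<inter> K e \<subseteq> {q}" unfolding Kxy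
        by (rule subset_trans[OF Int_mono[OF order_refl in2(2)[OF that]] segf])
      have "y \<in> e" if "q \<in> K e"
      proof -
        have "(f \<circ> p2) y \<in> f ` K2 e" using KE2[OF \<open>e \<in> E2\<close>] that fy by (metis comp_apply)
        then have "(f \<circ> p2) y \<in> (f \<circ> p2) ` e"
          using subsetD[OF drawing_vertices[OF d2' \<open>e \<in> E2\<close>]] xy(2) by (metis IntI imageI)
        then show ?thesis using inj_on_image_mem_iff[OF drawing_inj[OF d2'] xy(2) e2(1)[OF \<open>e \<in> E2\<close>]] by blast
      qed
      then show ?thesis using A px by auto
    qed
    have c12: "K e \<inter> K g = {}" if "e \<in> E1" "g \<in> E2" for e g
      using in1(2)[OF that(1)] in2(2)[OF that(2)] S12 by blast
    consider "e = {x, y}" "g \<in> E1 \<or> g \<in> E2" | "g = {x, y}" "e \<in> E1 \<or> e \<in> E2" | "e \<in> E1" "g \<in> E1" | "e \<in> E2" "g \<in> E2"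
      | "e \<in> E1" "g \<in> E2" | "e \<in> E2" "g \<in> E1"
      using \<open>e \<in> _\<close> \<open>g \<in> _\<close> ne by blast
    then show "K e \<inter> K g \<subseteq> p ` (e \<inter> g)"
    proof cases
      case 1
      then show ?thesis using c1 c2 by blast
    next
      case 2
      then show ?thesis using c1[of e] c2[of e] by (auto simp: Int_commute)
    next
      case 3
      then show ?thesis using drawing_edges[OF d1 3 ne] KE1 pe1[of "e \<inter> g"] e1(1) by (simp add: le_infI1)
    next
      case 4
      then show ?thesis using drawing_edges[OF d2' 4 ne] KE2 pe2[of "e \<inter> g"] e2(1) by (simp add: le_infI1)
    next
      case 5
      then show ?thesis using c12 by blast
    next
      case 6
      then show ?thesis using c12 by blast
    qed
  qed
  then show "planar (V1 \<union> V2) (insert {x, y} (E1 \<union> E2))" using planar_iff_drawing[OF sg] by blast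
qed

text \<open>The shared vertex is split: its copy in the second graph is renamed to a fresh
  \<open>v'\<close>, the two graphs are bridged by \<open>{v, v'}\<close>, and this edge is
  contracted. Finite sets of natural numbers always leave such a fresh name.\<close>

lemma planar_glue:
  fixes V1 V2 :: "nat set"
  assumes s1: "simple_graph V1 E1" "finite V1" "planar V1 E1" and s2: "simple_graph V2 E2" "finite V2" "planar V2 E2"
    and v: "V1 \<inter> V2 = {v}"
  shows "planar (V1 \<union> V2) (E1 \<union> E2)"
proof -
  obtain v' where v': "v' \<notin> V1 \<union> V2"
    using s1(2) s2(2) by (metis ex_new_if_finite finite_UnI infinite_UNIV_nat)
  have vv: "v \<in> V1" "v \<in> V2" "v \<noteq> v'" using v v' by auto
  define f where "f = id(v := v')"
  have inj: "inj_on f V2" using v' unfolding f_def inj_on_def by auto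
  have fV2: "f ` V2 = insert v' (V2 - {v})" using vv unfolding f_def by auto
  have dj: "V1 \<inter> f ` V2 = {}" using v v' vv unfolding fV2 by auto
  note r = planar_relabel[OF s2(1,3) inj]
  have fin: "finite (V1 \<union> f ` V2)" using s1 s2 by simp
  have v'V2: "v' \<in> f ` V2" using fV2 by simp
  note b = planar_bridge[OF s1 r(1) finite_imageI[OF s2(2)] r(2) dj vv(1) v'V2]
  note c = planar_contract[OF b(1) fin b(2), of v v', simplified]
  define g where "g = id(v' := v)"
  have gV: "g ` e = e" if "e \<subseteq> V1" for e using that v' unfolding g_def by (force simp: image_iff)
  have gf: "g ` f ` e = e" if "e \<subseteq> V2" for e
  proof -
    have "g (f z) = z" if "z \<in> V2" for z using that v' unfolding g_def f_def by auto
    then show ?thesis using that by force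
  qed
  have sub1: "e \<subseteq> V1" "card e = 2" if "e \<in> E1" for e using s1(1) that unfolding simple_graph_def by auto
  have sub2: "e \<subseteq> V2" "card e = 2" if "e \<in> E2" for e using s2(1) that unfolding simple_graph_def by auto
  have "E1 \<subseteq> image_graph g (insert {v, v'} (E1 \<union> (`) f ` E2))"
  proof
    fix e assume "e \<in> E1"
    then have "e \<in> insert {v, v'} (E1 \<union> (`) f ` E2)" "e = g ` e" "card (g ` e) = 2" using gV sub1 by auto
    then show "e \<in> image_graph g (insert {v, v'} (E1 \<union> (`) f ` E2))"
      unfolding image_graph_def by blast
  qed
  moreover have "E2 \<subseteq> image_graph g (insert {v, v'} (E1 \<union> (`) f ` E2))"
  proof
    fix e assume "e \<in> E2"
    then have "f ` e \<in> (`) f ` E2" "e = g ` f ` e" "card (g ` f ` e) = 2" using gf sub2 by auto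
    then show "e \<in> image_graph g (insert {v, v'} (E1 \<union> (`) f ` E2))"
      unfolding image_graph_def by blast
  qed
  moreover have "V1 \<union> f ` V2 - {v'} = V1 \<union> V2" using vv v' unfolding fV2 by auto
  moreover have "simple_graph (V1 \<union> V2) (E1 \<union> E2)" using s1 s2 unfolding simple_graph_def by blast
  ultimately show ?thesis
    using planar_subgraph[OF c(1,2), of "V1 \<union> V2" "E1 \<union> E2"] unfolding g_def by simp
qed

section \<open>The complete graph on five vertices and the double fan\<close>

lemma theta_split:
  assumes "arc_on S1 a b" "arc_on S2 a b" "arc_on S a b"
    and "S1 \<inter> S2 = {a, b}" "S1 \<inter> S = {a, b}" "S2 \<inter> S = {a, b}" "S \<inter> inside (S1 \<union> S2) \<noteq> {}"
  shows "inside (S1 \<union> S) \<union> inside (S2 \<union> S) \<union> (S - {a, b}) = inside (S1 \<union> S2)"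
proof -
  obtain g1 g2 g where g: "arc g1" "path_image g1 = S1" "pathstart g1 = a" "pathfinish g1 = b"
     "arc g2" "path_image g2 = S2" "pathstart g2 = a" "pathfinish g2 = b"
     "arc g" "path_image g = S" "pathstart g = a" "pathfinish g = b"
    using assms(1-3) unfolding arc_on_def by metis
  have "a \<noteq> b" using arc_on_ends[OF assms(1)] by blast
  then show ?thesis
    using split_inside_simple_closed_curve[of g1 a b g2 g] g assms arc_imp_simple_path by metis
qed

lemma jordan_arcs:
  assumes "arc_on S1 a b" "arc_on S2 a b" "S1 \<inter> S2 = {a, b}"
  shows "inside (S1 \<union> S2) \<noteq> {}" "open (inside (S1 \<union> S2))" "open (outside (S1 \<union> S2))"
    "connected (outside (S1 \<union> S2))" "\<not> bounded (outside (S1 \<union> S2))"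
    "inside (S1 \<union> S2) \<inter> outside (S1 \<union> S2) = {}" "inside (S1 \<union> S2) \<union> outside (S1 \<union> S2) = - (S1 \<union> S2)"
proof -
  obtain g1 g2 where g: "arc g1" "path_image g1 = S1" "pathstart g1 = a" "pathfinish g1 = b"
     "arc g2" "path_image g2 = S2" "pathstart g2 = b" "pathfinish g2 = a"
    using assms(1) arc_on_sym[OF assms(2)] unfolding arc_on_def by metis
  have sp: "simple_path (g1 +++ g2)"
    using g assms(3) by (intro simple_path_join_loop) auto
  have im: "path_image (g1 +++ g2) = S1 \<union> S2" using g by (simp add: path_image_join)
  have cl: "pathfinish (g1 +++ g2) = pathstart (g1 +++ g2)" using g by simp
  show "inside (S1 \<union> S2) \<noteq> {}" "open (inside (S1 \<union> S2))" "open (outside (S1 \<union> S2))"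
    "connected (outside (S1 \<union> S2))" "\<not> bounded (outside (S1 \<union> S2))"
    "inside (S1 \<union> S2) \<inter> outside (S1 \<union> S2) = {}" "inside (S1 \<union> S2) \<union> outside (S1 \<union> S2) = - (S1 \<union> S2)"
    using Jordan_inside_outside[OF sp cl] unfolding im by blast+
qed

lemma connected_subset_inside:
  assumes "connected X" "X \<inter> C = {}" "x \<in> X" "x \<in> inside C"
  shows "X \<subseteq> inside C"
proof
  fix y assume "y \<in> X"
  then have "connected_component (- C) x y"
    using assms unfolding connected_component_def by (intro exI[of _ X]) auto
  then show "y \<in> inside C" using inside_same_component assms(4) by blast
qed

lemma connected_subset_outside:
  assumes "connected X" "X \<inter> C = {}" "x \<in> X" "x \<in> outside C"
  shows "X \<subseteq> outside C"
proof
  fix y assume "y \<in> X"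
  then have "connected_component (- C) x y"
    using assms unfolding connected_component_def by (intro exI[of _ X]) auto
  then show "y \<in> outside C" using outside_same_component assms(4) by blast
qed

lemma arc_on_minus_end:
  assumes "arc_on S a b"
  shows "connected (S - {a})"
proof -
  obtain g where g: "arc g" "path_image g = S" "pathstart g = a" "pathfinish g = b"
    using assms unfolding arc_on_def by blast
  have "S - {a} = g ` {0<..1}"
  proof -
    have "S = g ` {0..1}" "a = g 0" using g by (auto simp: path_image_def pathstart_def)
    moreover have "{0..1} = insert 0 {0<..(1::real)}" by auto
    moreover have "g 0 \<notin> g ` {0<..1}" using inj_onD[OF arc_imp_inj_on[OF g(1)], of 0] by force
    ultimately show ?thesis by auto
  qed
  moreover have "continuous_on {0<..1} g"
    using arc_imp_path[OF g(1)] unfolding path_def by (rule continuous_on_subset) auto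
  ultimately show ?thesis using connected_continuous_image by fastforce
qed

lemma drawing_adjacent_edges:
  assumes "drawing V E p K" "{u, w} \<in> E" "{u, w'} \<in> E" "w \<noteq> w'" "u \<noteq> w" "u \<noteq> w'"
  shows "K {u, w} \<inter> K {u, w'} = {p u}"
proof -
  have "K {u, w} \<inter> K {u, w'} \<subseteq> p ` ({u, w} \<inter> {u, w'})"
    using assms by (intro drawing_edges[OF assms(1-3)]) (auto simp: doubleton_eq_iff)
  also have "\<dots> = {p u}" using assms by auto
  finally show ?thesis
    using arc_on_ends[OF drawing_arc[OF assms(1,2)]] arc_on_ends[OF drawing_arc[OF assms(1,3)]] by auto
qed

lemma drawing_disjoint_edges:
  assumes "drawing V E p K" "{u, w} \<in> E" "{x, y} \<in> E" "{u, w} \<inter> {x, y} = {}"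
  shows "K {u, w} \<inter> K {x, y} = {}"
proof -
  have "K {u, w} \<inter> K {x, y} \<subseteq> p ` ({u, w} \<inter> {x, y})"
    using assms(4) by (intro drawing_edges[OF assms(1-3)]) auto
  then show ?thesis using assms(4) by simp
qed

definition pairs :: "'a set \<Rightarrow> 'a set set" where
  "pairs U = {{u, w} |u w. u \<in> U \<and> w \<in> U \<and> u \<noteq> w}"

lemma pairsI: "u \<in> U \<Longrightarrow> w \<in> U \<Longrightarrow> u \<noteq> w \<Longrightarrow> {u, w} \<in> pairs U"
  unfolding pairs_def by blast

lemma simple_graph_pairs: "simple_graph U (pairs U)"
  unfolding pairs_def simple_graph_def by auto

text \<open>The path over \<open>d\<close> splits the interior of the triangle on \<open>x\<close>,
  \<open>y\<close>, \<open>z\<close>. If \<open>e\<close> were in the part bounded by the cycle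
  through \<open>x\<close>, \<open>d\<close>, \<open>y\<close>, the edge from \<open>e\<close> to
  \<open>z\<close> could not leave this part, and \<open>z\<close> would be inside the triangle
  instead of on it.\<close>

lemma K5_face_empty:
  assumes d: "drawing U (pairs U) p K" and U: "distinct [x, y, z, d, e]" "set [x, y, z, d, e] \<subseteq> U"
    and din: "p d \<in> inside (K {x, y} \<union> (K {x, z} \<union> K {z, y}))"
  shows "p e \<notin> inside (K {x, y} \<union> (K {x, d} \<union> K {d, y}))"
    and "inside (K {x, y} \<union> (K {x, d} \<union> K {d, y})) \<union> inside ((K {x, z} \<union> K {z, y}) \<union> (K {x, d} \<union> K {d, y}))
       \<union> ((K {x, d} \<union> K {d, y}) - {p x, p y}) = inside (K {x, y} \<union> (K {x, z} \<union> K {z, y}))"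
proof -
  have arc: "arc_on (K {u, w}) (p u) (p w)" if "u \<in> U" "w \<in> U" "u \<noteq> w" for u w
    using drawing_arc[OF d pairsI[OF that]] .
  have adj: "K {u, w} \<inter> K {u, w'} = {p u}" if "u \<in> U" "w \<in> U" "w' \<in> U" "distinct [u, w, w']" for u w w'
    using drawing_adjacent_edges[OF d pairsI pairsI] that by auto
  have dis: "K {u, w} \<inter> K {u', w'} = {}" if "u \<in> U" "w \<in> U" "u' \<in> U" "w' \<in> U" "distinct [u, w, u', w']" for u w u' w'
    by (rule drawing_disjoint_edges[OF d pairsI pairsI]) (use that in auto)
  have comm: "K {u, w} = K {w, u}" for u w by (simp add: insert_commute)
  have V: "x \<in> U" "y \<in> U" "z \<in> U" "d \<in> U" "e \<in> U" using U by auto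
  have via: "arc_on (K {x, t} \<union> K {t, y}) (p x) (p y)" if "t \<in> U" "t \<noteq> x" "t \<noteq> y" for t
    using that V U adj[of t x y] comm[of x t] by (intro arc_on_join[OF arc arc]) auto
  have i1: "K {x, y} \<inter> (K {x, t} \<union> K {t, y}) = {p x, p y}" if "t \<in> U" "t \<noteq> x" "t \<noteq> y" for t
    using that V U adj[of x y t] adj[of y x t] comm[of x y] comm[of t y] by auto
  have i2: "(K {x, z} \<union> K {z, y}) \<inter> (K {x, d} \<union> K {d, y}) = {p x, p y}"
    using V U adj[of x z d] adj[of y z d] dis[of x z d y] dis[of z y x d] comm[of z y] comm[of d y] by auto
  have "p d \<in> K {x, d}" using arc_on_ends[OF arc[of x d]] V U by auto
  then have ne: "(K {x, d} \<union> K {d, y}) \<inter> inside (K {x, y} \<union> (K {x, z} \<union> K {z, y})) \<noteq> {}"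
    using din by blast
  show spl: "inside (K {x, y} \<union> (K {x, d} \<union> K {d, y})) \<union> inside ((K {x, z} \<union> K {z, y}) \<union> (K {x, d} \<union> K {d, y}))
       \<union> ((K {x, d} \<union> K {d, y}) - {p x, p y}) = inside (K {x, y} \<union> (K {x, z} \<union> K {z, y}))"
    using theta_split[OF arc[of x y] via[of z] via[of d] i1[of z] i1[of d] i2 ne] V U by auto
  show "p e \<notin> inside (K {x, y} \<union> (K {x, d} \<union> K {d, y}))"
  proof
    assume ein: "p e \<in> inside (K {x, y} \<union> (K {x, d} \<union> K {d, y}))"
    have "K {e, z} \<subseteq> inside (K {x, y} \<union> (K {x, d} \<union> K {d, y}))"
    proof (rule connected_subset_inside)
      show "connected (K {e, z})" using arc_on_connected[OF arc[of e z]] V U by auto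
      show "K {e, z} \<inter> (K {x, y} \<union> (K {x, d} \<union> K {d, y})) = {}"
        using dis[of e z x y] dis[of e z x d] dis[of e z d y] V U by auto
      show "p e \<in> K {e, z}" using arc_on_ends[OF arc[of e z]] V U by auto
    qed (rule ein)
    then have "p z \<in> inside (K {x, y} \<union> (K {x, z} \<union> K {z, y}))"
      using spl arc_on_ends[OF arc[of e z]] V U by auto
    moreover have "p z \<in> K {x, z}" using arc_on_ends[OF arc[of x z]] V U by auto
    ultimately show False using inside_no_overlap by blast
  qed
qed

text \<open>The edges from \<open>d\<close> divide the interior of the triangle on \<open>a\<close>,
  \<open>b\<close>, \<open>c\<close> into three faces, and \<open>K5_face_empty\<close> keeps
  \<open>e\<close> out of each. That the faces exhaust the interior takes two splits: the path over
  \<open>d\<close> cuts off one face, then the edge from \<open>c\<close> to \<open>d\<close>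
  divides the rest.\<close>

lemma K5_not_both_inside:
  assumes dr: "drawing U (pairs U) p K" and U: "distinct [a, b, c, d, e]" "set [a, b, c, d, e] \<subseteq> U"
    and din: "p d \<in> inside (K {a, b} \<union> (K {a, c} \<union> K {c, b}))"
    and ein: "p e \<in> inside (K {a, b} \<union> (K {a, c} \<union> K {c, b}))"
  shows False
proof -
  have arc: "arc_on (K {u, w}) (p u) (p w)" if "u \<in> U" "w \<in> U" "u \<noteq> w" for u w
    using drawing_arc[OF dr pairsI[OF that]] .
  have adj: "K {u, w} \<inter> K {u, w'} = {p u}" if "u \<in> U" "w \<in> U" "w' \<in> U" "distinct [u, w, w']" for u w w'
    using drawing_adjacent_edges[OF dr pairsI pairsI] that by auto
  have dis: "K {u, w} \<inter> K {u', w'} = {}" if "u \<in> U" "w \<in> U" "u' \<in> U" "w' \<in> U" "distinct [u, w, u', w']" for u w u' w'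
    by (rule drawing_disjoint_edges[OF dr pairsI pairsI]) (use that in auto)
  have comm: "K {u, w} = K {w, u}" for u w by (simp add: insert_commute)
  have V: "a \<in> U" "b \<in> U" "c \<in> U" "d \<in> U" "e \<in> U" using U by auto
  define T where "T = K {a, b} \<union> (K {a, c} \<union> K {c, b})"
  have T2: "K {a, c} \<union> (K {a, b} \<union> K {b, c}) = T" unfolding T_def using comm by blast
  have T3: "K {c, b} \<union> (K {c, a} \<union> K {a, b}) = T" unfolding T_def using comm by blast
  have f1: "p e \<notin> inside (K {a, b} \<union> (K {a, d} \<union> K {d, b}))"
    using K5_face_empty(1)[OF dr, of a b c d e] U din by auto
  have f2: "p e \<notin> inside (K {a, c} \<union> (K {a, d} \<union> K {d, c}))"
    using K5_face_empty(1)[OF dr, of a c b d e] U din unfolding T2 T_def[symmetric] by auto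
  have f3: "p e \<notin> inside (K {c, b} \<union> (K {c, d} \<union> K {d, b}))"
    using K5_face_empty(1)[OF dr, of c b a d e] U din unfolding T3 T_def[symmetric] by auto
  define S where "S = K {a, d} \<union> K {d, b}"
  have spl: "inside (K {a, b} \<union> S) \<union> inside ((K {a, c} \<union> K {c, b}) \<union> S) \<union> (S - {p a, p b}) = inside T"
    using K5_face_empty(2)[OF dr, of a b c d e] U din unfolding S_def T_def by auto
  have pend: "p u \<in> K {u, w}" "p w \<in> K {u, w}" if "u \<in> U" "w \<in> U" "u \<noteq> w" for u w
    using arc_on_ends[OF arc[OF that]] by auto
  have notin: "p t \<notin> K {u, w}" if "t \<in> U" "u \<in> U" "w \<in> U" "distinct [t, u, w]" for t u w
  proof
    assume "p t \<in> K {u, w}"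
    then have "p t \<in> p ` {u, w}" using drawing_vertices[OF dr pairsI[of u U w]] that by auto
    then show False using drawing_inj[OF dr] that by (auto simp: inj_on_def)
  qed
  have eS: "p e \<notin> S" using notin[of e a d] notin[of e d b] V U unfolding S_def by auto
  then have e2: "p e \<in> inside ((K {a, c} \<union> K {c, b}) \<union> S)"
    using spl ein f1 unfolding S_def T_def by blast
  have cT: "p c \<in> T" unfolding T_def using pend[of a c] V U by auto
  have cS: "p c \<notin> K {a, b} \<union> S" unfolding S_def using notin[of c a b] notin[of c a d] notin[of c d b] V U by auto
  \<comment> \<open>The second split needs a point \<open>m\<close> of the edge from
    \<open>c\<close> to \<open>d\<close> inside the remaining part. The edge without
    \<open>c\<close> is inside the triangle; \<open>m\<close> is off the path over \<open>d\<close>,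
    and \<open>m\<close> in the first face would draw \<open>c\<close> into that face as
    well.\<close>
  have "K {c, d} - {p c} \<subseteq> inside T"
  proof (rule connected_subset_inside)
    show "connected (K {c, d} - {p c})" using arc_on_minus_end[OF arc[of c d]] V U by auto
    show "(K {c, d} - {p c}) \<inter> T = {}"
      unfolding T_def using dis[of c d a b] adj[of c d a] adj[of c d b] comm[of a c] V U by auto
    show "p d \<in> K {c, d} - {p c}" using pend[of c d] drawing_inj[OF dr] V U by (auto simp: inj_on_def)
    show "p d \<in> inside T" using din unfolding T_def .
  qed
  moreover obtain m where m: "m \<in> K {c, d}" "m \<noteq> p c" "m \<noteq> p d"
  proof -
    have "arc_on (K {c, d}) (p c) (p d)" using arc[of c d] V U by auto
    then obtain g where g: "arc g" "path_image g = K {c, d}" "pathstart g = p c" "pathfinish g = p d"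
      unfolding arc_on_def by blast
    have "g (1/2) \<in> path_image g" by (simp add: path_image_def)
    moreover have "g (1/2) \<noteq> g 0" "g (1/2) \<noteq> g 1"
      using inj_onD[OF arc_imp_inj_on[OF g(1)], of "1/2" 0] inj_onD[OF arc_imp_inj_on[OF g(1)], of "1/2" 1] by auto
    ultimately show thesis using that g by (auto simp: pathstart_def pathfinish_def)
  qed
  moreover have "m \<notin> S" unfolding S_def
    using m adj[of d c a] adj[of d c b] comm[of a d] comm[of c d] V U by auto
  moreover have "m \<notin> inside (K {a, b} \<union> S)"
  proof
    assume mi: "m \<in> inside (K {a, b} \<union> S)"
    have "K {d, c} - {p d} \<subseteq> inside (K {a, b} \<union> S)"
    proof (rule connected_subset_inside)
      show "connected (K {d, c} - {p d})" using arc_on_minus_end[OF arc[of d c]] V U by auto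
      show "(K {d, c} - {p d}) \<inter> (K {a, b} \<union> S) = {}"
        unfolding S_def using dis[of d c a b] adj[of d c a] adj[of d c b] comm[of a d] V U by auto
      show "m \<in> K {d, c} - {p d}" using m comm[of c d] by auto
    qed (rule mi)
    then have "p c \<in> inside (K {a, b} \<union> S)" using pend[of d c] drawing_inj[OF dr] V U by (auto simp: inj_on_def)
    then have "p c \<in> inside T" using spl by blast
    then show False using cT inside_no_overlap by blast
  qed
  ultimately have mC: "m \<in> inside ((K {a, c} \<union> K {c, b}) \<union> S)" using spl by blast
  have C': "(K {a, c} \<union> K {c, b}) \<union> S = (K {c, a} \<union> K {a, d}) \<union> (K {c, b} \<union> K {b, d})"
    unfolding S_def using comm[of a c] comm[of d b] by blast
  have A1: "arc_on (K {c, a} \<union> K {a, d}) (p c) (p d)"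
    using V U adj[of a c d] comm[of a c] by (intro arc_on_join[OF arc arc]) auto
  have A2: "arc_on (K {c, b} \<union> K {b, d}) (p c) (p d)"
    using V U adj[of b c d] comm[of b c] by (intro arc_on_join[OF arc arc]) auto
  have A3: "arc_on (K {c, d}) (p c) (p d)" using arc V U by auto
  have I12: "(K {c, a} \<union> K {a, d}) \<inter> (K {c, b} \<union> K {b, d}) = {p c, p d}"
    using V U adj[of c a b] adj[of d a b] dis[of c a b d] dis[of a d c b] comm[of a d] comm[of b d] by auto
  have I13: "(K {c, a} \<union> K {a, d}) \<inter> K {c, d} = {p c, p d}"
    using V U adj[of c a d] adj[of d a c] comm[of a d] comm[of c d] by auto
  have I23: "(K {c, b} \<union> K {b, d}) \<inter> K {c, d} = {p c, p d}"
    using V U adj[of c b d] adj[of d b c] comm[of b d] comm[of c d] by auto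
  have ne: "K {c, d} \<inter> inside ((K {c, a} \<union> K {a, d}) \<union> (K {c, b} \<union> K {b, d})) \<noteq> {}"
    using m mC unfolding C' by blast
  have "p e \<in> inside ((K {c, a} \<union> K {a, d}) \<union> K {c, d}) \<union> inside ((K {c, b} \<union> K {b, d}) \<union> K {c, d}) \<union> (K {c, d} - {p c, p d})"
    using theta_split[OF A1 A2 A3 I12 I13 I23 ne] e2 unfolding C' by blast
  moreover have "p e \<notin> K {c, d}" using notin V U by auto
  moreover have "(K {c, a} \<union> K {a, d}) \<union> K {c, d} = K {a, c} \<union> (K {a, d} \<union> K {d, c})"
    using comm[of a c] comm[of d c] by blast
  moreover have "(K {c, b} \<union> K {b, d}) \<union> K {c, d} = K {c, b} \<union> (K {c, d} \<union> K {d, b})"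
    using comm[of d b] by blast
  ultimately show False using f2 f3 by simp
qed

text \<open>The edge between \<open>d\<close> and \<open>e\<close> keeps both on one side of the
  triangle on \<open>a\<close>, \<open>b\<close>, \<open>c\<close>. Both inside contradicts
  \<open>K5_not_both_inside\<close>; both outside is reduced to this case by an inversion about a
  point \<open>q\<close> inside.\<close>

lemma K5_not_planar:
  assumes U: "card U = 5"
  shows "\<not> planar U (pairs U)"
proof
  assume pl: "planar U (pairs U)"
  obtain L where L: "set L = U" "distinct L" "length L = 5"
    using U by (metis card_ge_0_finite distinct_card finite_distinct_list zero_less_numeral)
  then obtain a b c d e where Le: "L = [a, b, c, d, e]"
    by (auto simp: numeral_eq_Suc length_Suc_conv)
  then have dist: "distinct [a, b, c, d, e]" and Us: "set [a, b, c, d, e] \<subseteq> U" and Ueq: "U = {a, b, c, d, e}"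
    using L by auto
  obtain p K where dr: "drawing U (pairs U) p K" using planar_iff_drawing[OF simple_graph_pairs] pl by blast
  have arc: "arc_on (K {u, w}) (p u) (p w)" if "u \<in> U" "w \<in> U" "u \<noteq> w" for u w
    using drawing_arc[OF dr pairsI[OF that]] .
  have adj: "K {u, w} \<inter> K {u, w'} = {p u}" if "u \<in> U" "w \<in> U" "w' \<in> U" "distinct [u, w, w']" for u w w'
    using drawing_adjacent_edges[OF dr pairsI pairsI] that by auto
  have dis: "K {u, w} \<inter> K {u', w'} = {}" if "u \<in> U" "w \<in> U" "u' \<in> U" "w' \<in> U" "distinct [u, w, u', w']" for u w u' w'
    by (rule drawing_disjoint_edges[OF dr pairsI pairsI]) (use that in auto)
  have comm: "K {u, w} = K {w, u}" for u w by (simp add: insert_commute)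
  have V: "a \<in> U" "b \<in> U" "c \<in> U" "d \<in> U" "e \<in> U" using Ueq by auto
  have pend: "p u \<in> K {u, w}" "p w \<in> K {u, w}" if "u \<in> U" "w \<in> U" "u \<noteq> w" for u w
    using arc_on_ends[OF arc[OF that]] by auto
  define T where "T = K {a, b} \<union> (K {a, c} \<union> K {c, b})"
  have A2: "arc_on (K {a, c} \<union> K {c, b}) (p a) (p b)"
    using V dist adj[of c a b] comm[of a c] by (intro arc_on_join[OF arc arc]) auto
  have A1: "arc_on (K {a, b}) (p a) (p b)" using arc V dist by auto
  have I: "K {a, b} \<inter> (K {a, c} \<union> K {c, b}) = {p a, p b}"
    using V dist adj[of a b c] adj[of b a c] comm[of a b] comm[of c b] by auto
  note J = jordan_arcs[OF A1 A2 I, folded T_def]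
  have deT: "K {d, e} \<inter> T = {}"
    unfolding T_def using dis[of d e a b] dis[of d e a c] dis[of d e c b] V dist by auto
  have cde: "connected (K {d, e})" using arc_on_connected[OF arc[of d e]] V dist by auto
  have dne: "p d \<in> K {d, e}" "p e \<in> K {d, e}" using pend[of d e] V dist by auto
  have "p d \<notin> inside T"
  proof
    assume din: "p d \<in> inside T"
    then have "p e \<in> inside T" using connected_subset_inside[OF cde deT dne(1)] dne(2) by blast
    then show False using K5_not_both_inside[OF dr dist Us] din unfolding T_def by blast
  qed
  then have dout: "p d \<in> outside T" using J(7) dne(1) deT by blast
  then have eout: "p e \<in> outside T" using connected_subset_outside[OF cde deT dne(1)] dne(2) by blast
  obtain q where q: "q \<in> inside T" using J(1) by blast
  have touch: "K {t, s} - {p s} \<subseteq> outside T" if "t \<in> {d, e}" "s \<in> {a, b, c}" for t s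
  proof (rule connected_subset_outside)
    have ts: "t \<in> U" "s \<in> U" "t \<noteq> s" using that V dist by auto
    show "connected (K {t, s} - {p s})" using arc_on_minus_end[OF arc[of s t]] ts comm[of s t] by auto
    show "(K {t, s} - {p s}) \<inter> T = {}"
    proof -
      have td: "t \<noteq> a" "t \<noteq> b" "t \<noteq> c" using \<open>t \<in> {d, e}\<close> dist by auto
      consider "s = a" | "s = b" | "s = c" using \<open>s \<in> {a, b, c}\<close> by blast
      then show ?thesis
      proof cases
        case 1
        then show ?thesis unfolding T_def
          using adj[of a t b] adj[of a t c] dis[of a t c b] comm[of t a] V dist td ts by auto
      next
        case 2
        then show ?thesis unfolding T_def
          using adj[of b t a] adj[of b t c] dis[of b t a c] comm[of t b] comm[of a b] comm[of c b] V dist td ts by auto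
      next
        case 3
        then show ?thesis unfolding T_def
          using adj[of c t a] adj[of c t b] dis[of c t a b] comm[of t c] comm[of a c] V dist td ts by auto
      qed
    qed
    show "p t \<in> K {t, s} - {p s}" using pend[of t s] ts drawing_inj[OF dr] by (auto simp: inj_on_def)
    show "p t \<in> outside T" using that dout eout by auto
  qed
  have qK: "q \<notin> K f" if "f \<in> pairs U" for f
  proof
    assume qf: "q \<in> K f"
    have qT: "q \<notin> T" "q \<notin> outside T" using q J(6) inside_no_overlap by blast+
    obtain u w where f: "f = {u, w}" "u \<in> U" "w \<in> U" "u \<noteq> w" using \<open>f \<in> pairs U\<close> unfolding pairs_def by blast
    have de: "q \<notin> K {d, e}" using connected_subset_outside[OF cde deT dne(1) dout] qT by blast
    have ps: "p s \<noteq> q" if "s \<in> {a, b, c}" for s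
      using that pend[of a b] pend[of a c] V dist qT unfolding T_def by auto
    have tch: "q \<notin> K {t, s}" if "t \<in> {d, e}" "s \<in> {a, b, c}" for t s
      using touch[OF that] ps[OF that(2)] qT by auto
    have inT: "K {u, w} \<subseteq> T" if "u \<in> {a, b, c}" "w \<in> {a, b, c}"
      using that f(4) unfolding T_def by (auto simp: insert_commute)
    consider "u \<in> {a, b, c}" "w \<in> {a, b, c}" | "{u, w} = {d, e}" | "u \<in> {d, e}" "w \<in> {a, b, c}" | "w \<in> {d, e}" "u \<in> {a, b, c}"
      using f(2-4) Ueq by blast
    then have "q \<notin> K {u, w}"
    proof cases
      case 1
      then show ?thesis using inT qT by blast
    next
      case 2
      then show ?thesis using de by simp
    next
      case 3
      then show ?thesis using tch by blast
    next
      case 4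
      then show ?thesis using tch[of w u] comm[of u w] by simp
    qed
    then show False using qf f by simp
  qed
  have qp: "q \<notin> p ` U"
  proof
    assume "q \<in> p ` U"
    then obtain u where u: "u \<in> U" "q = p u" by blast
    obtain w where "w \<in> U" "w \<noteq> u" using V dist by (metis distinct_length_2_or_more)
    then show False using pend[of u w] qK[OF pairsI[of u U w]] u by auto
  qed
  define f where "f z = 1 / (z - q)" for z
  define h where "h w = q + 1 / w" for w
  have cont: "continuous_on (- {q}) f" unfolding f_def by (intro continuous_intros) auto
  have inj: "inj_on f (- {q})" unfolding f_def inj_on_def by (auto simp: field_simps)
  have d': "drawing U (pairs U) (f \<circ> p) (\<lambda>e. f ` K e)"
    using drawing_map[OF simple_graph_pairs dr cont inj] qK qp by blast
  have qT: "T \<subseteq> - {q}" using q inside_no_overlap by blast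
  have fT: "f ` K {a, b} \<union> (f ` K {a, c} \<union> f ` K {c, b}) = f ` T" unfolding T_def by blast
  have B1: "arc_on (f ` K {a, b}) (f (p a)) (f (p b))"
    using arc_on_image[OF A1 continuous_on_subset[OF cont] inj_on_subset[OF inj]] qT unfolding T_def by blast
  have B2: "arc_on (f ` K {a, c} \<union> f ` K {c, b}) (f (p a)) (f (p b))"
    using arc_on_image[OF A2 continuous_on_subset[OF cont] inj_on_subset[OF inj]] qT unfolding T_def
    by (simp add: image_Un)
  have BI: "f ` K {a, b} \<inter> (f ` K {a, c} \<union> f ` K {c, b}) = {f (p a), f (p b)}"
  proof -
    have "f ` K {a, b} \<inter> f ` (K {a, c} \<union> K {c, b}) = f ` (K {a, b} \<inter> (K {a, c} \<union> K {c, b}))"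
      using qT unfolding T_def by (intro inj_on_image_Int[OF inj, symmetric]) auto
    then show ?thesis unfolding I by (simp add: image_Un)
  qed
  note J' = jordan_arcs[OF B1 B2 BI, unfolded fT]
  obtain r where r: "r > 0" "ball q r \<subseteq> inside T" using J(2) q open_contains_ball by blast
  have hf: "h (f z) = z" if "z \<noteq> q" for z using that unfolding h_def f_def by simp
  have fh: "f (h w) = w" if "w \<noteq> 0" for w using that unfolding h_def f_def by simp
  \<comment> \<open>Inversion exchanges the sides. Otherwise \<open>h\<close> would map the
    unbounded side of the image curve into \<open>outside T\<close>, yet points of large modulus are
    mapped close to \<open>q\<close>, which is inside.\<close>
  have swap: "f z \<in> inside (f ` T)" if z: "z \<in> outside T" for z
  proof (rule ccontr)
    assume "f z \<notin> inside (f ` T)"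
    have zq: "z \<noteq> q" using z q J(6) by blast
    have "z \<notin> T" using z outside_no_overlap by blast
    then have "f z \<notin> f ` T" using inj qT zq by (auto simp: inj_on_def)
    then have fo: "f z \<in> outside (f ` T)" using J'(7) \<open>f z \<notin> inside (f ` T)\<close> by blast
    have fz0: "f z \<noteq> 0" using zq unfolding f_def by simp
    obtain w where w: "w \<in> outside (f ` T)" "cmod w > 1 / r"
      using J'(5) unfolding bounded_iff by (meson not_le)
    have w0: "w \<noteq> 0" using w(2) r(1) by (metis divide_pos_pos less_asym norm_zero zero_less_one)
    \<comment> \<open>The point 0 corresponds to infinity under \<open>h\<close>, so it is removed;
      an open connected subset of the plane stays connected without a point.\<close>
    have conn: "connected (h ` (outside (f ` T) - {0}))"
    proof (rule connected_continuous_image)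
      show "continuous_on (outside (f ` T) - {0}) h" unfolding h_def by (intro continuous_intros) auto
      show "connected (outside (f ` T) - {0})" using J'(3,4) by (intro connected_open_delete) auto
    qed
    have "h ` (outside (f ` T) - {0}) \<inter> T = {}"
    proof -
      have "w \<in> f ` T" if "h w \<in> T" "w \<noteq> 0" for w using fh that by (metis imageI)
      then show ?thesis using outside_no_overlap by blast
    qed
    then have "h ` (outside (f ` T) - {0}) \<subseteq> outside T"
      using connected_subset_outside[OF conn] hf[OF zq] fo fz0 z by (metis DiffI imageI singletonD)
    then have "h w \<in> outside T" using w w0 by blast
    moreover have "h w \<in> ball q r"
      using w(2) r(1) w0 unfolding h_def by (simp add: dist_norm norm_divide field_simps)
    ultimately show False using r(2) J(6) by blast
  qed
  show False
    using K5_not_both_inside[OF d' dist Us] swap[OF dout] swap[OF eout] fT by simp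
qed

text \<open>A triangulation, namely the path 2, ..., n - 1 joined to the two adjacent poles 0 and 1.
  It is the source of the planar graphs constructed later: dense connected graphs, triangles and
  fans.\<close>

definition double_fan :: "nat \<Rightarrow> nat set set" where
  "double_fan n = {{0, j} |j. 1 \<le> j \<and> j < n} \<union> {{1, j} |j. 2 \<le> j \<and> j < n} \<union> {{j, Suc j} |j. 2 \<le> j \<and> Suc j < n}"

lemma simple_double_fan: "simple_graph {..<n} (double_fan n)"
  unfolding simple_graph_def double_fan_def by auto

lemma segment_pointE:
  assumes "z \<in> closed_segment a (b::complex)"
  obtains s where "0 \<le> s" "s \<le> 1" "Re z = (1 - s) * Re a + s * Re b" "Im z = (1 - s) * Im a + s * Im b"
  using assms unfolding in_segment by auto

lemma planar_double_fan: "planar {..<n} (double_fan n)"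
proof -
  \<comment> \<open>Straight-line drawing with the poles at \<open>\<i>\<close> and
    \<open>- \<i>\<close> and the path on the positive real axis. Apart from the edge between the
    poles, edges at 0 lie in the upper half plane and edges at 1 in the lower one.\<close>
  define p where "p j = (if j = 0 then \<i> else if j = 1 then - \<i> else of_nat j)" for j :: nat
  define K where "K e = closed_segment (p (Min e)) (p (Max e))" for e :: "nat set"
  \<comment> \<open>\<open>rank\<close> sorts the edges by kind, so that \<open>main\<close> has to
    treat two different kinds in one order only.\<close>
  define rank where "rank e = (if e = {0, 1} then 0 else if 0 \<in> e then 1 else if 1 \<in> e then 2 else (3::nat))" for e :: "nat set"
  have p0: "p 0 = \<i>" "p 1 = - \<i>" "p (Suc 0) = - \<i>" and pj: "\<And>j. 2 \<le> j \<Longrightarrow> p j = of_nat j" unfolding p_def by auto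
  have cases: "(e = {0, 1} \<and> K e = closed_segment \<i> (- \<i>)) \<or>
       (\<exists>j\<ge>2. e = {0, j} \<and> K e = closed_segment \<i> (of_nat j)) \<or>
       (\<exists>j\<ge>2. e = {1, j} \<and> K e = closed_segment (- \<i>) (of_nat j)) \<or>
       (\<exists>j\<ge>2. e = {j, Suc j} \<and> K e = closed_segment (of_nat j) (of_nat (Suc j)))" if eD: "e \<in> double_fan n" for e
  proof -
    consider "e = {0, 1}" | j where "j \<ge> 2" "e = {0, j}" | j where "j \<ge> 2" "e = {1, j}" | j where "j \<ge> 2" "e = {j, Suc j}"
    proof -
      from eD consider j where "1 \<le> j" "e = {0, j}" | j where "j \<ge> 2" "e = {1, j}" | j where "j \<ge> 2" "e = {j, Suc j}"
        unfolding double_fan_def by blast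
      then show thesis
      proof cases
        case (1 j)
        then show thesis using that(1) that(2)[of j] by (cases "j = 1") auto
      qed (use that(3,4) in auto)
    qed
    then show ?thesis
    proof cases
      case 1
      then show ?thesis unfolding K_def using p0 by simp
    next
      case (2 j)
      then show ?thesis unfolding K_def using p0 pj by (intro disjI2 disjI1 exI[of _ j]) auto
    next
      case (3 j)
      then show ?thesis unfolding K_def using p0 pj by (intro disjI2 disjI1 exI[of _ j]) (auto simp: min_def max_def)
    next
      case (4 j)
      then show ?thesis unfolding K_def using p0 pj by (intro disjI2 exI[of _ j]) (auto simp: min_def max_def)
    qed
  qed
  have R0: "Re z = 0" if "z \<in> closed_segment \<i> (- \<i>)" for z
    using that by (elim segment_pointE) auto
  have R1: "0 \<le> Im z \<and> Im z \<le> 1 \<and> Re z = real j * (1 - Im z)" if "z \<in> closed_segment \<i> (of_nat j)" for z j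
    using that by (elim segment_pointE) auto
  have R2: "Im z \<le> 0 \<and> - 1 \<le> Im z \<and> Re z = real j * (1 + Im z)" if "z \<in> closed_segment (- \<i>) (of_nat j)" for z j
    using that by (elim segment_pointE) auto
  have R3: "Im z = 0 \<and> real j \<le> Re z \<and> Re z \<le> real j + 1" if "z \<in> closed_segment (of_nat j) (of_nat (Suc j))" for z j
    using that by (elim segment_pointE) (auto simp: algebra_simps)
  have zi: "z = p 0" if "Re z = 0" "Im z = 1" for z using that p0 by (simp add: complex_eq_iff)
  have zmi: "z = p 1" if "Re z = 0" "Im z = - 1" for z using that p0 by (simp add: complex_eq_iff)
  have zj: "z = p j" if "Re z = real j" "Im z = 0" "j \<ge> 2" for z j using that pj by (simp add: complex_eq_iff)
  have inj: "inj_on p {..<n}"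
    unfolding inj_on_def p_def by (auto simp: complex_eq_iff)
  have dr: "drawing {..<n} (double_fan n) p K"
    unfolding drawing_def
  proof (intro conjI allI impI ballI inj)
    fix u w assume uw: "{u, w} \<in> double_fan n"
    then have "u \<noteq> w" "u < n" "w < n" using simple_double_fan[of n] unfolding simple_graph_def by auto
    then have ne: "p u \<noteq> p w" using inj by (auto simp: inj_on_def)
    show "arc_on (K {u, w}) (p u) (p w)"
      using arc_on_segment[OF ne] arc_on_segment[OF ne[symmetric]] arc_on_sym unfolding K_def
      by (auto simp: min_def max_def)
  next
    fix e assume e: "e \<in> double_fan n"
    show "K e \<inter> p ` {..<n} \<subseteq> p ` e"
    proof
      fix z assume "z \<in> K e \<inter> p ` {..<n}"
      then obtain v where v: "z = p v" "z \<in> K e" by blast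
      have pv: "v = 0 \<and> Re z = 0 \<and> Im z = 1 \<or> v = 1 \<and> Re z = 0 \<and> Im z = -1 \<or> v \<ge> 2 \<and> Re z = real v \<and> Im z = 0"
        using v unfolding p_def by auto
      from cases[OF e] show "z \<in> p ` e"
      proof (elim disjE exE conjE)
        assume *: "e = {0, 1}" "K e = closed_segment \<i> (- \<i>)"
        then show ?thesis using R0[of z] v pv by auto
      next
        fix j assume *: "2 \<le> j" "e = {0, j}" "K e = closed_segment \<i> (of_nat j)"
        then show ?thesis using R1[of z j] v pv by auto
      next
        fix j assume *: "2 \<le> j" "e = {1, j}" "K e = closed_segment (- \<i>) (of_nat j)"
        then show ?thesis using R2[of z j] v pv by auto
      next
        fix j assume *: "2 \<le> j" "e = {j, Suc j}" "K e = closed_segment (of_nat j) (of_nat (Suc j))"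
        then have "v = j \<or> v = Suc j" using R3[of z j] v pv by auto
        then show ?thesis using * v by auto
      qed
    qed
  next
    have main: "z \<in> p ` (e \<inter> f)"
      if e: "e \<in> double_fan n" and f: "f \<in> double_fan n" and ne: "e \<noteq> f" and r: "rank e \<le> rank f"
        and z: "z \<in> K e" "z \<in> K f" for e f z
      using cases[OF e] cases[OF f]
    proof (elim disjE exE conjE)
      fix j assume *: "e = {0, 1}" "K e = closed_segment \<i> (- \<i>)" "2 \<le> j" "f = {0, j}" "K f = closed_segment \<i> (of_nat j)"
      have "z = p 0" using R0[of z] R1[of z j] z * by (intro zi) auto
      then show ?thesis using * by auto
    next
      fix j assume *: "e = {0, 1}" "K e = closed_segment \<i> (- \<i>)" "2 \<le> j" "f = {1, j}" "K f = closed_segment (- \<i>) (of_nat j)"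
      have "z = p 1" using R0[of z] R2[of z j] z * by (intro zmi) auto
      then show ?thesis using * by auto
    next
      fix j assume *: "e = {0, 1}" "K e = closed_segment \<i> (- \<i>)" "2 \<le> j" "f = {j, Suc j}" "K f = closed_segment (of_nat j) (of_nat (Suc j))"
      then show ?thesis using R0[of z] R3[of z j] z by auto
    next
      fix j k assume *: "2 \<le> j" "e = {0, j}" "K e = closed_segment \<i> (of_nat j)" "2 \<le> k" "f = {0, k}" "K f = closed_segment \<i> (of_nat k)"
      have "real j * (1 - Im z) = real k * (1 - Im z)" using R1[of z j] R1[of z k] z * by auto
      moreover have "j \<noteq> k" using ne * by auto
      ultimately have "Im z = 1" by auto
      then have "z = p 0" using R1[of z j] z * by (intro zi) auto
      then show ?thesis using * by auto
    next
      fix j k assume *: "2 \<le> j" "e = {0, j}" "K e = closed_segment \<i> (of_nat j)" "2 \<le> k" "f = {1, k}" "K f = closed_segment (- \<i>) (of_nat k)"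
      have "Im z = 0" "Re z = real j" "Re z = real k" using R1[of z j] R2[of z k] z * by auto
      then have "z = p j" "j = k" using zj * by auto
      then show ?thesis using * by auto
    next
      fix j k assume *: "2 \<le> j" "e = {0, j}" "K e = closed_segment \<i> (of_nat j)" "2 \<le> k" "f = {k, Suc k}" "K f = closed_segment (of_nat k) (of_nat (Suc k))"
      have "Im z = 0" "Re z = real j" "real k \<le> Re z" "Re z \<le> real k + 1" using R1[of z j] R3[of z k] z * by auto
      then have "z = p j" "j = k \<or> j = Suc k" using zj * by auto
      then show ?thesis using * by auto
    next
      fix j k assume *: "2 \<le> j" "e = {1, j}" "K e = closed_segment (- \<i>) (of_nat j)" "2 \<le> k" "f = {1, k}" "K f = closed_segment (- \<i>) (of_nat k)"
      have "real j * (1 + Im z) = real k * (1 + Im z)" using R2[of z j] R2[of z k] z * by auto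
      moreover have "j \<noteq> k" using ne * by auto
      ultimately have "Im z = - 1" by auto
      then have "z = p 1" using R2[of z j] z * by (intro zmi) auto
      then show ?thesis using * by auto
    next
      fix j k assume *: "2 \<le> j" "e = {1, j}" "K e = closed_segment (- \<i>) (of_nat j)" "2 \<le> k" "f = {k, Suc k}" "K f = closed_segment (of_nat k) (of_nat (Suc k))"
      have "Im z = 0" "Re z = real j" "real k \<le> Re z" "Re z \<le> real k + 1" using R2[of z j] R3[of z k] z * by auto
      then have "z = p j" "j = k \<or> j = Suc k" using zj * by auto
      then show ?thesis using * by auto
    next
      fix j k assume *: "2 \<le> j" "e = {j, Suc j}" "K e = closed_segment (of_nat j) (of_nat (Suc j))" "2 \<le> k" "f = {k, Suc k}" "K f = closed_segment (of_nat k) (of_nat (Suc k))"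
      have A: "Im z = 0" "real j \<le> Re z" "Re z \<le> real j + 1" "real k \<le> Re z" "Re z \<le> real k + 1"
        using R3[of z j] R3[of z k] z * by auto
      moreover have "j \<noteq> k" using ne * by auto
      ultimately have "k = Suc j \<and> Re z = real k \<or> j = Suc k \<and> Re z = real j" by linarith
      then have "k = Suc j \<and> z = p k \<or> j = Suc k \<and> z = p j" using zj[of z k] zj[of z j] A(1) * by auto
      then show ?thesis using * by auto
    qed (use r ne in \<open>auto simp: rank_def doubleton_eq_iff split: if_splits\<close>)
    fix e f assume ef: "e \<in> double_fan n" "f \<in> double_fan n" "e \<noteq> f"
    show "K e \<inter> K f \<subseteq> p ` (e \<inter> f)"
    proof (cases "rank e \<le> rank f")
      case True
      then show ?thesis using main[OF ef] by blast
    next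
      case False
      then show ?thesis using main[OF ef(2,1)] ef(3) by (metis Int_commute IntE nle_le subsetI)
    qed
  qed
  then show ?thesis using planar_iff_drawing[OF simple_double_fan] by blast
qed

section \<open>Linearly many edges\<close>

definition nb :: "'a set set \<Rightarrow> 'a \<Rightarrow> 'a set" where
  "nb E v = {u. {v, u} \<in> E}"

lemma nb_sym: "u \<in> nb E v \<longleftrightarrow> v \<in> nb E u"
  unfolding nb_def by (simp add: insert_commute)

lemma nb_simple: "simple_graph V E \<Longrightarrow> u \<in> nb E v \<Longrightarrow> u \<in> V \<and> v \<in> V \<and> u \<noteq> v"
  unfolding nb_def simple_graph_def by fastforce

lemma simple_graph_edgeD: "simple_graph V E \<Longrightarrow> {x, y} \<in> E \<Longrightarrow> x \<in> V \<and> y \<in> V \<and> x \<noteq> y"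
  unfolding simple_graph_def by fastforce

lemma nb_subset: "simple_graph V E \<Longrightarrow> nb E v \<subseteq> V"
  using nb_simple by fastforce

lemma vertex_degree_nb:
  assumes "simple_graph V E"
  shows "vertex_degree E v = card (nb E v)"
proof -
  have "{e \<in> E. v \<in> e} = (\<lambda>u. {v, u}) ` nb E v"
  proof
    show "{e \<in> E. v \<in> e} \<subseteq> (\<lambda>u. {v, u}) ` nb E v"
    proof
      fix e assume e: "e \<in> {e \<in> E. v \<in> e}"
      then have "e \<in> E" by simp
      then obtain a b where "e = {a, b}" "a \<noteq> b" using simple_graph_edgeE[OF assms] by metis
      then show "e \<in> (\<lambda>u. {v, u}) ` nb E v" using e unfolding nb_def by (auto simp: insert_commute)
    qed
  qed (auto simp: nb_def)
  moreover have "inj_on (\<lambda>u. {v, u}) (nb E v)" by (auto simp: inj_on_def doubleton_eq_iff)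
  ultimately show ?thesis unfolding vertex_degree_def by (simp add: card_image)
qed

lemma handshake:
  assumes "simple_graph V E" "finite V"
  shows "(\<Sum>v\<in>V. card (nb E v)) = 2 * card E"
proof -
  have fE: "finite E" using finite_edges assms by blast
  have "(\<Sum>v\<in>V. card (nb E v)) = (\<Sum>v\<in>V. card {e \<in> E. v \<in> e})"
    using vertex_degree_nb[OF assms(1)] unfolding vertex_degree_def by simp
  also have "\<dots> = (\<Sum>v\<in>V. \<Sum>e\<in>E. if v \<in> e then 1 else 0)"
    using fE by (simp add: sum.If_cases Int_def)
  also have "\<dots> = (\<Sum>e\<in>E. \<Sum>v\<in>V. if v \<in> e then 1 else 0)" by (rule sum.swap)
  also have "\<dots> = (\<Sum>e\<in>E. card e)"
  proof (rule sum.cong)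
    fix e assume "e \<in> E"
    then have "V \<inter> {v. v \<in> e} = e" using assms(1) unfolding simple_graph_def by blast
    then show "(\<Sum>v\<in>V. if v \<in> e then 1 else 0) = card e" using assms(2) by (simp add: sum.If_cases)
  qed simp
  also have "\<dots> = 2 * card E" using assms(1) unfolding simple_graph_def by simp
  finally show ?thesis .
qed

text \<open>Besides the contracted edge itself, an edge is lost only where the edges from
  \<open>x\<close> and \<open>y\<close> to a common neighbour become equal.\<close>

lemma card_contract:
  assumes sg: "simple_graph V E" and fin: "finite V" and xy: "{x, y} \<in> E"
  shows "card E \<le> card (image_graph (id(y := x)) E) + 1 + card (nb E x \<inter> nb E y)"
proof -
  let ?f = "id(y := x)"
  let ?R = "(\<lambda>w. {y, w}) ` (nb E x \<inter> nb E y)"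
  define E0 where "E0 = E - {{x, y}} - ?R"
  have fE: "finite E" using finite_edges sg fin by blast
  have fnb: "finite (nb E x \<inter> nb E y)" using nb_subset[OF sg] fin finite_subset by (metis finite_Int)
  have ne: "x \<noteq> y" using sg xy unfolding simple_graph_def by fastforce
  have cs: "(y \<notin> e \<and> ?f ` e = e) \<or> (\<exists>w. e = {y, w} \<and> w \<noteq> x \<and> w \<noteq> y \<and> ?f ` e = {x, w} \<and> {x, w} \<notin> E)"
    if e: "e \<in> E0" for e
  proof (cases "y \<in> e")
    case True
    have eE: "e \<in> E" using e unfolding E0_def by blast
    obtain w where w: "e = {y, w}" "w \<noteq> y" using simple_graph_edgeE[OF sg eE] True by (metis insert_iff singletonD insert_commute)
    moreover have "w \<noteq> x" using w e unfolding E0_def by (auto simp: insert_commute)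
    moreover have "{x, w} \<notin> E"
    proof
      assume "{x, w} \<in> E"
      then have "w \<in> nb E x \<inter> nb E y" using w eE unfolding nb_def by auto
      then show False using e w(1) unfolding E0_def by blast
    qed
    ultimately show ?thesis by auto
  next
    case False
    then show ?thesis by (auto simp: image_iff)
  qed
  have "inj_on ((`) ?f) E0"
  proof (rule inj_onI)
    fix e e' assume e: "e \<in> E0" "e' \<in> E0" "?f ` e = ?f ` e'"
    have E0E: "e \<in> E" "e' \<in> E" using e unfolding E0_def by blast+
    show "e = e'"
      using cs[OF e(1)] cs[OF e(2)] e(3) E0E by (elim disjE exE conjE) (auto simp: doubleton_eq_iff)
  qed
  moreover have "(`) ?f ` E0 \<subseteq> image_graph ?f E"
  proof
    fix e' assume "e' \<in> (`) ?f ` E0"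
    then obtain e where e: "e \<in> E0" "e' = ?f ` e" by blast
    have eE: "e \<in> E" using e unfolding E0_def by blast
    have "card e = 2" using sg eE unfolding simple_graph_def by blast
    then have "card (?f ` e) = 2" using cs[OF e(1)] by auto
    then show "e' \<in> image_graph ?f E" using eE e unfolding image_graph_def by blast
  qed
  moreover have "finite (image_graph ?f E)"
    using fE unfolding image_graph_def by simp
  ultimately have "card E0 \<le> card (image_graph ?f E)" by (metis card_image card_mono)
  moreover have "card E \<le> card E0 + card {{x, y}} + card ?R"
  proof -
    have "E \<subseteq> E0 \<union> {{x, y}} \<union> ?R" unfolding E0_def by blast
    moreover have "finite (E0 \<union> {{x, y}} \<union> ?R)" using fE fnb unfolding E0_def by simp
    ultimately have "card E \<le> card (E0 \<union> {{x, y}} \<union> ?R)" by (rule card_mono[rotated])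
    also have "\<dots> \<le> card E0 + card {{x, y}} + card ?R" by (meson add_le_mono1 card_Un_le le_trans)
    finally show ?thesis .
  qed
  moreover have "card ?R \<le> card (nb E x \<inter> nb E y)" by (rule card_image_le[OF fnb])
  ultimately show ?thesis by simp
qed

definition minor_closed :: "('a set \<Rightarrow> 'a set set \<Rightarrow> bool) \<Rightarrow> bool" where
  "minor_closed C \<longleftrightarrow>
     (\<forall>V E V' E'. C V E \<longrightarrow> finite V \<longrightarrow> simple_graph V E \<longrightarrow> V' \<subseteq> V \<longrightarrow> E' \<subseteq> E \<longrightarrow> simple_graph V' E' \<longrightarrow> C V' E') \<and>
     (\<forall>V E x y. C V E \<longrightarrow> finite V \<longrightarrow> simple_graph V E \<longrightarrow> {x, y} \<in> E \<longrightarrow> C (V - {y}) (image_graph (id(y := x)) E))"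

lemma minor_closed_planar: "minor_closed planar"
  unfolding minor_closed_def
  by (intro conjI allI impI) (metis planar_subgraph, metis planar_contract(2))

lemma simple_graph_contract:
  assumes "simple_graph V E" "{x, y} \<in> E"
  shows "simple_graph (V - {y}) (image_graph (id(y := x)) E)"
proof -
  have xyV: "x \<in> V" "y \<in> V" "x \<noteq> y" using assms unfolding simple_graph_def by auto
  show ?thesis
    using assms xyV unfolding simple_graph_def image_graph_def by (auto split: if_splits)
qed

text \<open>Mader's bound: in a minimal counterexample all edges lie in many triangles, so the
  neighbourhood of a vertex is a dense graph in the class of all graphs whose cone belongs to the
  given class.\<close>

lemma mader:
  fixes C :: "'a set \<Rightarrow> 'a set set \<Rightarrow> bool"
  assumes "minor_closed C" "\<And>U. finite U \<Longrightarrow> card U = t \<Longrightarrow> \<not> C U (pairs U)"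
    and "C V E" "finite V" "simple_graph V E"
  shows "card E \<le> (2 ^ t - 1) * card V"
  using assms
proof (induction t arbitrary: C V E)
  case 0
  have "simple_graph {} ({} :: 'a set set)" unfolding simple_graph_def by blast
  then have "C {} {}" using 0 unfolding minor_closed_def by blast
  moreover have "pairs {} = ({} :: 'a set set)" unfolding pairs_def by blast
  ultimately show ?case using 0(2)[of "{}"] by simp
next
  case (Suc t)
  note mc = Suc.prems(1) and noK = Suc.prems(2)
  have sub: "C V' E'" if "C V E" "finite V" "simple_graph V E" "V' \<subseteq> V" "E' \<subseteq> E" "simple_graph V' E'" for V E V' E'
    using mc that unfolding minor_closed_def by blast
  have con: "C (V - {y}) (image_graph (id(y := x)) E)" if "C V E" "finite V" "simple_graph V E" "{x, y} \<in> E" for V E x y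
    using mc that unfolding minor_closed_def by blast
  define C' where "C' V E \<longleftrightarrow> (\<exists>v. v \<notin> V \<and> C (insert v V) (E \<union> (\<lambda>u. {v, u}) ` V))" for V E
  have sgj: "simple_graph (insert v V) (E \<union> (\<lambda>u. {v, u}) ` V)" if "v \<notin> V" "simple_graph V E" for v V and E :: "'a set set"
    using that unfolding simple_graph_def by (auto simp: card_insert_if)
  have mc': "minor_closed C'"
    unfolding minor_closed_def
  proof (intro conjI allI impI)
    fix V E V' E' assume *: "C' V E" "finite V" "simple_graph V E" "V' \<subseteq> V" "E' \<subseteq> E" "simple_graph V' E'"
    then obtain v where v: "v \<notin> V" "C (insert v V) (E \<union> (\<lambda>u. {v, u}) ` V)" unfolding C'_def by blast
    have "C (insert v V') (E' \<union> (\<lambda>u. {v, u}) ` V')"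
    proof (rule sub[OF v(2) _ sgj[OF v(1) *(3)]])
      show "simple_graph (insert v V') (E' \<union> (\<lambda>u. {v, u}) ` V')" using sgj[of v V' E'] * v(1) by auto
    qed (use * in auto)
    then show "C' V' E'" unfolding C'_def using v * by blast
  next
    fix V E x y assume *: "C' V E" "finite V" "simple_graph V E" "{x, y} \<in> E"
    then obtain v where v: "v \<notin> V" "C (insert v V) (E \<union> (\<lambda>u. {v, u}) ` V)" unfolding C'_def by blast
    have xy: "x \<in> V" "y \<in> V" "x \<noteq> y" using * unfolding simple_graph_def by auto
    let ?f = "id(y := x)"
    have "C (insert v V - {y}) (image_graph ?f (E \<union> (\<lambda>u. {v, u}) ` V))"
      using con[OF v(2) _ sgj[OF v(1) *(3)]] *(2,4) by blast
    moreover have "insert v V - {y} = insert v (V - {y})" using v xy by auto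
    moreover have "image_graph ?f (E \<union> (\<lambda>u. {v, u}) ` V) = image_graph ?f E \<union> (\<lambda>u. {v, u}) ` (V - {y})"
    proof -
      have "image_graph ?f ((\<lambda>u. {v, u}) ` V) = (\<lambda>u. {v, u}) ` (V - {y})"
      proof
        show "image_graph ?f ((\<lambda>u. {v, u}) ` V) \<subseteq> (\<lambda>u. {v, u}) ` (V - {y})"
          unfolding image_graph_def using v xy by auto
        show "(\<lambda>u. {v, u}) ` (V - {y}) \<subseteq> image_graph ?f ((\<lambda>u. {v, u}) ` V)"
        proof
          fix e assume "e \<in> (\<lambda>u. {v, u}) ` (V - {y})"
          then obtain u where u: "u \<in> V" "u \<noteq> y" "e = {v, u}" by blast
          have "?f ` {v, u} = {v, u}" "card {v, u} = 2" using u v xy by (auto simp: card_insert_if)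
          then show "e \<in> image_graph ?f ((\<lambda>u. {v, u}) ` V)"
            unfolding image_graph_def using u by (metis (mono_tags, lifting) image_eqI mem_Collect_eq)
        qed
      qed
      moreover have "image_graph ?f (A \<union> B) = image_graph ?f A \<union> image_graph ?f B" for A B
        unfolding image_graph_def by blast
      ultimately show ?thesis by simp
    qed
    ultimately show "C' (V - {y}) (image_graph ?f E)" unfolding C'_def using v by auto
  qed
  have noK': "\<not> C' U (pairs U)" if U: "finite U" "card U = t" for U
  proof
    assume "C' U (pairs U)"
    then obtain v where v: "v \<notin> U" "C (insert v U) (pairs U \<union> (\<lambda>u. {v, u}) ` U)" unfolding C'_def by blast
    have "pairs U \<union> (\<lambda>u. {v, u}) ` U = pairs (insert v U)"
      unfolding pairs_def using v by (auto simp: insert_commute)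
    then show False using noK[of "insert v U"] v U by auto
  qed
  define A where "A = (2::nat) ^ t - 1"
  have A2: "2 ^ Suc t - 1 = 2 * A + 1" unfolding A_def using one_le_power[of "2::nat" t] by (simp only: power_Suc) linarith
  have "card E \<le> (2 * A + 1) * card V" if "C V E" "finite V" "simple_graph V E" for V E
    using that
  proof (induction "card V" arbitrary: V E rule: less_induct)
    case less
    show ?case
    proof (cases "\<exists>x y. {x, y} \<in> E \<and> card (nb E x \<inter> nb E y) \<le> 2 * A")
      \<comment> \<open>The edge lies in few triangles, so its contraction removes one vertex and at
        most \<open>2 A + 1\<close> edges, exactly what the bound allows per vertex.\<close>
      case True
      then obtain x y where xy: "{x, y} \<in> E" "card (nb E x \<inter> nb E y) \<le> 2 * A" by blast
      have yV: "y \<in> V" using simple_graph_edgeD[OF less.prems(3) xy(1)] by blast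
      have cV: "card V = Suc (card (V - {y}))" using card_Suc_Diff1[OF less.prems(2) yV] by simp
      have "card (image_graph (id(y := x)) E) \<le> (2 * A + 1) * card (V - {y})"
      proof (rule less.hyps)
        show "card (V - {y}) < card V" using cV by simp
        show "C (V - {y}) (image_graph (id(y := x)) E)" by (rule con[OF less.prems xy(1)])
        show "simple_graph (V - {y}) (image_graph (id(y := x)) E)" by (rule simple_graph_contract[OF less.prems(3) xy(1)])
      qed (use less.prems(2) in simp)
      then show ?thesis using card_contract[OF less.prems(3,2) xy(1)] xy(2) cV by simp
    next
      case False
      show ?thesis
      proof (cases "E = {}")
        case False
        then obtain e where "e \<in> E" by blast
        then obtain v w where vw: "{v, w} \<in> E" using simple_graph_edgeE[OF less.prems(3)] by metis
        define N where "N = nb E v"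
        define F where "F = {e \<in> E. e \<subseteq> N}"
        have NV: "N \<subseteq> V" "v \<notin> N" unfolding N_def using nb_simple[OF less.prems(3)] by blast+
        have finN: "finite N" using NV less.prems(2) finite_subset by blast
        have sgF: "simple_graph N F" using less.prems(3) unfolding F_def simple_graph_def by auto
        have vV: "v \<in> V" using simple_graph_edgeD[OF less.prems(3) vw] by blast
        have "F \<union> (\<lambda>u. {v, u}) ` N \<subseteq> E" unfolding F_def N_def nb_def by auto
        then have "C (insert v N) (F \<union> (\<lambda>u. {v, u}) ` N)"
          using sub[OF less.prems, of "insert v N"] sgj[OF NV(2) sgF] NV vV by simp
        then have "C' N F" unfolding C'_def using NV by blast
        then have "card F \<le> A * card N"
          using Suc.IH[OF mc' noK' _ finN sgF] unfolding A_def by blast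
        \<comment> \<open>The common neighbours of \<open>v\<close> and a neighbour \<open>u\<close>
          are the neighbours of \<open>u\<close> in \<open>F\<close>. So all degrees of
          \<open>F\<close> exceed \<open>2 A\<close>, against the \<open>A\<close> edges per vertex
          that the induction hypothesis for cones permits.\<close>
        moreover have "(2 * A + 1) * card N \<le> 2 * card F"
        proof -
          have "2 * A + 1 \<le> card (nb F u)" if u: "u \<in> N" for u
          proof -
            have "{u, v} \<in> E" using u unfolding N_def nb_def by (simp add: insert_commute)
            then have "2 * A + 1 \<le> card (nb E u \<inter> nb E v)"
              using \<open>\<nexists>x y. {x, y} \<in> E \<and> card (nb E x \<inter> nb E y) \<le> 2 * A\<close> by (metis Suc_eq_plus1 Suc_leI not_le)
            moreover have "nb E u \<inter> nb E v = nb F u" using u unfolding F_def N_def nb_def by auto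
            ultimately show ?thesis by simp
          qed
          then have "(\<Sum>u\<in>N. 2 * A + 1) \<le> (\<Sum>u\<in>N. card (nb F u))" by (rule sum_mono)
          then show ?thesis using handshake[OF sgF finN] by (simp add: mult.commute)
        qed
        moreover have "card N > 0" using vw finN unfolding N_def nb_def by (auto simp: card_gt_0_iff)
        ultimately show ?thesis by (simp add: algebra_simps)
      qed simp
    qed
  qed
  then show ?case using Suc.prems A2 by metis
qed

text \<open>The constant is \<open>2 ^ 5 - 1\<close>, from Mader's bound with the complete graph on
  five vertices excluded.\<close>

lemma planar_edge_bound:
  assumes "simple_graph V E" "finite V" "planar V E"
  shows "card E \<le> 31 * card V"
proof -
  have "\<not> planar U (pairs U)" if "finite U" "card U = 5" for U :: "'a set" using K5_not_planar that by blast
  from mader[where t = 5, OF minor_closed_planar this assms(3,2,1)] show ?thesis by simp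
qed

section \<open>Smallness of the class of planar graphs\<close>

definition pgraphs :: "'a set \<Rightarrow> 'a set set set" where
  "pgraphs V = {E. simple_graph V E \<and> planar V E}"

lemma finite_pgraphs: "finite V \<Longrightarrow> finite (pgraphs V)"
  by (rule finite_subset[of _ "Pow (Pow V)"]) (auto simp: pgraphs_def simple_graph_def)

lemma card_relabel_le:
  assumes inj: "inj_on f V" and A: "\<And>E. E \<in> A \<Longrightarrow> simple_graph V E"
    and B: "\<And>E. E \<in> A \<Longrightarrow> (`) f ` E \<in> B" and fin: "finite B"
  shows "card A \<le> card B"
proof (rule card_inj_on_le)
  have 1: "inj_on ((`) f) (Pow V)" using inj by (rule inj_on_image_Pow)
  then have "inj_on ((`) ((`) f)) (Pow (Pow V))" by (rule inj_on_image_Pow)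
  moreover have "A \<subseteq> Pow (Pow V)" using A unfolding simple_graph_def by blast
  ultimately show "inj_on ((`) ((`) f)) A" by (rule inj_on_subset)
  show "(`) ((`) f) ` A \<subseteq> B" using B by blast
qed (rule fin)

lemma card_pgraphs_le:
  assumes "finite V" "finite W" "card V = card W"
  shows "card (pgraphs V) \<le> card (pgraphs W)"
proof -
  obtain f where f: "bij_betw f V W" using assms by (metis finite_same_card_bij)
  show ?thesis
  proof (rule card_relabel_le[of f V])
    show "inj_on f V" using f bij_betw_def by blast
    fix E assume "E \<in> pgraphs V"
    then show "(`) f ` E \<in> pgraphs W"
      using planar_relabel[of V E f] f unfolding pgraphs_def bij_betw_def by auto
  qed (use assms finite_pgraphs in \<open>auto simp: pgraphs_def\<close>)
qed

lemma card_pgraphs: "finite V \<Longrightarrow> card (pgraphs V) = card (pgraphs {1..card V})"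
  by (intro antisym card_pgraphs_le) auto

lemma simple_subgraph: "simple_graph V E \<Longrightarrow> simple_graph (V - {u}) {e \<in> E. u \<notin> e}"
  unfolding simple_graph_def by auto

text \<open>Twice the edge bound of 31 per vertex bounds the average degree by 62.\<close>

lemma planar_low_degree:
  assumes sg: "simple_graph U F" and fin: "finite U" and pl: "planar U F" and ne: "U \<noteq> {}"
  obtains u where "u \<in> U" "card (nb F u) \<le> 62"
proof -
  have "\<exists>u\<in>U. card (nb F u) \<le> 62"
  proof (rule ccontr)
    assume "\<not> ?thesis"
    then have "\<And>u. u \<in> U \<Longrightarrow> 63 \<le> card (nb F u)" by auto
    then have "(\<Sum>u\<in>U. 63) \<le> (\<Sum>u\<in>U. card (nb F u))" by (rule sum_mono)
    then have "63 * card U \<le> 2 * card F" using handshake[OF sg fin] by simp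
    moreover have "card U > 0" using ne fin by (simp add: card_gt_0_iff)
    ultimately show False using planar_edge_bound[OF sg fin pl] by linarith
  qed
  then show thesis using that by blast
qed

definition cliques :: "'a set \<Rightarrow> 'a set set \<Rightarrow> 'a set set" where
  "cliques U F = {K. K \<subseteq> U \<and> (\<forall>u\<in>K. \<forall>w\<in>K. u \<noteq> w \<longrightarrow> {u, w} \<in> F)}"

text \<open>Induction by removing a vertex \<open>u\<close> of degree at most 62: a clique either
  avoids \<open>u\<close> or is \<open>u\<close> together with a subset of its neighbourhood. The
  summand 1 is the empty clique.\<close>

lemma card_cliques:
  assumes "simple_graph U F" "finite U" "planar U F"
  shows "card (cliques U F) \<le> 2 ^ 62 * card U + 1"
  using assms
proof (induction "card U" arbitrary: U F)
  case 0
  then have "U = {}" by simp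
  then have "cliques U F = {{}}" unfolding cliques_def by auto
  then show ?case by simp
next
  case (Suc n)
  then have "U \<noteq> {}" by auto
  then obtain u where u: "u \<in> U" "card (nb F u) \<le> 62" using planar_low_degree Suc.prems by metis
  define F' where "F' = {e \<in> F. u \<notin> e}"
  have sg': "simple_graph (U - {u}) F'" unfolding F'_def by (rule simple_subgraph[OF Suc.prems(1)])
  have pl': "planar (U - {u}) F'"
    using planar_subgraph[OF Suc.prems(1,3) sg'] unfolding F'_def by blast
  have c: "n = card (U - {u})" using card_Suc_Diff1[OF Suc.prems(2) u(1)] Suc.hyps(2) by simp
  have IH: "card (cliques (U - {u}) F') \<le> 2 ^ 62 * n + 1" using Suc.hyps(1)[OF c sg' _ pl'] Suc.prems(2) c by simp
  have finN: "finite (nb F u)" using nb_subset[OF Suc.prems(1)] Suc.prems(2) finite_subset by blast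
  have "cliques U F \<subseteq> cliques (U - {u}) F' \<union> insert u ` Pow (nb F u)"
  proof
    fix K assume K: "K \<in> cliques U F"
    show "K \<in> cliques (U - {u}) F' \<union> insert u ` Pow (nb F u)"
    proof (cases "u \<in> K")
      case True
      then have "K - {u} \<in> Pow (nb F u)" "K = insert u (K - {u})" using K unfolding cliques_def nb_def by auto
      then show ?thesis by blast
    next
      case False
      then show ?thesis using K unfolding cliques_def F'_def by auto
    qed
  qed
  then have "card (cliques U F) \<le> card (cliques (U - {u}) F' \<union> insert u ` Pow (nb F u))"
    using finN Suc.prems(2) by (intro card_mono) (auto simp: cliques_def)
  also have "\<dots> \<le> card (cliques (U - {u}) F') + card (insert u ` Pow (nb F u))" by (rule card_Un_le)
  also have "card (insert u ` Pow (nb F u)) \<le> card (Pow (nb F u))" using finN by (intro card_image_le) simp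
  also have "card (Pow (nb F u)) = 2 ^ card (nb F u)" using finN by (rule card_Pow)
  also have "(2::nat) ^ card (nb F u) \<le> 2 ^ 62" using u(2) by (rule power_increasing) simp
  finally show ?case using IH Suc.hyps(2) by simp
qed

text \<open>The 31 pays for the edges inside \<open>U\<close> and the \<open>2 ^ 62\<close> for the
  cliques on \<open>U\<close> in \<open>card_neighbourhoods\<close>.\<close>

definition nbh_const :: nat where "nbh_const = 31 + 2 ^ 62"

text \<open>The edges inside \<open>U\<close> are counted along because they carry the induction: if
  some \<open>z\<close> in \<open>I\<close> has two non-adjacent neighbours, contracting
  \<open>z\<close> into one of them loses at most one neighbourhood and creates a new edge inside
  \<open>U\<close>. If there is no such \<open>z\<close>, all neighbourhoods are cliques of the
  planar graph on \<open>U\<close>.\<close>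

lemma card_neighbourhoods:
  assumes "simple_graph (U \<union> I) E" "finite U" "finite I" "planar (U \<union> I) E" "U \<inter> I = {}" "\<And>e. e \<in> E \<Longrightarrow> \<not> e \<subseteq> I"
  shows "card (nb E ` I) + card {e \<in> E. e \<subseteq> U} \<le> nbh_const * card U + 1"
  using assms
proof (induction "card I" arbitrary: I E rule: less_induct)
  case less
  note sg = less.prems(1) and finU = less.prems(2) and finI = less.prems(3) and pl = less.prems(4)
    and dj = less.prems(5) and ind = less.prems(6)
  have finE: "finite E" using finite_edges[OF sg] finU finI by simp
  have nbU: "nb E z \<subseteq> U" if "z \<in> I" for z
  proof
    fix u assume u: "u \<in> nb E z"
    then have "u \<in> U \<union> I" using nb_simple[OF sg] by blast
    moreover have "u \<notin> I" using ind[of "{z, u}"] u that unfolding nb_def by auto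
    ultimately show "u \<in> U" by blast
  qed
  define F where "F = {e \<in> E. e \<subseteq> U}"
  show ?case
  proof (cases "\<exists>z\<in>I. \<exists>u u'. u \<in> nb E z \<and> u' \<in> nb E z \<and> u \<noteq> u' \<and> {u, u'} \<notin> E")
    case True
    then obtain z u u' where z: "z \<in> I" "u \<in> nb E z" "u' \<in> nb E z" "u \<noteq> u'" "{u, u'} \<notin> E" by blast
    have uz: "{u, z} \<in> E" using z unfolding nb_def by (simp add: insert_commute)
    have u: "u \<in> U" "u' \<in> U" "z \<notin> U" using nbU z dj by auto
    define I' where "I' = I - {z}"
    define E' where "E' = image_graph (id(z := u)) E"
    have VI: "(U \<union> I) - {z} = U \<union> I'" using u unfolding I'_def by blast
    have fin: "finite (U \<union> I)" using finU finI by simp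
    have sg': "simple_graph (U \<union> I') E'" and pl': "planar (U \<union> I') E'"
      using planar_contract[OF sg fin pl uz] unfolding VI E'_def by blast+
    have E'c: "(e \<in> E \<and> z \<notin> e) \<or> (\<exists>s\<in>U. e = {u, s})" if "e \<in> E'" for e
    proof -
      obtain e0 where e0: "e0 \<in> E" "e = (id(z := u)) ` e0" using \<open>e \<in> E'\<close> unfolding E'_def image_graph_def by blast
      show ?thesis
      proof (cases "z \<in> e0")
        case True
        obtain a b where "e0 = {a, b}" "a \<noteq> b" using simple_graph_edgeE[OF sg e0(1)] by metis
        then obtain s where s: "e0 = {z, s}" "s \<noteq> z" using True by auto
        then have "s \<in> U" using nbU[OF z(1)] e0 unfolding nb_def by blast
        moreover have "e = {u, s}" using s e0 by auto
        ultimately show ?thesis by blast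
      next
        case False
        then have "e = e0" using e0 by (auto simp: image_iff)
        then show ?thesis using e0 False by blast
      qed
    qed
    have E'I: "e \<in> E'" if "e \<in> E" "z \<notin> e" for e
    proof -
      have "(id(z := u)) ` e = e" using that by (auto simp: image_iff)
      moreover have "card e = 2" using sg that unfolding simple_graph_def by blast
      ultimately show ?thesis unfolding E'_def image_graph_def using that by (metis (mono_tags, lifting) mem_Collect_eq)
    qed
    have ind': "\<not> e \<subseteq> I'" if "e \<in> E'" for e
      using E'c[OF that] ind u dj unfolding I'_def by blast
    have nbeq: "nb E' w = nb E w" if w: "w \<in> I'" for w
    proof -
      have "{w, t} \<in> E' \<longleftrightarrow> {w, t} \<in> E" for t
      proof
        assume "{w, t} \<in> E'"
        from E'c[OF this] show "{w, t} \<in> E"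
        proof
          assume "\<exists>s\<in>U. {w, t} = {u, s}"
          then have "w \<in> U" using u by (auto simp: doubleton_eq_iff)
          then show ?thesis using w dj unfolding I'_def by blast
        qed simp
      next
        assume e: "{w, t} \<in> E"
        then have "t \<in> U" using nbU[of w] w unfolding nb_def I'_def by blast
        then show "{w, t} \<in> E'" using E'I[OF e] w u unfolding I'_def by auto
      qed
      then show ?thesis unfolding nb_def by blast
    qed
    have "card (nb E' ` I') + card {e \<in> E'. e \<subseteq> U} \<le> nbh_const * card U + 1"
    proof (rule less.hyps)
      show "card I' < card I" using card_Diff1_less[OF finI z(1)] unfolding I'_def .
    qed (use sg' finU finI pl' dj ind' I'_def in auto)
    moreover have "card (nb E ` I) \<le> card (nb E' ` I') + 1"
    proof -
      have "nb E ` I \<subseteq> insert (nb E z) (nb E' ` I')" using nbeq unfolding I'_def by auto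
      then have "card (nb E ` I) \<le> card (insert (nb E z) (nb E' ` I'))"
        using finI unfolding I'_def by (intro card_mono) auto
      also have "\<dots> \<le> card (nb E' ` I') + 1" using card_insert_le_m1 by (metis Suc_eq_plus1 card_insert_if finI I'_def finite_Diff finite_imageI le_SucI order_refl)
      finally show ?thesis .
    qed
    moreover have "card {e \<in> E. e \<subseteq> U} + 1 \<le> card {e \<in> E'. e \<subseteq> U}"
    proof -
      have "{u, u'} \<in> E'"
      proof -
        have "{z, u'} \<in> E" using z unfolding nb_def by simp
        moreover have "(id(z := u)) ` {z, u'} = {u, u'}" using u by auto
        moreover have "card {u, u'} = 2" using z by simp
        ultimately show ?thesis unfolding E'_def image_graph_def by (metis (mono_tags, lifting) mem_Collect_eq)
      qed
      then have "insert {u, u'} {e \<in> E. e \<subseteq> U} \<subseteq> {e \<in> E'. e \<subseteq> U}" using E'I u by blast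
      moreover have "finite E'" using finite_edges[OF sg'] finU finI unfolding I'_def by simp
      ultimately have "card (insert {u, u'} {e \<in> E. e \<subseteq> U}) \<le> card {e \<in> E'. e \<subseteq> U}"
        by (intro card_mono) auto
      then show ?thesis using z(5) finE by simp
    qed
    ultimately show ?thesis by linarith
  next
    case False
    have sgF: "simple_graph U F" using sg unfolding F_def simple_graph_def by auto
    have plF: "planar U F" using planar_subgraph[OF sg pl sgF] unfolding F_def by blast
    have "nb E ` I \<subseteq> cliques U F"
    proof
      fix N assume "N \<in> nb E ` I"
      then obtain z where z: "z \<in> I" "N = nb E z" by blast
      have "{u, w} \<in> F" if "u \<in> N" "w \<in> N" "u \<noteq> w" for u w
        using False z that nbU[OF z(1)] unfolding F_def by auto
      then show "N \<in> cliques U F" unfolding cliques_def using nbU[OF z(1)] z by auto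
    qed
    then have "card (nb E ` I) \<le> card (cliques U F)"
      using finU by (intro card_mono) (auto simp: cliques_def)
    also have "\<dots> \<le> 2 ^ 62 * card U + 1" by (rule card_cliques[OF sgF finU plF])
    finally show ?thesis using planar_edge_bound[OF sgF finU plF] unfolding F_def nbh_const_def
      by (simp add: algebra_simps)
  qed
qed

lemma image_graph_comp:
  assumes "simple_graph V E"
  shows "image_graph g (image_graph h E) = image_graph (g \<circ> h) E"
proof -
  have "card (h ` e) = 2" if "e \<in> E" "card (g ` h ` e) = 2" for e
  proof -
    have c: "card e = 2" using assms that unfolding simple_graph_def by blast
    then have "finite e" using card.infinite by fastforce
    then show ?thesis using c that card_image_le[of e h] card_image_le[of "h ` e" g] by simp
  qed
  note * = this
  show ?thesis
  proof (intro set_eqI iffI)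
    fix x assume "x \<in> image_graph g (image_graph h E)"
    then show "x \<in> image_graph (g \<circ> h) E" unfolding image_graph_def by (auto simp: image_comp)
  next
    fix x assume "x \<in> image_graph (g \<circ> h) E"
    then obtain e where e: "e \<in> E" "x = g ` h ` e" "card (g ` h ` e) = 2"
      unfolding image_graph_def by (auto simp: image_comp)
    then have "h ` e \<in> image_graph h E" using * unfolding image_graph_def by blast
    then show "x \<in> image_graph g (image_graph h E)" using e unfolding image_graph_def by blast
  qed
qed

text \<open>Since every \<open>f y\<close> lies outside \<open>Y\<close>, the edge
  \<open>{f y, y}\<close> survives the contraction of the other vertices of \<open>Y\<close> and can
  be contracted next.\<close>

lemma planar_contract_set:
  assumes "simple_graph V E" "finite V" "planar V E" "finite Y" "Y \<subseteq> V" "\<And>y. y \<in> Y \<Longrightarrow> f y \<in> V - Y \<and> {f y, y} \<in> E"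
  shows "simple_graph (V - Y) (image_graph (\<lambda>v. if v \<in> Y then f v else v) E) \<and>
    planar (V - Y) (image_graph (\<lambda>v. if v \<in> Y then f v else v) E)"
  using assms(4-6)
proof (induction Y)
  case empty
  have "image_graph (\<lambda>v. if v \<in> {} then f v else v) E = E"
    using assms(1) unfolding image_graph_def simple_graph_def by auto
  then show ?case using assms(1,3) by simp
next
  case (insert y Y)
  define g where "g v = (if v \<in> Y then f v else v)" for v
  define E1 where "E1 = image_graph g E"
  have IH: "simple_graph (V - Y) E1" "planar (V - Y) E1"
    using insert unfolding E1_def g_def by auto
  have fy: "f y \<in> V" "f y \<notin> Y" "f y \<noteq> y" "{f y, y} \<in> E" using insert.prems by auto
  have "g ` {f y, y} = {f y, y}" "card {f y, y} = 2" using fy insert.hyps unfolding g_def by auto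
  then have "{f y, y} \<in> E1" unfolding E1_def image_graph_def using fy by (metis (mono_tags, lifting) mem_Collect_eq)
  note c = planar_contract[OF IH(1) _ IH(2) this]
  have "image_graph (id(y := f y)) E1 = image_graph (id(y := f y) \<circ> g) E"
    unfolding E1_def by (rule image_graph_comp[OF assms(1)])
  moreover have "id(y := f y) \<circ> g = (\<lambda>v. if v \<in> insert y Y then f v else v)"
    using insert.hyps insert.prems unfolding g_def by (auto simp: fun_eq_iff)
  moreover have "V - Y - {y} = V - insert y Y" by blast
  ultimately show ?case using c assms(2) by simp
qed

text \<open>If a maximum matching has fewer than \<open>k\<close> edges, the unmatched vertices form
  an independent set \<open>I\<close> with few distinct neighbourhoods. One representative is kept
  for each neighbourhood; all other vertices of \<open>I\<close> are twins of representatives, and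
  there are at least \<open>k\<close> of them.\<close>

lemma matching_or_twins:
  fixes V :: "nat set"
  assumes sg: "simple_graph V E" and fin: "finite V" and pl: "planar V E" and V2: "card V \<ge> 2"
    and k: "k = (card V - 1) div (2 * nbh_const + 4) + 1"
  shows "(\<exists>Y f. Y \<subseteq> V \<and> card Y = k \<and> f ` Y \<subseteq> V - Y \<and> inj_on f Y \<and> (\<forall>y\<in>Y. {f y, y} \<in> E)) \<or>
    (\<exists>Y f. Y \<subseteq> V \<and> card Y = k \<and> f ` Y \<subseteq> V - Y \<and> (\<forall>y\<in>Y. nb E y = nb E (f y) \<and> nb E y \<inter> Y = {}))"
proof -
  have finE: "finite E" using finite_edges[OF sg fin] .
  define Ms where "Ms = {M. M \<subseteq> E \<and> pairwise disjnt M}"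
  have finMs: "finite (card ` Ms)" unfolding Ms_def using finE by simp
  have "{} \<in> Ms" unfolding Ms_def by simp
  then have "Max (card ` Ms) \<in> card ` Ms" by (intro Max_in[OF finMs]) auto
  then obtain M where "M \<in> Ms" "card M = Max (card ` Ms)" by auto
  then have M: "M \<in> Ms" "\<And>M'. M' \<in> Ms \<Longrightarrow> card M' \<le> card M"
    using Max_ge[OF finMs] by auto
  have ME: "M \<subseteq> E" and Md: "pairwise disjnt M" using M(1) unfolding Ms_def by auto
  have finM: "finite M" using ME finE finite_subset by blast
  have e2: "card e = 2" "e \<subseteq> V" "finite e" "e \<noteq> {}" if "e \<in> E" for e
    using sg that fin finite_subset unfolding simple_graph_def by (auto intro: finite_subset)
  show ?thesis
  proof (cases "k \<le> card M")
    case True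
    then obtain M' where M': "M' \<subseteq> M" "card M' = k" by (metis obtain_subset_with_card_n)
    have injMin: "inj_on Min M'"
    proof (rule inj_onI)
      fix e e' assume ee: "e \<in> M'" "e' \<in> M'" "Min e = Min e'"
      have "e \<in> E" "e' \<in> E" using ee M' ME by auto
      then have "Min e \<in> e" "Min e' \<in> e'" using Min_in e2 by auto
      then show "e = e'" using pairwiseD[OF Md, of e e'] ee M'(1) unfolding disjnt_def by auto
    qed
    define Y where "Y = Min ` M'"
    define f where "f y = Max (the_inv_into M' Min y)" for y
    have f: "f (Min e) = Max e" if "e \<in> M'" for e unfolding f_def using the_inv_into_f_f[OF injMin that] by simp
    have mm: "e = {Max e, Min e} \<and> Max e \<noteq> Min e \<and> Max e \<in> e \<and> Min e \<in> e" if "e \<in> M'" for e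
    proof -
      have eE: "e \<in> E" using that M' ME by auto
      then obtain a b where "e = {a, b}" "a \<noteq> b" using simple_graph_edgeE[OF sg] by metis
      then show ?thesis by (auto simp: max_def min_def)
    qed
    have dj: "e = e'" if "e \<in> M'" "e' \<in> M'" "x \<in> e" "x \<in> e'" for e e' x
      using pairwiseD[OF Md, of e e'] that M'(1) unfolding disjnt_def by blast
    have M'V: "e \<subseteq> V" "e \<in> E" if "e \<in> M'" for e using e2(2)[of e] that M'(1) ME by blast+
    have "Y \<subseteq> V" unfolding Y_def using mm M'V by blast
    moreover have "card Y = k" unfolding Y_def using card_image[OF injMin] M' by simp
    moreover have "f ` Y \<subseteq> V - Y"
    proof
      fix x assume "x \<in> f ` Y"
      then obtain e where e: "e \<in> M'" "x = Max e" unfolding Y_def using f by auto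
      have "x \<notin> Y"
      proof
        assume "x \<in> Y"
        then obtain e' where e': "e' \<in> M'" "x = Min e'" unfolding Y_def by blast
        then have "e = e'" using dj[of e e' x] mm e by metis
        then show False using mm e e' by metis
      qed
      then show "x \<in> V - Y" using e mm M'V by blast
    qed
    moreover have "inj_on f Y"
    proof (rule inj_onI)
      fix x y assume xy: "x \<in> Y" "y \<in> Y" "f x = f y"
      then obtain e e' where e: "e \<in> M'" "x = Min e" "e' \<in> M'" "y = Min e'" unfolding Y_def by blast
      then have "Max e = Max e'" using xy f by simp
      then have "e = e'" using dj[of e e' "Max e"] mm e by metis
      then show "x = y" using e by simp
    qed
    moreover have "\<forall>y\<in>Y. {f y, y} \<in> E"
      unfolding Y_def using f mm M'V by (metis (no_types, lifting) imageE)
    ultimately show ?thesis by blast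
  next
    case False
    define U where "U = \<Union>M"
    define I where "I = V - U"
    have UV: "U \<subseteq> V" unfolding U_def using ME e2 by blast
    have finU: "finite U" "finite I" using UV fin finite_subset unfolding I_def by auto
    have cU: "card U \<le> 2 * (k - 1)"
    proof -
      have "card U \<le> (\<Sum>e\<in>M. card e)" unfolding U_def by (rule card_Union_le_sum_card)
      also have "\<dots> = 2 * card M" using ME e2 by (simp add: subset_iff)
      finally show ?thesis using False by simp
    qed
    have ind: "\<not> e \<subseteq> I" if "e \<in> E" for e
    proof
      assume "e \<subseteq> I"
      then have d: "disjnt e e'" if "e' \<in> M" for e' using that unfolding I_def U_def disjnt_def by blast
      then have "insert e M \<in> Ms" using M(1) \<open>e \<in> E\<close> unfolding Ms_def
        by (auto simp: pairwise_insert disjnt_sym)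
      moreover have "e \<notin> M" using d[of e] e2[OF \<open>e \<in> E\<close>] unfolding disjnt_def by blast
      ultimately show False using M(2)[of "insert e M"] finM by simp
    qed
    have UI: "U \<union> I = V" "U \<inter> I = {}" using UV unfolding I_def by auto
    have cN: "card (nb E ` I) \<le> nbh_const * card U + 1"
      using card_neighbourhoods[of U I E] sg pl finU ind UI by simp
    define h where "h N = (SOME z. z \<in> I \<and> nb E z = N)" for N
    have h: "h N \<in> I \<and> nb E (h N) = N" if "N \<in> nb E ` I" for N
    proof -
      from that obtain z where "z \<in> I \<and> nb E z = N" by blast
      then show ?thesis unfolding h_def by (rule someI)
    qed
    define R where "R = h ` nb E ` I"
    have RI: "R \<subseteq> I" unfolding R_def using h by blast
    have cR: "card R \<le> card (nb E ` I)" unfolding R_def using finU(2) by (intro card_image_le) auto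
    have "k \<le> card (I - R)"
    proof -
      have "card I = card V - card U" unfolding I_def using UV finU by (simp add: card_Diff_subset)
      moreover have "card (I - R) = card I - card R" using RI finU finite_subset by (metis card_Diff_subset)
      \<comment> \<open>With \<open>k = j + 1\<close> and at most \<open>2 j\<close> matched
        vertices the left side is at most \<open>j (2 nbh_const + 3) + 2\<close>; the divisor
        \<open>2 nbh_const + 4\<close> in the definition of \<open>k\<close> is made for
        this.\<close>
      moreover have "card U + (nbh_const * card U + 1) + k \<le> card V"
      proof (cases "k = 1")
        case True
        then show ?thesis using cU V2 by simp
      next
        case k1: False
        define j where "j = k - 1"
        have j: "k = j + 1" "j \<ge> 1" using k1 k unfolding j_def by auto
        have "j * (2 * nbh_const + 4) \<le> card V - 1" using k unfolding j_def by simp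
        then have "j * (2 * nbh_const) + 4 * j + 1 \<le> card V" using V2 by (simp add: algebra_simps)
        moreover have "nbh_const * card U \<le> j * (2 * nbh_const)"
          using mult_le_mono2[OF cU, of nbh_const] unfolding j_def[symmetric] by (simp add: mult.commute mult.left_commute)
        moreover have "card U \<le> 2 * j" using cU unfolding j_def .
        ultimately show ?thesis using j by linarith
      qed
      ultimately show ?thesis using cR cN by linarith
    qed
    then obtain Y where Y: "Y \<subseteq> I - R" "card Y = k" by (metis obtain_subset_with_card_n)
    define f where "f y = h (nb E y)" for y
    have nbU: "nb E z \<subseteq> U" if "z \<in> I" for z
    proof
      fix u assume u: "u \<in> nb E z"
      then have "u \<in> V" using nb_simple[OF sg] by blast
      moreover have "u \<notin> I" using ind[of "{z, u}"] u that unfolding nb_def by auto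
      ultimately show "u \<in> U" using UI by blast
    qed
    have "Y \<subseteq> V" using Y UI by blast
    moreover have "f ` Y \<subseteq> V - Y" using Y RI UI unfolding f_def R_def by blast
    moreover have "\<forall>y\<in>Y. nb E y = nb E (f y) \<and> nb E y \<inter> Y = {}"
    proof
      fix y assume y: "y \<in> Y"
      then have "y \<in> I" using Y by blast
      then show "nb E y = nb E (f y) \<and> nb E y \<inter> Y = {}"
        using h[of "nb E y"] nbU[of y] Y UI(2) unfolding f_def by blast
    qed
    ultimately show ?thesis using Y(2) by blast
  qed
qed

text \<open>A graph is encoded by \<open>Y\<close>, a partner map \<open>f\<close>, a planar graph
  \<open>H\<close> on the remaining vertices, and extra information of exponential size. In the
  matching case \<open>H\<close> is the contraction and the graph is a subset of
  \<open>Cand Y f H\<close>; in the twin case \<open>H\<close> is the graph without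
  \<open>Y\<close>, and \<open>Y\<close>, \<open>f\<close>, \<open>H\<close> determine
  everything.\<close>

lemma pgraphs_recursion:
  assumes n: "n \<ge> 2" and k: "k = (n - 1) div (2 * nbh_const + 4) + 1"
  shows "card (pgraphs {1..n}) \<le> 2 ^ (499 * n) * ((n - k) ^ k * card (pgraphs {1..n - k}))"
proof -
  define V where "V = {1..n}"
  have fV: "finite V" and cV: "card V = n" unfolding V_def by auto
  define D where "D = (SIGMA Y:{Y \<in> Pow V. card Y = k}. (PiE Y (\<lambda>_. V - Y)) \<times> pgraphs (V - Y))"
  \<comment> \<open>The vertex that the matching contracts into \<open>c\<close>, or
    \<open>c\<close> itself if there is none. \<open>D\<close> also contains non-injective
    \<open>f\<close>; the bound on the size of \<open>Cand\<close> holds whatever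
    \<open>\<sigma>\<close> is then.\<close>
  define \<sigma> where "\<sigma> Y f c = (if c \<in> f ` Y then the_inv_into Y f c else c)" for Y and f :: "nat \<Rightarrow> nat" and c
  define Cand where "Cand Y f H = (\<Union>h\<in>H. Pow (h \<union> \<sigma> Y f ` h)) \<union> (\<lambda>c. {c, \<sigma> Y f c}) ` (V - Y)" for Y f and H :: "nat set set"
  define tw where "tw Y f H = H \<union> {{y, u} |y u. y \<in> Y \<and> u \<in> nb H (f y)}" for Y and f :: "nat \<Rightarrow> nat" and H
  have cover: "pgraphs V \<subseteq> (\<Union>(Y, f, H)\<in>D. insert (tw Y f H) (Pow (Cand Y f H)))"
  proof
    fix E assume "E \<in> pgraphs V"
    then have sg: "simple_graph V E" and pl: "planar V E" unfolding pgraphs_def by auto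
    have V2: "card V \<ge> 2" using n cV by simp
    have kV: "k = (card V - 1) div (2 * nbh_const + 4) + 1" using k cV by simp
    from matching_or_twins[OF sg fV pl V2 kV]
    show "E \<in> (\<Union>(Y, f, H)\<in>D. insert (tw Y f H) (Pow (Cand Y f H)))"
    proof (elim disjE exE conjE)
      fix Y f0 assume Y: "Y \<subseteq> V" "card Y = k" "f0 ` Y \<subseteq> V - Y" "inj_on f0 Y" "\<forall>y\<in>Y. {f0 y, y} \<in> E"
      define f where "f = restrict f0 Y"
      have fY: "f y = f0 y" if "y \<in> Y" for y using that unfolding f_def by simp
      have finY: "finite Y" using Y(1) fV finite_subset by blast
      have injf: "inj_on f Y" using Y(4) fY by (simp add: inj_on_def)
      have fE: "f \<in> PiE Y (\<lambda>_. V - Y)" unfolding f_def using Y(3) by auto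
      define g where "g v = (if v \<in> Y then f v else v)" for v
      define H where "H = image_graph g E"
      have "simple_graph (V - Y) H \<and> planar (V - Y) H"
        unfolding H_def g_def using Y fY fE by (intro planar_contract_set[OF sg fV pl finY Y(1)]) auto
      then have D: "(Y, f, H) \<in> D" unfolding D_def pgraphs_def using Y fE by auto
      have \<sigma>: "\<sigma> Y f (f y) = y" if "y \<in> Y" for y unfolding \<sigma>_def using that the_inv_into_f_f[OF injf] by simp
      have "e \<in> Cand Y f H" if e: "e \<in> E" for e
      proof -
        obtain a b where ab: "e = {a, b}" "a \<noteq> b" "a \<in> V" "b \<in> V" using simple_graph_edgeE[OF sg e] .
        have mem: "c \<in> insert (g c) {\<sigma> Y f (g c)}" for c unfolding g_def using \<sigma> by auto
        show ?thesis
        proof (cases "g a = g b")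
          case False
          then have "card (g ` e) = 2" using ab by simp
          then have h: "g ` e \<in> H" unfolding H_def image_graph_def using e by blast
          have "e \<subseteq> g ` e \<union> \<sigma> Y f ` g ` e" using mem[of a] mem[of b] ab by auto
          then show ?thesis unfolding Cand_def using h by blast
        next
          case True
          then have "(a \<in> Y \<and> b \<notin> Y \<and> b = f a) \<or> (b \<in> Y \<and> a \<notin> Y \<and> a = f b)"
            using ab(2) injf unfolding g_def by (auto simp: inj_on_def split: if_splits)
          then have "(b \<in> V - Y \<and> e = {b, \<sigma> Y f b}) \<or> (a \<in> V - Y \<and> e = {a, \<sigma> Y f a})"
            using \<sigma> ab by (auto simp: insert_commute)
          then show ?thesis unfolding Cand_def by blast
        qed
      qed
      then have "E \<in> Pow (Cand Y f H)" by blast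
      then show ?thesis using D by blast
    next
      fix Y f0 assume Y: "Y \<subseteq> V" "card Y = k" "f0 ` Y \<subseteq> V - Y" "\<forall>y\<in>Y. nb E y = nb E (f0 y) \<and> nb E y \<inter> Y = {}"
      define f where "f = restrict f0 Y"
      have fY: "f y = f0 y" if "y \<in> Y" for y using that unfolding f_def by simp
      have fE: "f \<in> PiE Y (\<lambda>_. V - Y)" unfolding f_def using Y(3) by auto
      define H where "H = {e \<in> E. e \<inter> Y = {}}"
      have sgH: "simple_graph (V - Y) H" using sg unfolding H_def simple_graph_def by auto
      have "planar (V - Y) H" using planar_subgraph[OF sg pl sgH] unfolding H_def by blast
      then have D: "(Y, f, H) \<in> D" unfolding D_def pgraphs_def using Y fE sgH by auto
      have fn: "f y \<notin> Y" "nb E y = nb E (f y)" "nb E y \<inter> Y = {}" if "y \<in> Y" for y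
        using fY[OF that] Y(3,4) that by (blast, simp, blast)
      have nbH: "nb H (f y) = nb E y" if "y \<in> Y" for y
      proof -
        have "u \<in> nb H (f y) \<longleftrightarrow> u \<in> nb E (f y) \<and> u \<notin> Y" for u
          using fn(1)[OF that] unfolding H_def nb_def by auto
        then show ?thesis using fn(2,3)[OF that] by blast
      qed
      have "E = tw Y f H"
      proof (intro set_eqI iffI)
        fix e assume e: "e \<in> E"
        show "e \<in> tw Y f H"
        proof (cases "e \<inter> Y = {}")
          case True
          then show ?thesis using e unfolding tw_def H_def by blast
        next
          case False
          obtain a b where ab: "e = {a, b}" using simple_graph_edgeE[OF sg e] by metis
          then obtain y u where yu: "e = {y, u}" "y \<in> Y" using False by (auto simp: insert_commute)
          then have "u \<in> nb H (f y)" using nbH e unfolding nb_def by auto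
          then show ?thesis unfolding tw_def using yu by blast
        qed
      next
        fix e assume "e \<in> tw Y f H"
        then consider "e \<in> H" | y u where "y \<in> Y" "u \<in> nb H (f y)" "e = {y, u}" unfolding tw_def by blast
        then show "e \<in> E"
        proof cases
          case 1
          then show ?thesis unfolding H_def by blast
        next
          case 2
          then show ?thesis using nbH unfolding nb_def by auto
        qed
      qed
      then show ?thesis using D by blast
    qed
  qed
  have finPi: "finite (PiE Y (\<lambda>_. V - Y))" if "Y \<subseteq> V" for Y
    using that fV finite_subset by (intro finite_PiE) auto
  have finP: "finite (pgraphs (V - Y))" for Y using fV by (intro finite_pgraphs) simp
  have fD: "finite D" unfolding D_def using fV finPi finP
    by (intro finite_SigmaI finite_cartesian_product) auto
  have cD: "card D \<le> 2 ^ n * ((n - k) ^ k * card (pgraphs {1..n - k}))"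
  proof -
    have "card D = (\<Sum>Y\<in>{Y \<in> Pow V. card Y = k}. card ((PiE Y (\<lambda>_. V - Y)) \<times> pgraphs (V - Y)))"
      unfolding D_def using fV finPi finP by (intro card_SigmaI) auto
    also have "\<dots> = (\<Sum>Y\<in>{Y \<in> Pow V. card Y = k}. (n - k) ^ k * card (pgraphs {1..n - k}))"
    proof (rule sum.cong)
      fix Y assume "Y \<in> {Y \<in> Pow V. card Y = k}"
      then have Y: "Y \<subseteq> V" "card Y = k" "finite Y" using fV finite_subset by auto
      then have c: "card (V - Y) = n - k" using cV by (simp add: card_Diff_subset)
      have "card (PiE Y (\<lambda>_. V - Y)) = (n - k) ^ k" using Y c by (simp add: card_PiE)
      moreover have "card (pgraphs (V - Y)) = card (pgraphs {1..n - k})" using card_pgraphs[of "V - Y"] fV c by simp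
      ultimately show "card ((PiE Y (\<lambda>_. V - Y)) \<times> pgraphs (V - Y)) = (n - k) ^ k * card (pgraphs {1..n - k})"
        by (simp add: card_cartesian_product)
    qed simp
    also have "\<dots> = card {Y \<in> Pow V. card Y = k} * ((n - k) ^ k * card (pgraphs {1..n - k}))" by simp
    also have "card {Y \<in> Pow V. card Y = k} \<le> card (Pow V)" using fV by (intro card_mono) auto
    also have "card (Pow V) = 2 ^ n" using fV cV by (simp add: card_Pow)
    finally show ?thesis by simp
  qed
  \<comment> \<open>At most \<open>31 n\<close> edges \<open>h\<close> with 16 sets each and at most
    \<open>n\<close> partner pairs give \<open>497 n\<close> candidates. Adding the twin graph
    raises the exponent to \<open>498 n\<close>, and the choice of \<open>Y\<close> raises it to
    \<open>499 n\<close>.\<close>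
  have piece: "card (insert (tw Y f H) (Pow (Cand Y f H))) \<le> 2 ^ (498 * n)" if d: "(Y, f, H) \<in> D" for Y f H
  proof -
    have Y: "Y \<subseteq> V" "H \<in> pgraphs (V - Y)" using d unfolding D_def by auto
    have sgH: "simple_graph (V - Y) H" and plH: "planar (V - Y) H" using Y unfolding pgraphs_def by auto
    have fVY: "finite (V - Y)" "card (V - Y) \<le> n" using fV cV card_mono[of V "V - Y"] by auto
    have finH: "finite H" using finite_edges[OF sgH fVY(1)] .
    have cH: "card H \<le> 31 * n" using planar_edge_bound[OF sgH fVY(1) plH] fVY(2) by linarith
    have hh: "finite h \<and> card (Pow (h \<union> \<sigma> Y f ` h)) \<le> 16" if "h \<in> H" for h
    proof -
      have h: "card h = 2" using sgH that unfolding simple_graph_def by blast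
      then have fh: "finite h" by (metis card.infinite zero_neq_numeral)
      have "card (h \<union> \<sigma> Y f ` h) \<le> card h + card (\<sigma> Y f ` h)" by (rule card_Un_le)
      also have "\<dots> \<le> 4" using card_image_le[OF fh, of "\<sigma> Y f"] h by simp
      finally have "(2::nat) ^ card (h \<union> \<sigma> Y f ` h) \<le> 2 ^ 4" by (intro power_increasing) auto
      then show ?thesis using fh by (simp add: card_Pow)
    qed
    have finC: "finite (Cand Y f H)" unfolding Cand_def using finH hh fVY by auto
    have "card (Cand Y f H) \<le> card (\<Union>h\<in>H. Pow (h \<union> \<sigma> Y f ` h)) + card ((\<lambda>c. {c, \<sigma> Y f c}) ` (V - Y))"
      unfolding Cand_def by (rule card_Un_le)
    also have "card (\<Union>h\<in>H. Pow (h \<union> \<sigma> Y f ` h)) \<le> (\<Sum>h\<in>H. card (Pow (h \<union> \<sigma> Y f ` h)))"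
      using finH by (rule card_UN_le)
    also have "\<dots> \<le> (\<Sum>h\<in>H. 16)" using hh by (intro sum_mono) blast
    also have "card ((\<lambda>c. {c, \<sigma> Y f c}) ` (V - Y)) \<le> n" using card_image_le[OF fVY(1)] fVY(2) order_trans by blast
    finally have "card (Cand Y f H) \<le> 497 * n" using cH by simp
    then have "(2::nat) ^ card (Cand Y f H) \<le> 2 ^ (497 * n)" by (intro power_increasing) auto
    moreover have "card (insert (tw Y f H) (Pow (Cand Y f H))) \<le> Suc (2 ^ card (Cand Y f H))"
      using finC card_insert_le_m1[of "Suc (2 ^ card (Cand Y f H))" "Pow (Cand Y f H)"] by (simp add: card_Pow card_insert_if)
    moreover have "Suc (2 ^ (497 * n)) \<le> (2::nat) ^ (498 * n)"
    proof -
      have "Suc (2 ^ (497 * n)) \<le> 2 * (2::nat) ^ (497 * n)" by simp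
      also have "\<dots> = 2 ^ (Suc (497 * n))" by simp
      also have "\<dots> \<le> 2 ^ (498 * n)" using n by (intro power_increasing) auto
      finally show ?thesis .
    qed
    ultimately show ?thesis by linarith
  qed
  have "card (pgraphs V) \<le> card (\<Union>(Y, f, H)\<in>D. insert (tw Y f H) (Pow (Cand Y f H)))"
  proof (rule card_mono[OF _ cover])
    have "finite (insert (tw Y f H) (Pow (Cand Y f H)))" if d: "(Y, f, H) \<in> D" for Y f H
    proof -
      have "H \<in> pgraphs (V - Y)" using d unfolding D_def by auto
      then have sgH: "simple_graph (V - Y) H" unfolding pgraphs_def by auto
      have "finite H" using finite_edges[OF sgH] fV by blast
      moreover have "finite h" if "h \<in> H" for h
        using sgH that fV finite_subset unfolding simple_graph_def by (metis finite_Diff)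
      ultimately show ?thesis unfolding Cand_def using fV by auto
    qed
    then show "finite (\<Union>(Y, f, H)\<in>D. insert (tw Y f H) (Pow (Cand Y f H)))" using fD by auto
  qed
  also have "\<dots> \<le> (\<Sum>d\<in>D. card (case d of (Y, f, H) \<Rightarrow> insert (tw Y f H) (Pow (Cand Y f H))))"
    using fD by (rule card_UN_le)
  also have "\<dots> \<le> (\<Sum>d\<in>D. 2 ^ (498 * n))" using piece by (intro sum_mono) auto
  also have "\<dots> = card D * 2 ^ (498 * n)" by simp
  also have "\<dots> \<le> (2 ^ n * ((n - k) ^ k * card (pgraphs {1..n - k}))) * 2 ^ (498 * n)" using cD by (rule mult_le_mono1)
  also have "\<dots> = 2 ^ (499 * n) * ((n - k) ^ k * card (pgraphs {1..n - k}))"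
    by (simp add: power_add[symmetric] mult.commute mult.left_commute)
  finally show ?thesis unfolding V_def .
qed

lemma pow_fact_le: "m ^ k * fact m \<le> (fact (m + k) :: nat)"
proof (induction k)
  case (Suc k)
  have "m ^ Suc k * fact m = m * (m ^ k * fact m)" by simp
  also have "\<dots> \<le> Suc (m + k) * fact (m + k)" using Suc by (intro mult_le_mono) auto
  finally show ?case by simp
qed simp

text \<open>Contracting a matching or deleting twins removes a constant fraction of the vertices at the
  price of an exponential factor (Norine, Seymour, Thomas and Wollan).\<close>

theorem planar_graphs_small: "\<exists>C\<ge>1. \<forall>n. card (pgraphs {1..n}) \<le> fact n * C ^ n"
proof -
  define L where "L = 2 * nbh_const + 4"
  have L: "L > 0" unfolding L_def by simp
  \<comment> \<open>As \<open>n \<le> L k\<close>, the factor \<open>C ^ k\<close> pays for the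
    \<open>2 ^ (499 n)\<close> of one recursion step; the partner maps are absorbed by the factorial
    through \<open>pow_fact_le\<close>.\<close>
  define C :: nat where "C = 2 ^ (499 * L)"
  have C1: "C \<ge> 1" unfolding C_def by simp
  have "card (pgraphs {1..n}) \<le> fact n * C ^ n" for n
  proof (induction n rule: less_induct)
    case (less n)
    show ?case
    proof (cases "n \<ge> 2")
      case False
      then have "pgraphs {1..n} \<subseteq> {{}}"
        unfolding pgraphs_def simple_graph_def by (auto simp: card_2_iff)
      then have "card (pgraphs {1..n}) \<le> 1" using card_mono[of "{{}}" "pgraphs {1..n}"] by simp
      also have "\<dots> \<le> fact n * C ^ n" using C1 by (simp add: Suc_leI)
      finally show ?thesis .
    next
      case n: True
      define k where "k = (n - 1) div L + 1"
      have "(n - 1) div L \<le> n - 1" by (rule div_le_dividend)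
      then have kn: "k \<le> n" "k \<ge> 1" unfolding k_def using n by linarith+
      have Lk: "n \<le> L * k"
      proof -
        have "n - 1 = L * ((n - 1) div L) + (n - 1) mod L" by simp
        moreover have "(n - 1) mod L < L" using L by simp
        ultimately have "n - 1 < L * ((n - 1) div L) + L" by linarith
        then show ?thesis unfolding k_def using n by simp
      qed
      have "card (pgraphs {1..n}) \<le> 2 ^ (499 * n) * ((n - k) ^ k * card (pgraphs {1..n - k}))"
        by (rule pgraphs_recursion[OF n]) (simp add: k_def L_def)
      also have "\<dots> \<le> 2 ^ (499 * n) * ((n - k) ^ k * (fact (n - k) * C ^ (n - k)))"
        using less[of "n - k"] kn n by (intro mult_le_mono order_refl) simp
      also have "\<dots> = 2 ^ (499 * n) * (((n - k) ^ k * fact (n - k)) * C ^ (n - k))" by (simp only: mult.assoc)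
      also have "\<dots> \<le> C ^ k * (fact n * C ^ (n - k))"
      proof (intro mult_le_mono order_refl)
        have "(2::nat) ^ (499 * n) \<le> 2 ^ (499 * (L * k))" using Lk by (intro power_increasing) auto
        also have "\<dots> = C ^ k" unfolding C_def by (simp add: power_mult[symmetric] mult.assoc)
        finally show "(2::nat) ^ (499 * n) \<le> C ^ k" .
        show "(n - k) ^ k * fact (n - k) \<le> fact n" using pow_fact_le[of "n - k" k] kn by simp
      qed
      also have "\<dots> = fact n * C ^ (k + (n - k))" by (simp only: power_add mult.left_commute)
      also have "k + (n - k) = n" using kn by simp
      finally show ?thesis .
    qed
  qed
  then show ?thesis using C1 by blast
qed

section \<open>Connected planar graphs\<close>

definition pgm :: "'a set \<Rightarrow> nat \<Rightarrow> 'a set set set" where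
  "pgm V m = {E. simple_graph V E \<and> planar V E \<and> card E = m}"

definition adj :: "'a set set \<Rightarrow> ('a \<times> 'a) set" where
  "adj E = {(u, v). {u, v} \<in> E}"

definition cls :: "'a set set \<Rightarrow> 'a \<Rightarrow> 'a set" where
  "cls E v = {u. (v, u) \<in> (adj E)\<^sup>*}"

definition comps :: "'a set \<Rightarrow> 'a set set \<Rightarrow> 'a set set" where
  "comps V E = cls E ` V"

definition conn :: "'a set \<Rightarrow> 'a set set \<Rightarrow> bool" where
  "conn V E \<longleftrightarrow> (\<forall>u\<in>V. \<forall>v\<in>V. v \<in> cls E u)"

definition cgm :: "'a set \<Rightarrow> nat \<Rightarrow> 'a set set set" where
  "cgm V m = {E \<in> pgm V m. conn V E}"

lemma finite_pgm: "finite V \<Longrightarrow> finite (pgm V m)"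
  using finite_pgraphs by (rule finite_subset[rotated]) (auto simp: pgm_def pgraphs_def)

lemma finite_cgm: "finite V \<Longrightarrow> finite (cgm V m)"
  unfolding cgm_def by (simp add: finite_pgm)

lemma sym_adj: "sym (adj E)"
  unfolding adj_def sym_def by (simp add: insert_commute)

lemma cls_refl: "v \<in> cls E v"
  unfolding cls_def by simp

lemma cls_eq: "u \<in> cls E v \<Longrightarrow> cls E u = cls E v"
proof -
  have s: "sym ((adj E)\<^sup>*)" using sym_adj by (rule sym_rtrancl)
  assume "u \<in> cls E v"
  then have "(v, u) \<in> (adj E)\<^sup>*" "(u, v) \<in> (adj E)\<^sup>*" using s unfolding cls_def sym_def by auto
  then show ?thesis unfolding cls_def by (auto intro: rtrancl_trans)
qed

lemma cls_sym: "u \<in> cls E v \<longleftrightarrow> v \<in> cls E u"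
  using cls_eq cls_refl by metis

lemma cls_mono: "E \<subseteq> E' \<Longrightarrow> cls E v \<subseteq> cls E' v"
proof -
  assume "E \<subseteq> E'"
  then have "adj E \<subseteq> adj E'" unfolding adj_def by blast
  then show ?thesis unfolding cls_def using rtrancl_mono by blast
qed

lemma cls_closed:
  assumes "x \<in> S" "\<And>u v. {u, v} \<in> E \<Longrightarrow> u \<in> S \<Longrightarrow> v \<in> S"
  shows "cls E x \<subseteq> S"
proof
  fix y assume "y \<in> cls E x"
  then have "(x, y) \<in> (adj E)\<^sup>*" unfolding cls_def by simp
  then show "y \<in> S"
  proof (induction rule: rtrancl_induct)
    case (step a b)
    then show ?case using assms(2)[of a b] unfolding adj_def by blast
  qed (rule assms(1))
qed

lemma cls_step: "u \<in> cls E x \<Longrightarrow> {u, v} \<in> E \<Longrightarrow> v \<in> cls E x"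
  unfolding cls_def adj_def by (simp add: rtrancl_into_rtrancl)

lemma cls_subset: "simple_graph V E \<Longrightarrow> x \<in> V \<Longrightarrow> cls E x \<subseteq> V"
  by (rule cls_closed) (auto dest: simple_graph_edgeD)

lemma conn_crossing:
  assumes "conn V E" "x \<in> V" "y \<in> V" "x \<in> S" "y \<notin> S"
  obtains u v where "{u, v} \<in> E" "u \<in> S" "v \<notin> S"
proof -
  have "\<not> cls E x \<subseteq> S" using assms unfolding conn_def by blast
  then show thesis using cls_closed[OF assms(4)] that by blast
qed

lemma conn_bridge:
  assumes "conn V1 E1" "conn V2 E2" "x \<in> V1" "y \<in> V2"
  shows "conn (V1 \<union> V2) (insert {x, y} (E1 \<union> E2))"
proof -
  let ?E = "insert {x, y} (E1 \<union> E2)"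
  have 1: "V1 \<subseteq> cls ?E x" using assms(1,3) cls_mono[of E1 ?E x] unfolding conn_def by blast
  have "y \<in> cls ?E x" by (rule cls_step[OF cls_refl]) simp
  moreover have "V2 \<subseteq> cls ?E y" using assms(2,4) cls_mono[of E2 ?E y] unfolding conn_def by blast
  ultimately have 2: "V2 \<subseteq> cls ?E x" using cls_eq[of y ?E x] by simp
  show ?thesis unfolding conn_def
  proof (intro ballI)
    fix u v assume "u \<in> V1 \<union> V2" "v \<in> V1 \<union> V2"
    then have "u \<in> cls ?E x" "v \<in> cls ?E x" using 1 2 by auto
    then show "v \<in> cls ?E u" using cls_eq[of u ?E x] by simp
  qed
qed

lemma relabel_conn:
  assumes "inj_on f V" "simple_graph V E" "conn V E"
  shows "conn (f ` V) ((`) f ` E)"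
proof -
  have step: "f v \<in> cls ((`) f ` E) (f u)" if "u \<in> V" "v \<in> cls E u" for u v
  proof -
    have "cls E u \<subseteq> {w. f w \<in> cls ((`) f ` E) (f u)}"
    proof (rule cls_closed)
      fix a b assume ab: "{a, b} \<in> E" "a \<in> {w. f w \<in> cls ((`) f ` E) (f u)}"
      have "f ` {a, b} \<in> (`) f ` E" using ab(1) by (rule imageI)
      then show "b \<in> {w. f w \<in> cls ((`) f ` E) (f u)}"
        using cls_step[of "f a" "(`) f ` E" "f u" "f b"] ab(2) by simp
    qed (simp add: cls_refl)
    then show ?thesis using that by blast
  qed
  then show ?thesis using assms(3) unfolding conn_def by blast
qed

lemma card_relabel:
  fixes A :: "nat set \<Rightarrow> nat set set set"
  assumes inv: "\<And>f V E. inj_on f V \<Longrightarrow> simple_graph V E \<Longrightarrow> planar V E \<Longrightarrow> E \<in> A V \<Longrightarrow> (`) f ` E \<in> A (f ` V)"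
    and A: "\<And>V. A V \<subseteq> pgraphs V" and fin: "finite V" "finite W" "card V = card W"
  shows "card (A V) = card (A W)"
proof -
  have le: "card (A V) \<le> card (A W)" if VW: "finite V" "finite W" "card V = card W" for V W
  proof -
    obtain f where f: "bij_betw f V W" using finite_same_card_bij[OF VW] by blast
    show ?thesis
    proof (rule card_relabel_le[of f V])
      show "inj_on f V" using f bij_betw_def by blast
      fix E assume E: "E \<in> A V"
      then show "simple_graph V E" using A unfolding pgraphs_def by blast
      show "(`) f ` E \<in> A W"
        using inv[of f V E] E A[of V] f unfolding pgraphs_def bij_betw_def by auto
    qed (rule finite_subset[OF A finite_pgraphs[OF VW(2)]])
  qed
  show ?thesis using le[OF fin] le[OF fin(2,1) fin(3)[symmetric]] by simp
qed

lemma card_relabel_edges: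
  assumes "inj_on f V" "simple_graph V E"
  shows "card ((`) f ` E) = card E"
proof (rule card_image)
  have "inj_on ((`) f) (Pow V)" using assms(1) by (rule inj_on_image_Pow)
  then show "inj_on ((`) f) E" using assms(2) unfolding simple_graph_def by (meson Pow_iff inj_on_subset subsetI)
qed

lemma card_cgm: "finite (V :: nat set) \<Longrightarrow> card (cgm V m) = card (cgm {1..card V} m)"
  by (rule card_relabel[where A = "\<lambda>V. cgm V m"])
    (auto simp: cgm_def pgm_def pgraphs_def planar_relabel card_relabel_edges relabel_conn)

lemma card_ordered_edges:
  assumes "simple_graph V E" "finite V"
  shows "card {(x, y). {x, y} \<in> E} = 2 * card E"
proof -
  have "{(x, y). {x, y} \<in> E} = Sigma V (nb E)"
    using simple_graph_edgeD[OF assms(1)] unfolding nb_def by blast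
  moreover have "finite (nb E v)" for v using nb_subset[OF assms(1)] assms(2) finite_subset by blast
  ultimately show ?thesis using handshake[OF assms] assms(2) by (simp add: card_SigmaI)
qed

text \<open>Two connected graphs on complementary vertex sets are joined by an edge from a chosen
  \<open>x\<close> to a chosen \<open>y\<close>. The result with the ordered pair
  \<open>(x, y)\<close> marked gives everything back, because \<open>S\<close> is the component of
  \<open>x\<close> once the marked edge is removed. A graph has twice as many ordered pairs as
  edges.\<close>

lemma superadditive:
  shows "(n1 + n2 choose n1) * (card (cgm {1..n1} m1) * (card (cgm {1..n2} m2) * (n1 * n2)))
    \<le> card (cgm {1..n1 + n2} (m1 + m2 + 1)) * (2 * (m1 + m2 + 1))"
proof -
  define V where "V = {1..n1 + n2}"
  have fV: "finite V" "card V = n1 + n2" unfolding V_def by auto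
  define D where "D = (SIGMA S:{S. S \<subseteq> V \<and> card S = n1}. cgm S m1 \<times> (cgm (V - S) m2 \<times> (S \<times> (V - S))))"
  define T where "T = (SIGMA E:cgm V (m1 + m2 + 1). {(x, y). {x, y} \<in> E})"
  define F where "F = (\<lambda>(S :: nat set, E1, E2, x, y). (insert {x, y} (E1 \<union> E2), (x, y :: nat)))"
  have finS: "finite S" if "S \<subseteq> V" for S using that fV finite_subset by blast
  have edges: "e \<subseteq> S \<and> card e = 2" if "E \<in> cgm S m" "e \<in> E" for E and S :: "nat set" and m e
    using that unfolding cgm_def pgm_def simple_graph_def by blast
  have "card D \<le> card T"
  proof (rule card_inj_on_le[where f = F])
    show "inj_on F D"
    proof (rule inj_onI)
      fix d d' assume dd: "d \<in> D" "d' \<in> D" "F d = F d'"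
      obtain S E1 E2 x y where d: "d = (S, E1, E2, x, y)" "S \<subseteq> V" "card S = n1" "E1 \<in> cgm S m1"
        "E2 \<in> cgm (V - S) m2" "x \<in> S" "y \<in> V - S" using dd(1) unfolding D_def by auto
      obtain S' E1' E2' x' y' where d': "d' = (S', E1', E2', x', y')" "S' \<subseteq> V" "card S' = n1" "E1' \<in> cgm S' m1"
        "E2' \<in> cgm (V - S') m2" "x' \<in> S'" "y' \<in> V - S'" using dd(2) unfolding D_def by auto
      have xy: "x' = x" "y' = y" and eq: "insert {x, y} (E1 \<union> E2) = insert {x, y} (E1' \<union> E2')"
        using dd(3) d(1) d'(1) unfolding F_def by auto
      have no: "{x, y} \<notin> E1 \<union> E2" using edges[OF d(4), of "{x, y}"] edges[OF d(5), of "{x, y}"] d(6,7) by auto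
      have no': "{x, y} \<notin> E1' \<union> E2'" using edges[OF d'(4), of "{x, y}"] edges[OF d'(5), of "{x, y}"] d'(6,7) xy by auto
      have eq2: "E1 \<union> E2 = E1' \<union> E2'" using eq insert_ident[OF no no'] by (simp only:)
      \<comment> \<open>Otherwise the connected graph on \<open>S\<close> has an edge leaving
        \<open>S'\<close>, and neither part of the second decomposition contains such an
        edge.\<close>
      have SS: "S = S'"
      proof (rule ccontr)
        assume ne: "S \<noteq> S'"
        have "\<not> S \<subseteq> S'" using ne card_subset_eq[OF finS[OF d'(2)]] d(3) d'(3) by metis
        then obtain z where z: "z \<in> S" "z \<notin> S'" by blast
        have "conn S E1" using d(4) unfolding cgm_def by blast
        then obtain u v where uv: "{u, v} \<in> E1" "u \<in> S'" "v \<notin> S'"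
          using conn_crossing[of S E1 x z S'] d(6) d'(6) xy z by metis
        then have "{u, v} \<in> E1' \<union> E2'" using eq2 by blast
        then show False using edges[OF d'(4), of "{u, v}"] edges[OF d'(5), of "{u, v}"] uv(2,3) by auto
      qed
      have part: "A = {e \<in> A \<union> B. e \<subseteq> S}" "B = {e \<in> A \<union> B. e \<subseteq> V - S}"
        if "A \<in> cgm S m1" "B \<in> cgm (V - S) m2" for A B S
      proof -
        have "e \<noteq> {}" if "e \<in> A \<union> B" for e using edges[OF \<open>A \<in> _\<close>, of e] edges[OF \<open>B \<in> _\<close>, of e] that by auto
        then show "A = {e \<in> A \<union> B. e \<subseteq> S}" "B = {e \<in> A \<union> B. e \<subseteq> V - S}"
          using edges[OF \<open>A \<in> _\<close>] edges[OF \<open>B \<in> _\<close>] by blast+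
      qed
      have E1: "E1 = E1'" using part(1)[OF d(4,5)] part(1)[OF d'(4,5)] eq2 SS by simp
      have "E2 = E2'" using part(2)[OF d(4,5)] part(2)[OF d'(4,5)] eq2 SS by simp
      then show "d = d'" using d(1) d'(1) SS E1 xy by simp
    qed
    show "F ` D \<subseteq> T"
    proof
      fix t assume "t \<in> F ` D"
      then obtain S E1 E2 x y where d: "t = F (S, E1, E2, x, y)" "S \<subseteq> V" "card S = n1" "E1 \<in> cgm S m1"
        "E2 \<in> cgm (V - S) m2" "x \<in> S" "y \<in> V - S" unfolding D_def by auto
      have s1: "simple_graph S E1" "planar S E1" "card E1 = m1" "conn S E1" using d(4) unfolding cgm_def pgm_def by auto
      have s2: "simple_graph (V - S) E2" "planar (V - S) E2" "card E2 = m2" "conn (V - S) E2"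
        using d(5) unfolding cgm_def pgm_def by auto
      have fin: "finite S" "finite (V - S)" using finS d(2) by auto
      have SV: "S \<union> (V - S) = V" using d(2) by blast
      note b = planar_bridge[OF s1(1) fin(1) s1(2) s2(1) fin(2) s2(2) _ d(6,7), unfolded SV]
      have c: "conn V (insert {x, y} (E1 \<union> E2))" using conn_bridge[OF s1(4) s2(4) d(6,7)] SV by simp
      have dj: "E1 \<inter> E2 = {}"
      proof -
        have False if "e \<in> E1" "e \<in> E2" for e
          using edges[OF d(4) that(1)] edges[OF d(5) that(2)] by (auto simp: card_2_iff)
        then show ?thesis by blast
      qed
      have no: "{x, y} \<notin> E1 \<union> E2" using edges[OF d(4), of "{x, y}"] edges[OF d(5), of "{x, y}"] d(6,7) by auto
      have "card (insert {x, y} (E1 \<union> E2)) = m1 + m2 + 1"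
        using no dj s1(3) s2(3) finite_edges[OF s1(1) fin(1)] finite_edges[OF s2(1) fin(2)] by (simp add: card_Un_disjoint)
      then have "insert {x, y} (E1 \<union> E2) \<in> cgm V (m1 + m2 + 1)" unfolding cgm_def pgm_def using b c by blast
      then show "t \<in> T" unfolding T_def d(1) F_def by simp
    qed
    have "finite {(x, y). {x, y} \<in> E}" if "E \<in> cgm V m" for E m
    proof -
      have "simple_graph V E" using that unfolding cgm_def pgm_def by blast
      then have "{(x, y). {x, y} \<in> E} \<subseteq> V \<times> V" by (auto dest: simple_graph_edgeD)
      then show ?thesis using fV finite_subset by blast
    qed
    then show "finite T" unfolding T_def using finite_cgm[OF fV(1)] by blast
  qed
  moreover have "card T = card (cgm V (m1 + m2 + 1)) * (2 * (m1 + m2 + 1))"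
  proof -
    have c: "card {(x, y). {x, y} \<in> E} = 2 * (m1 + m2 + 1)" if "E \<in> cgm V (m1 + m2 + 1)" for E
      using card_ordered_edges[of V E] that fV unfolding cgm_def pgm_def by auto
    have "card T = (\<Sum>E\<in>cgm V (m1 + m2 + 1). card {(x, y). {x, y} \<in> E})"
      unfolding T_def using finite_cgm[OF fV(1)] c by (intro card_SigmaI) (auto intro: card_ge_0_finite)
    then show ?thesis using c by simp
  qed
  moreover have "card D = (n1 + n2 choose n1) * (card (cgm {1..n1} m1) * (card (cgm {1..n2} m2) * (n1 * n2)))"
  proof -
    have "card D = (\<Sum>S\<in>{S. S \<subseteq> V \<and> card S = n1}. card (cgm S m1 \<times> (cgm (V - S) m2 \<times> (S \<times> (V - S)))))"
      unfolding D_def using fV finS finite_cgm by (intro card_SigmaI) (auto intro!: finite_cartesian_product)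
    also have "\<dots> = (\<Sum>S\<in>{S. S \<subseteq> V \<and> card S = n1}. card (cgm {1..n1} m1) * (card (cgm {1..n2} m2) * (n1 * n2)))"
    proof (rule sum.cong)
      fix S assume "S \<in> {S. S \<subseteq> V \<and> card S = n1}"
      then have S: "S \<subseteq> V" "card S = n1" "finite S" using finS by auto
      have VS: "card (V - S) = n2" "finite (V - S)" using S fV by (auto simp: card_Diff_subset)
      show "card (cgm S m1 \<times> (cgm (V - S) m2 \<times> (S \<times> (V - S)))) = card (cgm {1..n1} m1) * (card (cgm {1..n2} m2) * (n1 * n2))"
        using card_cgm[OF S(3), of m1] card_cgm[OF VS(2), of m2] S(2) VS(1) by (simp add: card_cartesian_product)
    qed simp
    also have "\<dots> = card {S. S \<subseteq> V \<and> card S = n1} * (card (cgm {1..n1} m1) * (card (cgm {1..n2} m2) * (n1 * n2)))" by simp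
    finally show ?thesis using n_subsets[OF fV(1), of n1] fV(2) by simp
  qed
  ultimately show ?thesis unfolding V_def by simp
qed

text \<open>The shift by one accounts for the edge that joins two connected graphs.\<close>

definition conn_density :: "nat \<Rightarrow> nat \<Rightarrow> real" where
  "conn_density n M = real (card (cgm {1..n} (M - 1))) / fact n"

lemma cgm_edge_bound:
  assumes "E \<in> cgm V m" "finite V"
  shows "m \<le> 31 * card V"
  using planar_edge_bound[of V E] assms unfolding cgm_def pgm_def by auto

text \<open>The marking factors cancel: with at most 31 edges per vertex there are at most
  \<open>62 (n1 + n2)\<close> markings of the joined graph, and this is at most \<open>n1 n2\<close>
  as soon as both sizes are at least 124.\<close>

lemma conn_density_superadditive:
  assumes n: "n1 \<ge> 124" "n2 \<ge> 124" and M: "M1 \<ge> 1" "M2 \<ge> 1"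
  shows "conn_density n1 M1 * conn_density n2 M2 \<le> conn_density (n1 + n2) (M1 + M2)"
proof -
  define a where "a = card (cgm {1..n1} (M1 - 1))"
  define b where "b = card (cgm {1..n2} (M2 - 1))"
  define c where "c = card (cgm {1..n1 + n2} (M1 + M2 - 1))"
  have Meq: "M1 - 1 + (M2 - 1) + 1 = M1 + M2 - 1" using M by simp
  have main: "(n1 + n2 choose n1) * (a * (b * (n1 * n2))) \<le> c * (2 * (M1 + M2 - 1))"
    using superadditive[of n1 n2 "M1 - 1" "M2 - 1"] unfolding Meq a_def b_def c_def .
  have "(n1 + n2 choose n1) * (a * b) \<le> c"
  proof (cases "c = 0")
    case True
    then have "a * b = 0" using main n by auto
    then show ?thesis by auto
  next
    case False
    then obtain E where "E \<in> cgm {1..n1 + n2} (M1 + M2 - 1)" unfolding c_def by (metis card.empty equals0I)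
    then have "M1 + M2 - 1 \<le> 31 * (n1 + n2)" using cgm_edge_bound by fastforce
    then have "c * (2 * (M1 + M2 - 1)) \<le> c * (62 * (n1 + n2))" by (intro mult_le_mono2) simp
    moreover have "62 * (n1 + n2) \<le> n1 * n2"
    proof -
      define t where "t = n1 * n2"
      have "124 * n2 \<le> t" "124 * n1 \<le> t" using n unfolding t_def by (auto simp: mult.commute)
      then have "62 * (n1 + n2) \<le> t" by simp
      then show ?thesis unfolding t_def .
    qed
    ultimately have "(n1 + n2 choose n1) * (a * (b * (n1 * n2))) \<le> c * (n1 * n2)"
      using main by (meson mult_le_mono2 order_trans)
    then have "((n1 + n2 choose n1) * (a * b)) * (n1 * n2) \<le> c * (n1 * n2)" by (simp only: mult.assoc)
    then show ?thesis using n by simp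
  qed
  then have "real ((n1 + n2 choose n1) * (a * b)) \<le> real c" by (simp only: of_nat_le_iff)
  moreover have "real (n1 + n2 choose n1) = fact (n1 + n2) / (fact n1 * fact n2)"
    using binomial_fact[of n1 "n1 + n2", where 'a = real] by simp
  ultimately have "fact (n1 + n2) / (fact n1 * fact n2) * (real a * real b) \<le> real c" by simp
  then have "(real a / fact n1) * (real b / fact n2) \<le> real c / fact (n1 + n2)"
    by (simp add: field_simps)
  then show ?thesis unfolding conn_density_def a_def b_def c_def .
qed

lemma conn_density_nonneg: "conn_density n M \<ge> 0"
  unfolding conn_density_def by simp

section \<open>Lower bounds on the number of connected planar graphs\<close>

lemma card_double_fan:
  assumes "b \<ge> 3"
  shows "card (double_fan b) = 3 * b - 6"
proof -
  define A B C where "A = (\<lambda>j. {0, j}) ` {1..<b}" and "B = (\<lambda>j. {1, j}) ` {2..<b}" and "C = (\<lambda>j. {j, Suc j}) ` {2..<b - 1}"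
  have eq: "double_fan b = A \<union> B \<union> C" unfolding double_fan_def A_def B_def C_def
    by (auto simp: less_diff_conv image_iff)
  have cA: "card A = b - 1" unfolding A_def by (subst card_image) (auto simp: inj_on_def doubleton_eq_iff)
  have cB: "card B = b - 2" unfolding B_def by (subst card_image) (auto simp: inj_on_def doubleton_eq_iff)
  have cC: "card C = b - 3" unfolding C_def using assms by (subst card_image) (auto simp: inj_on_def doubleton_eq_iff)
  have fin: "finite A" "finite B" "finite C" unfolding A_def B_def C_def by auto
  have "0 \<in> e" if "e \<in> A" for e using that unfolding A_def by blast
  moreover have "1 \<in> e \<and> 0 \<notin> e" if "e \<in> B" for e using that unfolding B_def by auto
  moreover have "1 \<notin> e \<and> 0 \<notin> e" if "e \<in> C" for e using that unfolding C_def by auto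
  ultimately have "A \<inter> B = {}" "(A \<union> B) \<inter> C = {}" by fastforce+
  then show ?thesis unfolding eq using fin cA cB cC assms by (simp add: card_Un_disjoint)
qed

text \<open>The star at 0 inside the double fan is a spanning tree with \<open>b - 1\<close> edges,
  to which arbitrary further edges of the double fan can be added.\<close>

lemma cgm_nonempty:
  assumes b: "b \<ge> 3" and m: "b - 1 \<le> m" "m \<le> 3 * b - 6"
  shows "card (cgm {1..b} m) > 0"
proof -
  define A where "A = (\<lambda>j. {0::nat, j}) ` {1..<b}"
  have AD: "A \<subseteq> double_fan b" unfolding A_def double_fan_def by auto
  have fD: "finite (double_fan b)" using finite_edges[OF simple_double_fan] by simp
  have cA: "card A = b - 1" unfolding A_def by (subst card_image) (auto simp: inj_on_def doubleton_eq_iff)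
  have "m - (b - 1) \<le> card (double_fan b - A)"
    using card_Diff_subset[OF finite_subset[OF AD fD] AD] card_double_fan[OF b] cA m b by linarith
  then obtain B where B: "B \<subseteq> double_fan b - A" "card B = m - (b - 1)" by (metis obtain_subset_with_card_n)
  define E where "E = A \<union> B"
  have ED: "E \<subseteq> double_fan b" using AD B unfolding E_def by blast
  have "card E = m" unfolding E_def using B cA m fD AD finite_subset
    by (subst card_Un_disjoint) (auto intro: finite_subset)
  moreover have sg: "simple_graph {..<b} E" using simple_double_fan[of b] ED unfolding simple_graph_def by blast
  moreover have "planar {..<b} E" using planar_subgraph[OF simple_double_fan planar_double_fan sg] ED by blast
  moreover have "conn {..<b} E"
  proof -
    have *: "j \<in> cls E 0" if "j < b" for j
    proof (cases "j = 0")
      case False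
      then have "{0, j} \<in> E" using that unfolding E_def A_def by auto
      then show ?thesis using cls_step[OF cls_refl] by metis
    qed (simp add: cls_refl)
    show ?thesis unfolding conn_def
    proof (intro ballI)
      fix u v assume "u \<in> {..<b}" "v \<in> {..<b}"
      then show "v \<in> cls E u" using *[of u] *[of v] cls_eq[of u E 0] by simp
    qed
  qed
  ultimately have "E \<in> cgm {..<b} m" unfolding cgm_def pgm_def by blast
  then have "card (cgm {..<b} m) > 0" using finite_cgm[of "{..<b}" m] by (auto simp: card_gt_0_iff)
  then show ?thesis using card_cgm[of "{..<b}" m] by simp
qed

text \<open>Blocks of \<open>b\<close> vertices are split off as trees or as triangulations, that
  is, with shifted edge count \<open>b\<close> or \<open>3 b - 5\<close>. Mixing both kinds reaches
  all slopes \<open>M / n\<close> between 1 and \<open>(3 b - 5) / b\<close>. Each block, including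
  a last one with fewer than \<open>2 b\<close> vertices, has density at least
  \<open>1 / fact (2 b)\<close>.\<close>

lemma conn_density_lower_bound:
  assumes b: "b \<ge> 124" and n: "n \<ge> b" "n \<le> M" "b * M \<le> (3 * b - 5) * n"
  shows "conn_density n M \<ge> (1 / fact (2 * b)) ^ n"
  using n
proof (induction n arbitrary: M rule: less_induct)
  case (less n)
  define k :: real where "k = 1 / fact (2 * b)"
  have k: "0 < k" "k \<le> 1" unfolding k_def by (auto simp: fact_ge_1)
  have base: "conn_density j M \<ge> k" if "j \<ge> 3" "j \<le> 2 * b" "j \<le> M" "M \<le> 3 * j - 5" for j M
  proof -
    have "card (cgm {1..j} (M - 1)) > 0" using that by (intro cgm_nonempty) auto
    then have "real (card (cgm {1..j} (M - 1))) \<ge> 1" by (simp add: Suc_leI)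
    then have "conn_density j M \<ge> 1 / fact j" unfolding conn_density_def by (simp add: divide_right_mono)
    moreover have "1 / fact j \<ge> k" unfolding k_def using fact_mono[OF that(2), where 'a = real] by (simp add: frac_le)
    ultimately show ?thesis by linarith
  qed
  show ?case
  proof (cases "n < 2 * b")
    case True
    have "b * M + 5 * b \<le> b * (3 * n)"
    proof -
      have "b * M \<le> 3 * b * n - 5 * n" using less.prems(3) by (simp add: diff_mult_distrib)
      moreover have "5 * n \<le> 3 * b * n" using b by simp
      moreover have "5 * b \<le> 5 * n" using less.prems(1) by simp
      ultimately have "b * M + 5 * b \<le> 3 * b * n" by linarith
      then show ?thesis by (simp only: mult.assoc mult.left_commute)
    qed
    then have "b * (M + 5) \<le> b * (3 * n)" by (simp add: algebra_simps)
    then have "M + 5 \<le> 3 * n" using b by simp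
    then have "conn_density n M \<ge> k" using base[of n M] True less.prems b by simp
    moreover have "k ^ n \<le> k ^ 1" using k less.prems b by (intro power_decreasing) auto
    ultimately show ?thesis unfolding k_def by simp
  next
    case False
    \<comment> \<open>A sparse block as long as the rest stays below the upper slope, otherwise a
      dense one. In the dense case the rest keeps enough edges precisely because the sparse choice
      left it too steep.\<close>
    define M1 where "M1 = (if b * (M - b) \<le> (3 * b - 5) * (n - b) then b else 3 * b - 5)"
    have M1: "b \<le> M1" "M1 \<le> 3 * b - 5" using b unfolding M1_def by auto
    have rest: "n - b \<le> M - M1" "b * (M - M1) \<le> (3 * b - 5) * (n - b)" "M1 \<le> M"
    proof -
      define X where "X = 3 * b - 5"
      have X: "b \<le> X" using b unfolding X_def by simp
      have n2: "2 * b \<le> n" using False by simp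
      have "(n - b \<le> M - M1 \<and> M1 \<le> M) \<and> b * (M - M1) \<le> X * (n - b)"
      proof (cases "b * (M - b) \<le> X * (n - b)")
        case True
        then show ?thesis using less.prems unfolding M1_def X_def by auto
      next
        case False
        then have M1X: "M1 = X" unfolding M1_def X_def by simp
        have "X * b \<le> X * (n - b)" using n2 by (intro mult_le_mono2) simp
        then have "b * X < b * (M - b)" using False mult.commute[of X b] by linarith
        then have XM: "X + b < M" by (simp add: less_diff_conv)
        have "int X * (int n - int b) < int b * (int M - int b)"
          using False n2 less.prems by (simp add: of_nat_diff[symmetric] of_nat_mult[symmetric] del: of_nat_diff of_nat_mult)
        moreover have "0 \<le> (int X - int b) * (int n - 2 * int b)" using X n2 by (intro mult_nonneg_nonneg) auto
        ultimately have "int b * (int n - int b) \<le> int b * (int M - int X)" by (simp add: algebra_simps)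
        then have "int n - int b \<le> int M - int X" using b by simp
        then have "n - b \<le> M - X" using XM n2 by linarith
        moreover have "b * (M - X) \<le> X * (n - b)"
          using less.prems(3) unfolding X_def[symmetric] by (simp add: diff_mult_distrib2 mult.commute)
        ultimately show ?thesis using M1X XM by simp
      qed
      then show "n - b \<le> M - M1" "b * (M - M1) \<le> (3 * b - 5) * (n - b)" "M1 \<le> M" unfolding X_def by auto
    qed
    have "conn_density b M1 \<ge> k" using base[of b M1] M1 b by simp
    moreover have "k ^ b \<le> k ^ 1" using k b by (intro power_decreasing) auto
    ultimately have 1: "conn_density b M1 \<ge> k ^ b" by simp
    have 2: "conn_density (n - b) (M - M1) \<ge> k ^ (n - b)"
      unfolding k_def using less.IH[of "n - b" "M - M1"] rest b False by simp
    have "k ^ n = k ^ b * k ^ (n - b)" using False by (simp add: power_add[symmetric])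
    also have "\<dots> \<le> conn_density b M1 * conn_density (n - b) (M - M1)" using 1 2 k conn_density_nonneg by (intro mult_mono) auto
    also have "\<dots> \<le> conn_density (b + (n - b)) (M1 + (M - M1))"
      using b False rest M1 by (intro conn_density_superadditive) auto
    also have "\<dots> = conn_density n M" using False rest by simp
    finally show ?thesis unfolding k_def .
  qed
qed

section \<open>Linking the components of a planar graph\<close>

definition pgm_comps :: "'a set \<Rightarrow> nat \<Rightarrow> nat \<Rightarrow> 'a set set set" where
  "pgm_comps V m q = {E \<in> pgm V m. card (comps V E) = q}"

lemma cls_insert:
  assumes "y \<notin> cls E x"
  shows "cls (insert {x, y} E) v = (if v \<in> cls E x \<union> cls E y then cls E x \<union> cls E y else cls E v)"
proof -
  let ?E = "insert {x, y} E"
  have sub: "cls E v \<subseteq> cls ?E v" for v by (rule cls_mono) blast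
  have y: "y \<in> cls ?E x" by (rule cls_step[OF cls_refl]) simp
  have U: "cls ?E w = cls E x \<union> cls E y" if w: "w \<in> cls E x \<union> cls E y" for w
  proof
    have "w \<in> cls ?E x" using w sub[of x] sub[of y] cls_eq[OF y] by blast
    then have e: "cls ?E w = cls ?E x" by (rule cls_eq)
    show "cls E x \<union> cls E y \<subseteq> cls ?E w" unfolding e using sub[of x] sub[of y] cls_eq[OF y] by blast
    show "cls ?E w \<subseteq> cls E x \<union> cls E y"
    proof (rule cls_closed[OF w])
      fix a b assume ab: "{a, b} \<in> ?E" "a \<in> cls E x \<union> cls E y"
      from ab(1) consider "{a, b} = {x, y}" | "{a, b} \<in> E" by blast
      then show "b \<in> cls E x \<union> cls E y"
      proof cases
        case 1
        then have "b = x \<or> b = y" by (auto simp: doubleton_eq_iff)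
        then show ?thesis using cls_refl[of x E] cls_refl[of y E] by blast
      next
        case 2
        then show ?thesis using ab(2) cls_step by (metis UnE UnI1 UnI2)
      qed
    qed
  qed
  show ?thesis
  proof (cases "v \<in> cls E x \<union> cls E y")
    case True
    then show ?thesis using U by simp
  next
    case False
    have "cls ?E v \<subseteq> cls E v"
    proof (rule cls_closed[OF cls_refl])
      fix a b assume ab: "{a, b} \<in> ?E" "a \<in> cls E v"
      have "{a, b} \<noteq> {x, y}"
      proof
        assume "{a, b} = {x, y}"
        then have "a = x \<or> a = y" by (auto simp: doubleton_eq_iff)
        then show False using ab(2) False cls_sym[of a E v] by auto
      qed
      then have "{a, b} \<in> E" using ab(1) by simp
      then show "b \<in> cls E v" by (rule cls_step[OF ab(2)])
    qed
    then show ?thesis using sub[of v] False by auto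
  qed
qed

lemma card_comps_insert:
  assumes fin: "finite V" and xy: "x \<in> V" "y \<in> V" "y \<notin> cls E x"
  shows "card (comps V E) = card (comps V (insert {x, y} E)) + 1"
proof -
  let ?E = "insert {x, y} E"
  define U where "U = cls E x \<union> cls E y"
  have ne: "cls E x \<noteq> cls E y" using xy(3) cls_refl[of y E] by auto
  have eq: "comps V ?E = insert U (comps V E - {cls E x, cls E y})"
  proof (intro set_eqI iffI)
    fix C assume "C \<in> comps V ?E"
    then obtain v where v: "v \<in> V" "C = cls ?E v" unfolding comps_def by blast
    show "C \<in> insert U (comps V E - {cls E x, cls E y})"
    proof (cases "v \<in> U")
      case True
      then show ?thesis using v cls_insert[OF xy(3)] unfolding U_def by simp
    next
      case False
      then have "C = cls E v" "cls E v \<noteq> cls E x" "cls E v \<noteq> cls E y"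
        using v cls_insert[OF xy(3)] cls_refl[of v E] unfolding U_def by auto
      then show ?thesis using v unfolding comps_def by blast
    qed
  next
    fix C assume C: "C \<in> insert U (comps V E - {cls E x, cls E y})"
    show "C \<in> comps V ?E"
    proof (cases "C = U")
      case True
      then have "C = cls ?E x" using cls_insert[OF xy(3), of x] cls_refl[of x E] unfolding U_def by simp
      then show ?thesis using xy unfolding comps_def by blast
    next
      case False
      then obtain v where v: "v \<in> V" "C = cls E v" "C \<noteq> cls E x" "C \<noteq> cls E y"
        using C unfolding comps_def by blast
      then have "v \<notin> cls E x \<union> cls E y" using cls_eq by (metis UnE)
      then have "C = cls ?E v" using v cls_insert[OF xy(3)] by simp
      then show ?thesis using v unfolding comps_def by blast
    qed
  qed
  have "U \<notin> comps V E"
  proof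
    assume "U \<in> comps V E"
    then obtain v where "U = cls E v" unfolding comps_def by blast
    then have "x \<in> cls E v" "y \<in> cls E v" unfolding U_def using cls_refl[of x E] cls_refl[of y E] by auto
    then show False using ne cls_eq[of x E v] cls_eq[of y E v] by simp
  qed
  moreover have f: "finite (comps V E)" unfolding comps_def using fin by simp
  moreover have two: "{cls E x, cls E y} \<subseteq> comps V E" using xy unfolding comps_def by blast
  moreover have "card {cls E x, cls E y} = 2" using ne by simp
  moreover have "card (comps V E) \<ge> 2" using card_mono[OF f two] \<open>card {cls E x, cls E y} = 2\<close> by simp
  ultimately show ?thesis unfolding eq by (simp add: card_Diff_subset)
qed

text \<open>The component of \<open>x\<close> and the rest are planar graphs without edges between
  them, so the new edge is a bridge.\<close>

lemma planar_insert_between_comps: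
  assumes sg: "simple_graph V E" and fin: "finite V" and pl: "planar V E" and xy: "x \<in> V" "y \<in> V" "y \<notin> cls E x"
  shows "simple_graph V (insert {x, y} E)" "planar V (insert {x, y} E)"
proof -
  define C where "C = cls E x"
  have CV: "C \<subseteq> V" unfolding C_def using cls_subset[OF sg xy(1)] .
  define E1 where "E1 = {e \<in> E. e \<subseteq> C}"
  define E2 where "E2 = {e \<in> E. e \<subseteq> V - C}"
  have s1: "simple_graph C E1" and s2: "simple_graph (V - C) E2"
    using sg unfolding E1_def E2_def simple_graph_def by auto
  have p1: "planar C E1" using planar_subgraph[OF sg pl s1 CV] unfolding E1_def by blast
  have p2: "planar (V - C) E2" using planar_subgraph[OF sg pl s2] unfolding E2_def by blast
  have fc: "finite C" "finite (V - C)" using CV fin finite_subset by auto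
  have x: "x \<in> C" "y \<in> V - C" using xy cls_refl unfolding C_def by auto
  have "E = E1 \<union> E2"
  proof -
    have "e \<in> E1 \<union> E2" if e: "e \<in> E" for e
    proof -
      obtain u w where uw: "e = {u, w}" "u \<in> V" "w \<in> V" using simple_graph_edgeE[OF sg e] by metis
      then have wu: "{w, u} \<in> E" "{u, w} \<in> E" using e by (auto simp: insert_commute)
      have "u \<in> C \<longleftrightarrow> w \<in> C" unfolding C_def using cls_step[OF _ wu(1)] cls_step[OF _ wu(2)] by blast
      then show ?thesis using uw e unfolding E1_def E2_def by auto
    qed
    then show ?thesis unfolding E1_def E2_def by blast
  qed
  moreover have "C \<union> (V - C) = V" using CV by blast
  ultimately show "simple_graph V (insert {x, y} E)" "planar V (insert {x, y} E)"
    using planar_bridge[OF s1 fc(1) p1 s2 fc(2) p2 _ x] by auto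
qed

text \<open>Two components are always linked through their least vertices, so a pair of components
  gives one edge. The linked graph with this edge marked determines the old graph and the pair, and
  \<open>Suc m\<close> edges can be marked.\<close>

lemma card_link_comps:
  fixes V :: "nat set"
  assumes fin: "finite V"
  shows "card (pgm_comps V m (Suc q)) * (Suc q choose 2) \<le> card (pgm_comps V (Suc m) q) * Suc m"
proof -
  define D where "D = (SIGMA E:pgm_comps V m (Suc q). {P. P \<subseteq> comps V E \<and> card P = 2})"
  define T where "T = (SIGMA E:pgm_comps V (Suc m) q. E)"
  define F where "F = (\<lambda>(E, P). (insert (Min ` P) E, Min ` (P :: nat set set)))"
  have fg: "finite (pgm_comps V m q)" for m q unfolding pgm_comps_def using finite_pgm[OF fin] by simp
  have E: "simple_graph V E" "planar V E" "card E = m" "card (comps V E) = q" "finite E" if "E \<in> pgm_comps V m q" for E m q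
    using that finite_edges[OF _ fin] unfolding pgm_comps_def pgm_def by auto
  have fcomps: "finite (comps V E)" for E unfolding comps_def using fin by simp
  have CMin: "Min C \<in> C \<and> C = cls E (Min C) \<and> Min C \<in> V" if sg: "simple_graph V E" and C: "C \<in> comps V E" for E C
  proof -
    obtain v where v: "v \<in> V" "C = cls E v" using C unfolding comps_def by blast
    have "C \<subseteq> V" using cls_subset[OF sg v(1)] v(2) by simp
    moreover from this have "Min C \<in> C" using v cls_refl[of v E] fin finite_subset by (intro Min_in) auto
    ultimately show ?thesis using cls_eq[of "Min C" E v] v by auto
  qed
  have pair: "\<exists>C1 C2. P = {C1, C2} \<and> Min ` P = {Min C1, Min C2} \<and> Min C1 \<in> V \<and> Min C2 \<in> V \<and> C1 = cls E (Min C1) \<and> C2 = cls E (Min C2)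
      \<and> Min C2 \<notin> cls E (Min C1)" if sg: "simple_graph V E" and P: "P \<subseteq> comps V E" "card P = 2" for E P
  proof -
    obtain C1 C2 where C: "P = {C1, C2}" "C1 \<noteq> C2" using P(2) by (meson card_2_iff)
    have 1: "Min C1 \<in> V" "C1 = cls E (Min C1)" and 2: "Min C2 \<in> V" "C2 = cls E (Min C2)"
      using CMin[OF sg, of C1] CMin[OF sg, of C2] C P(1) by auto
    have "Min C2 \<notin> cls E (Min C1)" using 1 2 C(2) cls_eq by metis
    then show ?thesis using C 1 2 by auto
  qed
  have "card D \<le> card T"
  proof (rule card_inj_on_le[where f = F])
    have new: "Min ` P \<notin> E" if sg: "simple_graph V E" and P: "P \<subseteq> comps V E" "card P = 2" for E P
    proof -
      obtain C1 C2 where C: "Min ` P = {Min C1, Min C2}" "Min C2 \<notin> cls E (Min C1)" using pair[OF sg P] by blast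
      then show ?thesis using cls_step[OF cls_refl, of "Min C1" "Min C2" E] by auto
    qed
    show "inj_on F D"
    proof (rule inj_onI)
      fix d d' assume dd: "d \<in> D" "d' \<in> D" "F d = F d'"
      obtain E0 P where d: "d = (E0, P)" "E0 \<in> pgm_comps V m (Suc q)" "P \<subseteq> comps V E0" "card P = 2" using dd(1) unfolding D_def by auto
      obtain E1 P' where d': "d' = (E1, P')" "E1 \<in> pgm_comps V m (Suc q)" "P' \<subseteq> comps V E1" "card P' = 2" using dd(2) unfolding D_def by auto
      have eq0: "insert (Min ` P) E0 = insert (Min ` P') E1 \<and> Min ` P = Min ` P'"
        using dd(3) unfolding d(1) d'(1) F_def prod.case prod.inject .
      have eq: "insert (Min ` P) E0 = insert (Min ` P) E1" "Min ` P = Min ` P'"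
        using conjunct1[OF eq0] conjunct2[OF eq0] by (simp_all only:)
      have n: "Min ` P \<notin> E0" "Min ` P \<notin> E1"
        using new[OF E(1)[OF d(2)] d(3,4)] new[OF E(1)[OF d'(2)] d'(3,4)] eq(2) by auto
      have EE: "E0 = E1" by (rule iffD1[OF insert_ident[OF n] eq(1)])
      have inj: "inj_on Min (comps V E0)"
        by (rule inj_onI) (use CMin[OF E(1)[OF d(2)]] in metis)
      have P': "P' \<subseteq> comps V E0" using d'(3) EE by simp
      have "P = P'" by (rule iffD1[OF inj_on_image_eq_iff[OF inj d(3) P'] eq(2)])
      then show "d = d'" using d d' EE by simp
    qed
    show "F ` D \<subseteq> T"
    proof
      fix t assume "t \<in> F ` D"
      then obtain E0 P where d: "t = F (E0, P)" "E0 \<in> pgm_comps V m (Suc q)" "P \<subseteq> comps V E0" "card P = 2" unfolding D_def by auto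
      note e = E[OF d(2)]
      obtain C1 C2 where C: "Min ` P = {Min C1, Min C2}" "Min C1 \<in> V" "Min C2 \<in> V" "Min C2 \<notin> cls E0 (Min C1)"
        using pair[OF e(1) d(3,4)] by blast
      have "card (insert (Min ` P) E0) = Suc m" using new[OF e(1) d(3,4)] e by simp
      moreover have "simple_graph V (insert (Min ` P) E0)" "planar V (insert (Min ` P) E0)"
        using planar_insert_between_comps[OF e(1) fin e(2) C(2-4)] C(1) by auto
      moreover have "card (comps V (insert (Min ` P) E0)) = q"
        using card_comps_insert[OF fin C(2-4)] C(1) e(4) by simp
      ultimately have "insert (Min ` P) E0 \<in> pgm_comps V (Suc m) q" unfolding pgm_comps_def pgm_def by blast
      then show "t \<in> T" unfolding T_def d(1) F_def by simp
    qed
    show "finite T" unfolding T_def using fg E(5) by blast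
  qed
  moreover have "card D = card (pgm_comps V m (Suc q)) * (Suc q choose 2)"
  proof -
    have "card D = (\<Sum>E\<in>pgm_comps V m (Suc q). card {P. P \<subseteq> comps V E \<and> card P = 2})"
      unfolding D_def using fg fcomps by (intro card_SigmaI) auto
    also have "\<dots> = (\<Sum>E\<in>pgm_comps V m (Suc q). (Suc q choose 2))"
      using n_subsets[OF fcomps] E(4) by (intro sum.cong) auto
    finally show ?thesis by simp
  qed
  moreover have "card T = card (pgm_comps V (Suc m) q) * Suc m"
  proof -
    have "card T = (\<Sum>E\<in>pgm_comps V (Suc m) q. card E)"
      unfolding T_def using fg E(5) by (intro card_SigmaI) auto
    also have "\<dots> = (\<Sum>E\<in>pgm_comps V (Suc m) q. Suc m)" using E(3) by (intro sum.cong) auto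
    finally show ?thesis by simp
  qed
  ultimately show ?thesis by simp
qed

text \<open>The numbers of pairs met while linking down to one component multiply to at least
  \<open>(q!)^2 / 2 ^ q\<close>. This squared factorial against \<open>(2 (m + q)) ^ q\<close> is
  what makes the cost of connecting subexponential.\<close>

lemma card_link_all:
  fixes V :: "nat set"
  assumes fin: "finite V"
  shows "card (pgm_comps V m (Suc q)) * (fact q)\<^sup>2 \<le> card (pgm_comps V (m + q) 1) * (2 * (m + q)) ^ q"
proof (induction q arbitrary: m)
  case (Suc q)
  define a where "a = card (pgm_comps V m (Suc (Suc q)))"
  define b where "b = card (pgm_comps V (Suc m) (Suc q))"
  define c where "c = card (pgm_comps V (m + Suc q) 1)"
  define t where "t = 2 * (m + Suc q)"
  have IH: "b * (fact q)\<^sup>2 \<le> c * t ^ q" using Suc[of "Suc m"] unfolding b_def c_def t_def by simp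
  have "a * (Suc (Suc q) choose 2) \<le> b * Suc m" unfolding a_def b_def by (rule card_link_comps[OF fin])
  moreover have "2 * (Suc (Suc q) choose 2) = Suc (Suc q) * Suc q" by (simp add: choose_two)
  ultimately have "a * (Suc (Suc q) * Suc q) \<le> b * (2 * Suc m)"
    by (metis mult.left_commute mult_le_mono2)
  moreover have "a * (Suc q * Suc q) \<le> a * (Suc (Suc q) * Suc q)" by (intro mult_le_mono) auto
  moreover have "b * (2 * Suc m) \<le> b * t" unfolding t_def by simp
  ultimately have 1: "a * (Suc q * Suc q) \<le> b * t" by linarith
  have "a * (fact (Suc q))\<^sup>2 = (a * (Suc q * Suc q)) * (fact q)\<^sup>2" by (simp add: power2_eq_square algebra_simps)
  also have "\<dots> \<le> (b * t) * (fact q)\<^sup>2" using 1 by (rule mult_le_mono1)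
  also have "\<dots> = t * (b * (fact q)\<^sup>2)" by simp
  also have "\<dots> \<le> t * (c * t ^ q)" using IH by (rule mult_le_mono2)
  also have "\<dots> = c * t ^ Suc q" by simp
  finally show ?case unfolding a_def c_def t_def .
qed simp

lemma pgm_comps_one_conn:
  assumes "V \<noteq> {}" "finite V"
  shows "pgm_comps V m 1 = cgm V m"
proof -
  have "card (comps V E) = 1 \<longleftrightarrow> conn V E" for E
  proof
    assume "card (comps V E) = 1"
    then obtain C where "comps V E = {C}" by (meson card_1_singletonE)
    then have "cls E u = C" if "u \<in> V" for u using that unfolding comps_def by blast
    then show "conn V E" unfolding conn_def using cls_refl by metis
  next
    assume c: "conn V E"
    obtain v where v: "v \<in> V" using assms by blast
    have "cls E u = cls E v" if "u \<in> V" for u using c that v unfolding conn_def by (metis cls_eq)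
    then have "comps V E = {cls E v}" unfolding comps_def using v by blast
    then show "card (comps V E) = 1" by simp
  qed
  then show ?thesis unfolding pgm_comps_def cgm_def by blast
qed

section \<open>Coins\<close>

text \<open>Whole neighbourhoods are prescribed, so \<open>a\<close> has degree 3 and
  \<open>b\<close>, \<open>c\<close> have degree 2. Exchanging \<open>b\<close> and \<open>c\<close>
  gives the same coin, hence the comparison of \<open>b\<close> with \<open>c\<close> in
  \<open>attach_coin\<close>.\<close>

definition coin :: "'a set set \<Rightarrow> 'a \<Rightarrow> 'a \<Rightarrow> 'a \<Rightarrow> 'a \<Rightarrow> bool" where
  "coin E x a b c \<longleftrightarrow> nb E a = {x, b, c} \<and> nb E b = {a, c} \<and> nb E c = {a, b} \<and> distinct [x, a, b, c]"

text \<open>Vertices are counted instead of coins: a coin attached to a vertex that bore none is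
  recovered from this vertex, up to exchanging \<open>b\<close> and \<open>c\<close>, so a bound on
  this set bounds the number of ways to undo an attachment.\<close>

definition bearing :: "'a set set \<Rightarrow> 'a set" where
  "bearing E = {x. \<exists>a b c. coin E x a b c}"

definition add_coin :: "'a set set \<Rightarrow> 'a \<Rightarrow> 'a \<Rightarrow> 'a \<Rightarrow> 'a \<Rightarrow> 'a set set" where
  "add_coin E x a b c = E \<union> {{x, a}, {a, b}, {a, c}, {b, c}}"

text \<open>Degrees tell \<open>a\<close> from \<open>b\<close> and \<open>c\<close>, the triangle
  vertices are adjacent to each other, and \<open>x\<close> is the one neighbour of \<open>a\<close>
  that is adjacent to neither \<open>b\<close> nor \<open>c\<close>.\<close>

lemma coin_unique:
  assumes C: "coin E x a b c" and C': "coin E x' a' b' c'" and meet: "{a, b, c} \<inter> {a', b', c'} \<noteq> {}"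
  shows "x = x' \<and> a = a' \<and> {b, c} = {b', c'}"
proof -
  have n: "nb E a = {x, b, c}" "nb E b = {a, c}" "nb E c = {a, b}" "distinct [x, a, b, c]" using C unfolding coin_def by auto
  have n': "nb E a' = {x', b', c'}" "nb E b' = {a', c'}" "nb E c' = {a', b'}" "distinct [x', a', b', c']"
    using C' unfolding coin_def by auto
  have c3: "card (nb E a) = 3" "card (nb E b) = 2" "card (nb E c) = 2" using n by auto
  have c3': "card (nb E a') = 3" "card (nb E b') = 2" "card (nb E c') = 2" using n' by auto
  obtain z where z: "z \<in> {a, b, c}" "z \<in> {a', b', c'}" using meet by blast
  have aa: "a = a'"
  proof (cases "z = a")
    case True
    then show ?thesis using z c3 c3' by auto
  next
    case False
    then have "a \<in> nb E z" "card (nb E z) = 2" using z n c3 by auto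
    then have "a \<in> {a', b', c'}" using z n' c3' by auto
    then show ?thesis using c3 c3' by auto
  qed
  have eq: "{x, b, c} = {x', b', c'}" using n n' aa by simp
  have xx: "x = x'"
  proof (rule ccontr)
    assume ne: "x \<noteq> x'"
    then have "x \<in> {b', c'}" using eq by auto
    then obtain w where w: "w \<in> {b', c'}" "w \<noteq> x" "w \<in> nb E x" using n' by auto
    then have "w \<in> {b, c}" using eq by auto
    moreover have "x \<in> nb E w" using w nb_sym by fast
    ultimately show False using n by auto
  qed
  have "{b, c} = {b', c'}"
  proof -
    have "{b, c} = {x, b, c} - {x}" using n(4) by auto
    also have "\<dots> = {x', b', c'} - {x}" by (subst eq) (rule refl)
    also have "\<dots> = {b', c'}" using n'(4) xx by auto
    finally show ?thesis .
  qed
  then show ?thesis using xx aa by simp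
qed

context
  fixes V :: "nat set" and E :: "nat set set" and x a b c :: nat
  assumes sg: "simple_graph V E" and xV: "x \<in> V" and new: "a \<notin> V" "b \<notin> V" "c \<notin> V" and dist: "distinct [a, b, c]"
begin

lemma add_coin_ne: "x \<noteq> a" "x \<noteq> b" "x \<noteq> c" "a \<noteq> b" "a \<noteq> c" "b \<noteq> c"
  using xV new dist by auto

lemma add_coin_old: "a \<notin> nb E v" "b \<notin> nb E v" "c \<notin> nb E v" "nb E a = {}" "nb E b = {}" "nb E c = {}"
  using nb_simple[OF sg] new by blast+

lemma nb_add_coin:
  "nb (add_coin E x a b c) v = nb E v \<union> (if v = x then {a} else {}) \<union> (if v = a then {x, b, c} else {})
     \<union> (if v = b then {a, c} else {}) \<union> (if v = c then {a, b} else {})"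
  unfolding add_coin_def nb_def using add_coin_ne by (auto simp: doubleton_eq_iff)

lemma coin_add_coin: "coin (add_coin E x a b c) x a b c"
  unfolding coin_def nb_add_coin using add_coin_ne add_coin_old by auto

lemma simple_add_coin: "simple_graph (V \<union> {a, b, c}) (add_coin E x a b c)"
  using sg xV add_coin_ne unfolding simple_graph_def add_coin_def by (auto simp: card_insert_if)

lemma card_add_coin:
  assumes "finite V"
  shows "card (add_coin E x a b c) = card E + 4"
proof -
  have no: "{u, w} \<notin> E" if "w \<in> {a, b, c}" for u w
    using add_coin_old that unfolding nb_def by auto
  have d: "{x, a} \<noteq> {a, b}" "{x, a} \<noteq> {a, c}" "{x, a} \<noteq> {b, c}" "{a, b} \<noteq> {a, c}" "{a, b} \<noteq> {b, c}" "{a, c} \<noteq> {b, c}"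
    using add_coin_ne by (auto simp: doubleton_eq_iff)
  have "card {{x, a}, {a, b}, {a, c}, {b, c}} = 4" using d by simp
  moreover have "E \<inter> {{x, a}, {a, b}, {a, c}, {b, c}} = {}" using no by blast
  moreover have "finite E" using finite_edges[OF sg assms] .
  ultimately show ?thesis unfolding add_coin_def by (subst card_Un_disjoint) auto
qed

lemma planar_add_coin:
  assumes fin: "finite V" and pl: "planar V E"
  shows "planar (V \<union> {a, b, c}) (add_coin E x a b c)"
proof -
  define f where "f i = (if i = 0 then a else if i = Suc 0 then b else c)" for i :: nat
  have inj: "inj_on f {..<3}" using add_coin_ne unfolding f_def inj_on_def by (auto simp: numeral_3_eq_3 less_Suc_eq)
  have im: "f ` {..<3} = {a, b, c}" unfolding f_def by (auto simp: numeral_3_eq_3 lessThan_Suc)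
  have "{{0, Suc 0}, {0, 2}, {Suc 0, 2}} \<subseteq> double_fan 3" unfolding double_fan_def by fastforce
  then have sub: "{{a, b}, {a, c}, {b, c}} \<subseteq> (`) f ` double_fan 3"
  proof -
    have "f ` {0, Suc 0} = {a, b}" "f ` {0, 2} = {a, c}" "f ` {Suc 0, 2} = {b, c}" unfolding f_def by auto
    moreover have "f ` {0, Suc 0} \<in> (`) f ` double_fan 3" "f ` {0, 2} \<in> (`) f ` double_fan 3" "f ` {Suc 0, 2} \<in> (`) f ` double_fan 3"
      using \<open>_ \<subseteq> double_fan 3\<close> by (auto intro!: imageI simp del: image_insert)
    ultimately show ?thesis by simp
  qed
  note r = planar_relabel[OF simple_double_fan planar_double_fan inj, unfolded im]
  define T where "T = {{a, b}, {a, c}, {b, c}}"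
  have sT: "simple_graph {a, b, c} T" unfolding T_def simple_graph_def using add_coin_ne by auto
  have pT: "planar {a, b, c} T" using planar_subgraph[OF r sT] sub unfolding T_def by blast
  have "planar (V \<union> {a, b, c}) (insert {x, a} (E \<union> T))"
    using planar_bridge(2)[OF sg fin pl sT _ pT _ xV, of a] new by auto
  moreover have "insert {x, a} (E \<union> T) = add_coin E x a b c" unfolding T_def add_coin_def by auto
  ultimately show ?thesis by simp
qed

text \<open>Another coin can arise only with \<open>x\<close> as its triangle vertex of degree 3.
  Then \<open>x\<close> belonged to a component that is a triangle, which now hangs at
  \<open>a\<close>; this is the exceptional case \<open>y = a\<close>.\<close>

lemma coin_add_coin_cases:
  assumes C: "coin (add_coin E x a b c) y a' b' c'"
  shows "(y = x \<and> a' = a \<and> {b', c'} = {b, c}) \<or> y = a \<or> coin E y a' b' c'"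
proof (cases "{a', b', c'} \<inter> {a, b, c} = {}")
  case False
  then show ?thesis by (intro disjI1 coin_unique[OF C coin_add_coin])
next
  case True
  let ?E = "add_coin E x a b c"
  have n: "nb ?E a' = {y, b', c'}" "nb ?E b' = {a', c'}" "nb ?E c' = {a', b'}" "distinct [y, a', b', c']"
    using C unfolding coin_def by auto
  have ax: "a \<in> nb ?E x" unfolding nb_add_coin by simp
  have "b' \<noteq> x" "c' \<noteq> x" using ax n True by auto
  then have bc: "nb E b' = {a', c'}" "nb E c' = {a', b'}"
    using n(2,3) True unfolding nb_add_coin by (auto split: if_splits)
  show ?thesis
  proof (cases "a' = x")
    case True': True
    then have "a \<in> {y, b', c'}" using ax n by simp
    then show ?thesis using True by auto
  next
    case False
    then have "nb E a' = {y, b', c'}" using n(1) True unfolding nb_add_coin by (auto split: if_splits)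
    then show ?thesis using bc n(4) unfolding coin_def by simp
  qed
qed

lemma bearing_add_coin: "bearing (add_coin E x a b c) \<subseteq> bearing E \<union> {x, a}"
proof
  fix y assume "y \<in> bearing (add_coin E x a b c)"
  then obtain a' b' c' where C: "coin (add_coin E x a b c) y a' b' c'" unfolding bearing_def by blast
  show "y \<in> bearing E \<union> {x, a}" using coin_add_coin_cases[OF C] unfolding bearing_def by blast
qed

lemma add_coin_restrict: "{e \<in> add_coin E x a b c. e \<inter> {a, b, c} = {}} = E"
proof -
  have "e \<inter> {a, b, c} = {}" if "e \<in> E" for e using sg new that unfolding simple_graph_def by blast
  then show ?thesis unfolding add_coin_def by auto
qed

end

lemma remove_coin:
  fixes V :: "nat set"
  assumes sg: "simple_graph V E" and C: "coin E x a b c"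
  defines "E0 \<equiv> {e \<in> E. e \<inter> {a, b, c} = {}}"
  shows "simple_graph (V - {a, b, c}) E0" "E = add_coin E0 x a b c" "x \<in> V - {a, b, c}" "{a, b, c} \<subseteq> V"
proof -
  have n: "nb E a = {x, b, c}" "nb E b = {a, c}" "nb E c = {a, b}" "distinct [x, a, b, c]" using C unfolding coin_def by auto
  show "simple_graph (V - {a, b, c}) E0" using sg unfolding E0_def simple_graph_def by auto
  have e4: "{x, a} \<in> E" "{a, b} \<in> E" "{a, c} \<in> E" "{b, c} \<in> E"
  proof -
    have "x \<in> nb E a" "b \<in> nb E a" "c \<in> nb E a" "c \<in> nb E b" using n by auto
    then show "{x, a} \<in> E" "{a, b} \<in> E" "{a, c} \<in> E" "{b, c} \<in> E" unfolding nb_def by (auto simp: insert_commute)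
  qed
  show "{a, b, c} \<subseteq> V" "x \<in> V - {a, b, c}"
    using simple_graph_edgeD[OF sg e4(1)] simple_graph_edgeD[OF sg e4(4)] n(4) by auto
  show "E = add_coin E0 x a b c"
  proof (intro set_eqI iffI)
    fix e assume e: "e \<in> E"
    obtain u w where uw: "e = {u, w}" using simple_graph_edgeE[OF sg e] by metis
    have nbuw: "w \<in> nb E u" "u \<in> nb E w" using e uw unfolding nb_def by (auto simp: insert_commute)
    show "e \<in> add_coin E0 x a b c"
    proof (cases "e \<inter> {a, b, c} = {}")
      case True
      then show ?thesis using e unfolding add_coin_def E0_def by blast
    next
      case False
      have key: "{s, t} \<in> {{x, a}, {a, b}, {a, c}, {b, c}}" if "s \<in> {a, b, c}" "t \<in> nb E s" for s t
      proof -
        have "s = a \<and> t \<in> {x, b, c} \<or> s = b \<and> t \<in> {a, c} \<or> s = c \<and> t \<in> {a, b}" using that n by auto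
        then show ?thesis by (elim disjE conjE insertE emptyE) (auto simp: insert_commute)
      qed
      from False have "u \<in> {a, b, c} \<or> w \<in> {a, b, c}" using uw by auto
      then have "e \<in> {{x, a}, {a, b}, {a, c}, {b, c}}"
      proof
        assume "u \<in> {a, b, c}"
        then show ?thesis unfolding uw by (rule key[OF _ nbuw(1)])
      next
        assume "w \<in> {a, b, c}"
        then show ?thesis unfolding uw insert_commute[of u w] by (rule key[OF _ nbuw(2)])
      qed
      then show ?thesis unfolding add_coin_def by blast
    qed
  next
    fix e assume "e \<in> add_coin E0 x a b c"
    then show "e \<in> E" using e4 unfolding add_coin_def E0_def by auto
  qed
qed

lemma bearing_subset: "simple_graph V E \<Longrightarrow> bearing E \<subseteq> V"
proof
  fix x assume sg: "simple_graph V E" and "x \<in> bearing E"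
  then obtain a b c where "coin E x a b c" unfolding bearing_def by blast
  then have "x \<in> nb E a" unfolding coin_def by simp
  then show "x \<in> V" using nb_simple[OF sg] by blast
qed

section \<open>Counting graphs with few coins\<close>

definition few :: "nat set \<Rightarrow> nat \<Rightarrow> nat \<Rightarrow> nat set set set" where
  "few V m B = {E \<in> pgm V m. card (bearing E) \<le> B}"

lemma relabel_nb:
  assumes "inj_on f V" "simple_graph V E" "v \<in> V"
  shows "nb ((`) f ` E) (f v) = f ` nb E v"
proof -
  have sub: "e \<subseteq> V" if "e \<in> E" for e using assms(2) that unfolding simple_graph_def by blast
  show ?thesis
  proof (intro set_eqI iffI)
    fix y assume "y \<in> nb ((`) f ` E) (f v)"
    then obtain e where e: "e \<in> E" "{f v, y} = f ` e" unfolding nb_def by auto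
    obtain u w where uw: "e = {u, w}" "u \<in> V" "w \<in> V" using simple_graph_edgeE[OF assms(2) e(1)] by metis
    then have "y \<in> f ` e" "f v \<in> f ` e" using e by auto
    then obtain t where t: "t \<in> e" "y = f t" by blast
    have "v \<in> e" using inj_on_image_mem_iff[OF assms(1,3) sub[OF e(1)]] \<open>f v \<in> f ` e\<close> by blast
    have "{f v, f t} = f ` {v, t}" by simp
    then have "{v, t} = e" using inj_on_image_eq_iff[OF assms(1), of "{v, t}" e] e t sub[OF e(1)] assms(3) by auto
    then show "y \<in> f ` nb E v" using e t unfolding nb_def by auto
  next
    fix y assume "y \<in> f ` nb E v"
    then obtain t where t: "{v, t} \<in> E" "y = f t" unfolding nb_def by auto
    then have "f ` {v, t} \<in> (`) f ` E" by (intro imageI)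
    then show "y \<in> nb ((`) f ` E) (f v)" using t unfolding nb_def by simp
  qed
qed

lemma relabel_bearing:
  fixes V :: "nat set"
  assumes inj: "inj_on f V" and sg: "simple_graph V E"
  shows "bearing ((`) f ` E) = f ` bearing E"
proof -
  have V: "x \<in> V \<and> a \<in> V \<and> b \<in> V \<and> c \<in> V" if "coin E x a b c" for x a b c
    using remove_coin(3,4)[of V E x a b c] that sg nb_simple[OF sg] unfolding coin_def by (metis insertCI)
  have 1: "coin ((`) f ` E) (f x) (f a) (f b) (f c)" if C: "coin E x a b c" for x a b c
  proof -
    note v = V[OF C]
    have "inj_on f {x, a, b, c}" by (rule inj_on_subset[OF inj]) (use v in auto)
    then show ?thesis using C relabel_nb[OF inj sg] v unfolding coin_def by (simp add: inj_on_def)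
  qed
  have sg': "simple_graph (f ` V) ((`) f ` E)"
    using sg inj unfolding simple_graph_def by (auto simp: card_image inj_on_subset)
  have 2: "\<exists>x' a' b' c'. x = f x' \<and> coin E x' a' b' c'" if C: "coin ((`) f ` E) x a b c" for x a b c
  proof -
    have n: "nb ((`) f ` E) a = {x, b, c}" "nb ((`) f ` E) b = {a, c}" "nb ((`) f ` E) c = {a, b}" "distinct [x, a, b, c]"
      using C unfolding coin_def by auto
    have "x \<in> f ` V" "a \<in> f ` V" "b \<in> f ` V" "c \<in> f ` V" using nb_simple[OF sg'] n(1) by auto
    then obtain x' a' b' c' where v: "x' \<in> V" "a' \<in> V" "b' \<in> V" "c' \<in> V" "x = f x'" "a = f a'" "b = f b'" "c = f c'" by auto
    have sub: "nb E w \<subseteq> V" for w using nb_subset[OF sg] .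
    have im: "f ` nb E a' = f ` {x', b', c'}" "f ` nb E b' = f ` {a', c'}" "f ` nb E c' = f ` {a', b'}"
      using n relabel_nb[OF inj sg] v by auto
    have Vs: "{x', b', c'} \<subseteq> V" "{a', c'} \<subseteq> V" "{a', b'} \<subseteq> V" using v by auto
    have "nb E a' = {x', b', c'}" "nb E b' = {a', c'}" "nb E c' = {a', b'}"
      by (rule iffD1[OF inj_on_image_eq_iff[OF inj sub Vs(1)] im(1)] iffD1[OF inj_on_image_eq_iff[OF inj sub Vs(2)] im(2)]
          iffD1[OF inj_on_image_eq_iff[OF inj sub Vs(3)] im(3)])+
    then have "coin E x' a' b' c'" using n(4) v unfolding coin_def by auto
    then show ?thesis using v by blast
  qed
  show ?thesis unfolding bearing_def using 1 2 by blast
qed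

lemma card_few: "finite V \<Longrightarrow> card (few V m B) = card (few {1..card V} m B)"
proof (rule card_relabel[where A = "\<lambda>V. few V m B"])
  fix f :: "nat \<Rightarrow> nat" and V :: "nat set" and E assume inj: "inj_on f V" and sg: "simple_graph V E" and "planar V E" and E: "E \<in> few V m B"
  have "card (f ` bearing E) = card (bearing E)" using inj bearing_subset[OF sg] by (intro card_image) (rule inj_on_subset)
  then show "(`) f ` E \<in> few (f ` V) m B"
    using E planar_relabel[OF sg \<open>planar V E\<close> inj] card_relabel_edges[OF inj sg] relabel_bearing[OF inj sg]
    unfolding few_def pgm_def by auto
qed (auto simp: few_def pgm_def pgraphs_def)

text \<open>The labels \<open>a\<close>, \<open>b\<close>, \<open>c\<close> are chosen in order, and
  then a vertex \<open>x\<close> bearing no coin, in at least \<open>n - B\<close> ways. To undo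
  this it is enough to know \<open>x\<close>, now one of at most \<open>B + 2\<close> bearing
  vertices, and whether \<open>b < c\<close>. The increase by 2 covers \<open>x\<close> and
  \<open>a\<close>.\<close>

lemma attach_coin:
  "card (few {1..n} m B) * ((n - B) * ((n + 3) * ((n + 2) * (n + 1)))) \<le> card (few {1..n + 3} (m + 4) (B + 2)) * ((B + 2) * 2)"
proof -
  define W where "W = {1..n + 3}"
  have fW: "finite W" "card W = n + 3" unfolding W_def by auto
  define R where "R a b c = (SIGMA E:few (W - {a, b, c}) m B. (W - {a, b, c}) - bearing E)" for a b c
  define D where "D = (SIGMA a:W. SIGMA b:W - {a}. SIGMA c:W - {a, b}. R a b c)"
  define T where "T = (SIGMA E:few W (m + 4) (B + 2). bearing E \<times> (UNIV :: bool set))"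
  define F where "F = (\<lambda>(a :: nat, b, c, E, x). (add_coin E x a b c, x, b < c))"
  have ffew: "finite (few V m B)" if "finite V" for V m B unfolding few_def using finite_pgm[OF that] by simp
  have finR: "finite (R a b c)" for a b c unfolding R_def using fW ffew by auto
  have Dd: "\<exists>a b c E x. d = (a, b, c, E, x) \<and> a \<in> W \<and> b \<in> W \<and> c \<in> W \<and> distinct [a, b, c] \<and> simple_graph (W - {a, b, c}) E
     \<and> planar (W - {a, b, c}) E \<and> card E = m \<and> card (bearing E) \<le> B \<and> x \<in> W - {a, b, c} \<and> x \<notin> bearing E" if "d \<in> D" for d
    using that unfolding D_def R_def few_def pgm_def by auto
  have "card D \<le> card T"
  proof (rule card_inj_on_le[where f = F])
    show "inj_on F D"
    proof (rule inj_onI)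
      fix d d' assume dd: "d \<in> D" "d' \<in> D" "F d = F d'"
      obtain a b c E x where d: "d = (a, b, c, E, x)" "distinct [a, b, c]" "simple_graph (W - {a, b, c}) E"
        "x \<in> W - {a, b, c}" "x \<notin> bearing E" using Dd[OF dd(1)] by blast
      obtain a' b' c' E' x' where d': "d' = (a', b', c', E', x')" "distinct [a', b', c']" "simple_graph (W - {a', b', c'}) E'"
        "x' \<in> W - {a', b', c'}" "x' \<notin> bearing E'" using Dd[OF dd(2)] by blast
      have eq: "add_coin E x a b c = add_coin E' x' a' b' c'" "x = x'" "b < c \<longleftrightarrow> b' < c'"
        using dd(3) d(1) d'(1) unfolding F_def by auto
      have n: "a \<notin> W - {a, b, c}" "b \<notin> W - {a, b, c}" "c \<notin> W - {a, b, c}" by auto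
      have n': "a' \<notin> W - {a', b', c'}" "b' \<notin> W - {a', b', c'}" "c' \<notin> W - {a', b', c'}" by auto
      have "coin (add_coin E x a b c) x' a' b' c'"
        using coin_add_coin[OF d'(3,4) n' d'(2)] eq(1) by simp
      from coin_add_coin_cases[OF d(3,4) n d(2) this]
      have "a' = a \<and> {b', c'} = {b, c}" using eq(2) d(4,5) unfolding bearing_def by auto
      then have abc: "a' = a" "b' = b" "c' = c" using eq(3) d(2) by (auto simp: doubleton_eq_iff)
      have "E = E'"
        using add_coin_restrict[OF d(3,4) n d(2)] add_coin_restrict[OF d'(3,4) n' d'(2)] eq(1) abc by simp
      then show "d = d'" using d(1) d'(1) abc eq(2) by simp
    qed
    show "F ` D \<subseteq> T"
    proof
      fix t assume "t \<in> F ` D"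
      then obtain d where "d \<in> D" "t = F d" by blast
      then obtain a b c E x where d: "t = F (a, b, c, E, x)" "a \<in> W" "b \<in> W" "c \<in> W" "distinct [a, b, c]" "simple_graph (W - {a, b, c}) E"
        "planar (W - {a, b, c}) E" "card E = m" "card (bearing E) \<le> B" "x \<in> W - {a, b, c}" using Dd by metis
      have n: "a \<notin> W - {a, b, c}" "b \<notin> W - {a, b, c}" "c \<notin> W - {a, b, c}" by auto
      note ac = d(6,10) n d(5)
      have WW: "W - {a, b, c} \<union> {a, b, c} = W" using d by auto
      have fin: "finite (W - {a, b, c})" using fW by simp
      have "card (bearing (add_coin E x a b c)) \<le> B + 2"
      proof -
        have fb: "finite (bearing E)" using bearing_subset[OF d(6)] fin finite_subset by blast
        have "card (bearing (add_coin E x a b c)) \<le> card (bearing E \<union> {x, a})"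
          using bearing_add_coin[OF ac] fb by (intro card_mono) auto
        also have "\<dots> \<le> card (bearing E) + card {x, a}" by (rule card_Un_le)
        also have "card {x, a} \<le> 2" by (simp add: card_insert_if)
        finally show ?thesis using d(9) by simp
      qed
      then have "add_coin E x a b c \<in> few W (m + 4) (B + 2)"
        unfolding few_def pgm_def using simple_add_coin[OF ac] planar_add_coin[OF ac fin d(7)] card_add_coin[OF ac fin] d(8) WW by simp
      moreover have "x \<in> bearing (add_coin E x a b c)" unfolding bearing_def using coin_add_coin[OF ac] by blast
      ultimately show "t \<in> T" unfolding T_def d(1) F_def by simp
    qed
    have "finite (bearing E)" if "E \<in> few W (m + 4) (B + 2)" for E
      using that bearing_subset[of W E] fW finite_subset unfolding few_def pgm_def by blast
    then show "finite T" unfolding T_def using ffew[OF fW(1)] by (intro finite_SigmaI finite_cartesian_product) auto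
  qed
  also have "card T \<le> card (few W (m + 4) (B + 2)) * ((B + 2) * 2)"
  proof -
    have fb: "finite (bearing E)" if "E \<in> few W (m + 4) (B + 2)" for E
      using that bearing_subset[of W E] fW finite_subset unfolding few_def pgm_def by blast
    have "card T = (\<Sum>E\<in>few W (m + 4) (B + 2). card (bearing E \<times> (UNIV :: bool set)))"
      unfolding T_def using ffew[OF fW(1)] fb by (intro card_SigmaI) auto
    also have "\<dots> \<le> (\<Sum>E\<in>few W (m + 4) (B + 2). (B + 2) * 2)"
      by (intro sum_mono) (auto simp: card_cartesian_product few_def)
    finally show ?thesis by simp
  qed
  finally have DT: "card D \<le> card (few W (m + 4) (B + 2)) * ((B + 2) * 2)" .
  define r where "r = card (few {1..n} m B) * (n - B)"
  have cR: "r \<le> card (R a b c)" if "a \<in> W" "b \<in> W - {a}" "c \<in> W - {a, b}" for a b c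
  proof -
    have cV: "card (W - {a, b, c}) = n" using that fW by (subst card_Diff_subset) auto
    have fin: "finite (W - {a, b, c})" using fW by simp
    have "card (R a b c) = (\<Sum>E\<in>few (W - {a, b, c}) m B. card ((W - {a, b, c}) - bearing E))"
      unfolding R_def using ffew[OF fin] fW by (intro card_SigmaI) auto
    also have "\<dots> \<ge> (\<Sum>E\<in>few (W - {a, b, c}) m B. n - B)"
    proof (rule sum_mono)
      fix E assume E: "E \<in> few (W - {a, b, c}) m B"
      then have "bearing E \<subseteq> W - {a, b, c}" using bearing_subset unfolding few_def pgm_def by blast
      then have "card ((W - {a, b, c}) - bearing E) = n - card (bearing E)"
        using cV fin finite_subset by (subst card_Diff_subset) auto
      then show "n - B \<le> card ((W - {a, b, c}) - bearing E)" using E unfolding few_def by auto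
    qed
    finally show ?thesis using card_few[OF fin, of m B] cV unfolding r_def by simp
  qed
  have "(n + 3) * ((n + 2) * ((n + 1) * r)) \<le> card D"
  proof -
    have c1: "(n + 1) * r \<le> card (SIGMA c:W - {a, b}. R a b c)" if "a \<in> W" "b \<in> W - {a}" for a b
    proof -
      have "card (SIGMA c:W - {a, b}. R a b c) = (\<Sum>c\<in>W - {a, b}. card (R a b c))"
        using fW finR by (intro card_SigmaI) auto
      also have "\<dots> \<ge> (\<Sum>c\<in>W - {a, b}. r)" using cR that by (intro sum_mono) auto
      finally show ?thesis using fW that by (simp add: card_Diff_subset)
    qed
    have c2: "(n + 2) * ((n + 1) * r) \<le> card (SIGMA b:W - {a}. SIGMA c:W - {a, b}. R a b c)" if "a \<in> W" for a
    proof -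
      have "card (SIGMA b:W - {a}. SIGMA c:W - {a, b}. R a b c) = (\<Sum>b\<in>W - {a}. card (SIGMA c:W - {a, b}. R a b c))"
        using fW finR by (intro card_SigmaI) auto
      also have "\<dots> \<ge> (\<Sum>b\<in>W - {a}. (n + 1) * r)" using c1 that by (intro sum_mono) auto
      finally show ?thesis using fW that by (simp add: card_Diff_subset)
    qed
    have "card D = (\<Sum>a\<in>W. card (SIGMA b:W - {a}. SIGMA c:W - {a, b}. R a b c))"
      unfolding D_def using fW finR by (intro card_SigmaI) auto
    also have "\<dots> \<ge> (\<Sum>a\<in>W. (n + 2) * ((n + 1) * r))" using c2 by (intro sum_mono) auto
    finally show ?thesis using fW by simp
  qed
  moreover have "card (few {1..n} m B) * ((n - B) * ((n + 3) * ((n + 2) * (n + 1)))) = (n + 3) * ((n + 2) * ((n + 1) * r))"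
    unfolding r_def by (simp only: mult.commute mult.left_commute)
  ultimately show ?thesis using DT unfolding W_def by (simp only:)
qed

section \<open>Raising the maximum degree\<close>

fun path_edges :: "'a list \<Rightarrow> 'a set set" where
  "path_edges (x # y # zs) = insert {x, y} (path_edges (y # zs))"
| "path_edges _ = {}"

lemma path_edges_subset: "e \<in> path_edges zs \<Longrightarrow> e \<subseteq> set zs"
  by (induction zs rule: path_edges.induct) auto

lemma path_edges_card2: "distinct zs \<Longrightarrow> e \<in> path_edges zs \<Longrightarrow> card e = 2"
  by (induction zs rule: path_edges.induct) auto

lemma finite_pe: "finite (path_edges zs)"
  by (induction zs rule: path_edges.induct) auto

lemma card_pe: "distinct zs \<Longrightarrow> card (path_edges zs) = length zs - 1"
proof (induction zs rule: path_edges.induct)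
  case (1 x y zs)
  then have "{x, y} \<notin> path_edges (y # zs)" using path_edges_subset[of "{x, y}" "y # zs"] by auto
  then show ?case using 1 by (simp add: finite_pe)
qed auto

lemma path_edges_append:
  "path_edges (xs @ ys) = path_edges xs \<union> path_edges ys \<union> (if xs \<noteq> [] \<and> ys \<noteq> [] then {{last xs, hd ys}} else {})"
proof (induction xs rule: path_edges.induct)
  case ("2_2" x)
  then show ?case by (cases ys) auto
qed auto

lemma path_edges_rev: "path_edges (rev zs) = path_edges zs"
proof (induction zs rule: path_edges.induct)
  case (1 x y zs)
  have "path_edges (rev (x # y # zs)) = path_edges (rev (y # zs) @ [x])" by simp
  also have "\<dots> = path_edges (rev (y # zs)) \<union> {{last (rev (y # zs)), x}}" unfolding path_edges_append by simp
  also have "last (rev (y # zs)) = y" by simp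
  finally show ?case using 1 by (auto simp: insert_commute)
qed auto

lemma path_edges_closed:
  assumes "\<And>e. e \<in> path_edges zs \<Longrightarrow> e \<inter> S \<noteq> {} \<Longrightarrow> e \<subseteq> S" "set zs \<inter> S \<noteq> {}"
  shows "set zs \<subseteq> S"
  using assms
proof (induction zs rule: path_edges.induct)
  case (1 x y zs)
  have xy: "x \<in> S \<longleftrightarrow> y \<in> S" using 1(2)[of "{x, y}"] by auto
  then have "set (y # zs) \<inter> S \<noteq> {}" using 1(3) by auto
  then have "set (y # zs) \<subseteq> S" using 1(1,2) by auto
  then show ?case using xy by auto
qed auto

lemma nb_pe_Cons:
  assumes "distinct (x # y # zs)"
  shows "nb (path_edges (x # y # zs)) v = (if v = x then {y} else if v = y then insert x (nb (path_edges (y # zs)) y) else nb (path_edges (y # zs)) v)"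
proof -
  have "x \<notin> nb (path_edges (y # zs)) v" "v = x \<Longrightarrow> nb (path_edges (y # zs)) v = {}" for v
    using path_edges_subset[of _ "y # zs"] assms unfolding nb_def by fastforce+
  then show ?thesis using assms unfolding nb_def by (auto simp: doubleton_eq_iff)
qed

lemma nb_pe_hd: "distinct (x # zs) \<Longrightarrow> nb (path_edges (x # zs)) x = (if zs = [] then {} else {hd zs})"
proof (cases zs)
  case (Cons a list)
  then show "distinct (x # zs) \<Longrightarrow> ?thesis" using nb_pe_Cons[of x a list x] by (simp del: path_edges.simps)
qed (simp add: nb_def)

lemma card_nb_pe: "distinct zs \<Longrightarrow> finite (nb (path_edges zs) v) \<and> card (nb (path_edges zs) v) \<le> 2"
proof (induction zs arbitrary: v rule: path_edges.induct)
  case (1 x y zs)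
  have "nb (path_edges (y # zs)) y = (if zs = [] then {} else {hd zs})" using nb_pe_hd[of y zs] 1(2) by simp
  then show ?case using nb_pe_Cons[OF 1(2), of v] 1 by (auto simp: card_insert_if)
qed (auto simp: nb_def)

lemma path_edges_end_in_nb:
  assumes "distinct zs" "length zs \<ge> 2" "v \<in> set zs" "card (nb (path_edges zs) v) = 1"
  shows "v = hd zs \<or> v = last zs"
  using assms
proof (induction zs rule: path_edges.induct)
  case (1 x y zs)
  show ?case
  proof (cases "v = x")
    case False
    note vx = this
    show ?thesis
    proof (cases "zs = []")
      case True
      then show ?thesis using 1(4) by auto
    next
      case zs: False
      show ?thesis
      proof (cases "v = y")
        case True
        have "nb (path_edges (y # zs)) y = {hd zs}" using nb_pe_hd[of y zs] 1(2) zs by simp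
        then have "nb (path_edges (x # y # zs)) v = {x, hd zs}" using nb_pe_Cons[OF 1(2), of v] True vx by simp
        moreover have "x \<noteq> hd zs" using 1(2) zs by (auto simp: hd_in_set)
        ultimately show ?thesis using 1(5) by simp
      next
        case vy: False
        have "length (y # zs) \<ge> 2" using zs by (cases zs) auto
        then have "v = hd (y # zs) \<or> v = last (y # zs)"
          using 1 vx vy nb_pe_Cons[OF 1(2), of v] by auto
        then show ?thesis using vy zs by auto
      qed
    qed
  qed simp
qed auto

lemma path_edges_determined_hd:
  assumes "distinct (x # xs)" "distinct (x # ys)" "path_edges (x # xs) = path_edges (x # ys)"
  shows "xs = ys"
  using assms
proof (induction xs arbitrary: x ys)
  case Nil
  then have "nb (path_edges (x # ys)) x = {}" by (simp add: nb_def)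
  then show ?case using nb_pe_hd[OF Nil(2)] by (auto split: if_splits)
next
  case (Cons a xs)
  have "nb (path_edges (x # ys)) x = {a}" using nb_pe_hd[OF Cons(2)] Cons(4) by simp
  then have "ys \<noteq> [] \<and> hd ys = a" using nb_pe_hd[OF Cons(3)] by (auto split: if_splits)
  then obtain ys' where ys: "ys = a # ys'" by (metis list.collapse)
  have "e \<in> path_edges (a # xs) \<longleftrightarrow> e \<in> path_edges (x # a # xs) \<and> x \<notin> e" if "distinct (x # a # xs)" for e and xs :: "'a list"
    using path_edges_subset[of e "a # xs"] that by auto
  then have "path_edges (a # xs) = path_edges (a # ys')" using Cons(2-4) unfolding ys by blast
  then have "xs = ys'" using Cons(1)[of a ys'] Cons(2,3) ys by simp
  then show ?case using ys by simp
qed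

text \<open>The ends of a path with at least two vertices are its vertices of degree 1, and from an
  end the path can be traced edge by edge; only the choice of the end is free.\<close>

lemma path_edges_determined:
  assumes d: "distinct xs" "distinct ys" and st: "set xs = set ys" and eq: "path_edges xs = path_edges ys"
  shows "ys = xs \<or> ys = rev xs"
proof (cases "length xs \<ge> 2")
  case False
  have l: "length ys = length xs" using d st by (metis distinct_card)
  then show ?thesis
  proof (cases xs)
    case Nil
    then show ?thesis using l by simp
  next
    case (Cons a xs')
    then have "xs = [a]" using False by (cases xs') auto
    then show ?thesis using l st by (cases ys) auto
  qed
next
  case True
  have l: "length ys = length xs" using d st by (metis distinct_card)
  then obtain y ys' where ys: "ys = y # ys'" using True by (cases ys) auto
  have "ys' \<noteq> []" using True l ys by auto
  then have "nb (path_edges ys) y = {hd ys'}" using nb_pe_hd[of y ys'] d(2) ys by simp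
  then have "card (nb (path_edges xs) y) = 1" using eq by simp
  then have hl: "y = hd xs \<or> y = last xs" using path_edges_end_in_nb[OF d(1) True] st ys by auto
  have xs: "xs \<noteq> []" using True by auto
  from hl show ?thesis
  proof
    assume "y = hd xs"
    then obtain xs' where xs': "xs = y # xs'" using xs by (metis list.collapse)
    have "xs' = ys'" using path_edges_determined_hd[of y xs' ys'] d eq unfolding ys xs' by blast
    then show ?thesis using ys xs' by simp
  next
    assume "y = last xs"
    then have "y = hd (rev xs)" using xs by (simp add: hd_rev)
    then obtain xs' where xs': "rev xs = y # xs'" using xs by (metis Nil_is_rev_conv list.collapse)
    have "xs' = ys'"
      using path_edges_determined_hd[of y xs' ys'] d eq path_edges_rev[of xs] unfolding ys xs'[symmetric] by (metis distinct_rev ys xs')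
    then show ?thesis using ys xs' by simp
  qed
qed

text \<open>The fan is the double fan without its pole 1: the pole 0 becomes \<open>v\<close>, and
  the vertex \<open>i\<close> becomes entry \<open>i - 2\<close> of the list.\<close>

lemma planar_fan:
  assumes d: "distinct zs" and v: "v \<notin> set zs"
  shows "simple_graph (insert v (set zs)) (path_edges zs \<union> (\<lambda>z. {v, z}) ` set zs)"
    and "planar (insert v (set zs)) (path_edges zs \<union> (\<lambda>z. {v, z}) ` set zs)"
proof -
  let ?n = "length zs"
  let ?U = "insert 0 {2..<?n + 2}"
  define f where "f i = (if i = 0 then v else zs ! (i - 2))" for i :: nat
  have inj: "inj_on f ?U" unfolding f_def using d v
    by (auto simp: inj_on_def nth_eq_iff_index_eq)
  have im: "f ` ?U = insert v (set zs)"
  proof -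
    have "f ` {2..<?n + 2} = set zs"
    proof (intro set_eqI iffI)
      fix x assume "x \<in> set zs"
      then obtain i where i: "i < ?n" "x = zs ! i" by (metis in_set_conv_nth)
      then have "x = f (i + 2)" "i + 2 \<in> {2..<?n + 2}" unfolding f_def by auto
      then show "x \<in> f ` {2..<?n + 2}" by blast
    qed (auto simp: f_def)
    moreover have "f 0 = v" unfolding f_def by simp
    ultimately show ?thesis by simp
  qed
  define G where "G = {e \<in> double_fan (?n + 2). 1 \<notin> e}"
  have sgG: "simple_graph ?U G"
  proof -
    have "e \<subseteq> ?U" if "e \<subseteq> {..<?n + 2}" "1 \<notin> e" for e
    proof
      fix x assume "x \<in> e"
      then have "x < ?n + 2" "x \<noteq> 1" using that by auto
      then show "x \<in> ?U" by auto
    qed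
    then show ?thesis using simple_double_fan[of "?n + 2"] unfolding G_def simple_graph_def by blast
  qed
  have plG: "planar ?U G"
  proof (rule planar_subgraph[OF simple_double_fan planar_double_fan sgG])
    show "?U \<subseteq> {..<?n + 2}" by auto
  qed (auto simp: G_def)
  note r = planar_relabel[OF sgG plG inj, unfolded im]
  have path_edges_nth: "e \<in> path_edges zs \<Longrightarrow> \<exists>i. Suc i < length zs \<and> e = {zs ! i, zs ! Suc i}" for e and zs :: "'a list"
  proof (induction zs rule: path_edges.induct)
    case (1 x y zs)
    show ?case
    proof (cases "e = {x, y}")
      case True
      then show ?thesis by (intro exI[of _ 0]) auto
    next
      case False
      then obtain i where "Suc i < length (y # zs)" "e = {(y # zs) ! i, (y # zs) ! Suc i}" using 1 by auto
      then show ?thesis by (intro exI[of _ "Suc i"]) auto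
    qed
  qed auto
  have sub: "path_edges zs \<union> (\<lambda>z. {v, z}) ` set zs \<subseteq> (`) f ` G"
  proof
    fix e assume "e \<in> path_edges zs \<union> (\<lambda>z. {v, z}) ` set zs"
    then show "e \<in> (`) f ` G"
    proof
      assume "e \<in> path_edges zs"
      then obtain i where i: "Suc i < ?n" "e = {zs ! i, zs ! Suc i}" using path_edges_nth by blast
      then have "{i + 2, Suc (i + 2)} \<in> G" unfolding G_def double_fan_def by auto
      moreover have "e = f ` {i + 2, Suc (i + 2)}" unfolding f_def using i by simp
      ultimately show ?thesis by blast
    next
      assume "e \<in> (\<lambda>z. {v, z}) ` set zs"
      then obtain i where i: "i < ?n" "e = {v, zs ! i}" by (auto simp: in_set_conv_nth)
      then have "{0, i + 2} \<in> G" unfolding G_def double_fan_def by auto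
      moreover have "e = f ` {0, i + 2}" unfolding f_def using i by (simp add: insert_commute)
      ultimately show ?thesis by blast
    qed
  qed
  show s: "simple_graph (insert v (set zs)) (path_edges zs \<union> (\<lambda>z. {v, z}) ` set zs)"
    using path_edges_subset path_edges_card2[OF d] v unfolding simple_graph_def by (fastforce simp: card_insert_if)
  show "planar (insert v (set zs)) (path_edges zs \<union> (\<lambda>z. {v, z}) ` set zs)"
    using planar_subgraph[OF r s _ sub] by blast
qed

text \<open>A list \<^term>\<open>zs\<close> with this property runs along a component of the graph without \<^term>\<open>v\<close>
  that is an induced path; the vertex \<^term>\<open>v\<close> may be adjacent to any of its vertices.\<close>

definition pcomp :: "'a set set \<Rightarrow> 'a \<Rightarrow> 'a list \<Rightarrow> bool" where
  "pcomp E v zs \<longleftrightarrow> distinct zs \<and> v \<notin> set zs \<and> (\<forall>e\<in>E. e \<inter> set zs \<noteq> {} \<longrightarrow> e \<subseteq> insert v (set zs))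
     \<and> {e \<in> E. e \<subseteq> set zs} = path_edges zs"

text \<open>Both lists run through the component of a common vertex in the graph without
  \<open>v\<close>, so they have the same vertices and the same edges.\<close>

lemma pcomp_meet:
  assumes L: "pcomp E v L" and L': "pcomp E v L'" and meet: "set L \<inter> set L' \<noteq> {}"
  shows "L' = L \<or> L' = rev L"
proof -
  have sub: "set L \<subseteq> set L'" if L: "pcomp E v L" and L': "pcomp E v L'" and meet: "set L \<inter> set L' \<noteq> {}" for L L'
  proof (rule path_edges_closed[OF _ meet])
    fix e assume e: "e \<in> path_edges L" "e \<inter> set L' \<noteq> {}"
    have "e \<in> E" using e(1) L unfolding pcomp_def by blast
    then have "e \<subseteq> insert v (set L')" using e(2) L' unfolding pcomp_def by blast
    moreover have "v \<notin> e" using path_edges_subset[OF e(1)] L unfolding pcomp_def by blast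
    ultimately show "e \<subseteq> set L'" by blast
  qed
  have st: "set L = set L'" using sub[OF L L' meet] sub[OF L' L] meet by (simp add: Int_commute)
  then have "path_edges L = path_edges L'" using L L' unfolding pcomp_def by metis
  then show ?thesis using path_edges_determined[of L L'] L L' st unfolding pcomp_def by blast
qed

text \<open>\<^term>\<open>H\<close> is what remains of a graph after \<^term>\<open>j\<close> coins with vertices \<^term>\<open>ts\<close> have been
  taken off; removing a coin destroys at most one further coin.\<close>

definition switch_data :: "nat \<Rightarrow> nat \<Rightarrow> nat \<Rightarrow> nat \<Rightarrow> nat \<Rightarrow> (nat list \<times> nat set set \<times> nat) set" where
  "switch_data n m d B j = {(ts, H, v). distinct ts \<and> length ts = 3 * j \<and> set ts \<subseteq> {1..n} \<and>
     simple_graph ({1..n} - set ts) H \<and> planar ({1..n} - set ts) H \<and> card H + 4 * j = m \<and>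
     v \<in> {1..n} - set ts \<and> card (nb H v) = d \<and> (\<forall>u\<in>{1..n} - set ts. card (nb H u) \<le> d) \<and>
     B \<le> card (bearing H) + 2 * j}"

lemma finite_sw: "finite (switch_data n m d B j)"
proof (rule finite_subset)
  show "switch_data n m d B j \<subseteq> {ts. set ts \<subseteq> {1..n} \<and> length ts = 3 * j} \<times> (Pow (Pow {1..n}) \<times> {1..n})"
    unfolding switch_data_def simple_graph_def by auto
  show "finite ({ts. set ts \<subseteq> {1..n} \<and> length ts = 3 * j} \<times> (Pow (Pow {1..n}) \<times> {1..n}))"
    using finite_lists_length_eq[of "{1..n}" "3 * j"] by simp
qed

text \<open>A removed coin is put back by knowing \<open>x\<close>, at the cost of a factor
  \<open>n\<close>. The removal must leave the degree of \<open>v\<close> alone, which excludes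
  \<open>v\<close> as the bearing vertex and the at most one coin whose triangle contains
  \<open>v\<close>; these are the 2 beside \<open>2 j\<close>.\<close>

lemma switch_data_step: "card (switch_data n m d B j) * (B - (2 * j + 2)) \<le> card (switch_data n m d B (Suc j)) * n"
proof -
  \<comment> \<open>One coin is fixed at each bearing vertex, so that a choice of coin is a choice
    of vertex.\<close>
  define tri where "tri H x = (SOME t. case t of (a, b, c) \<Rightarrow> coin H x a b c)" for H :: "nat set set" and x
  have tri: "coin H x a b c" if "x \<in> bearing H" "tri H x = (a, b, c)" for H x a b c
  proof -
    obtain a0 b0 c0 where "coin H x a0 b0 c0" using \<open>x \<in> bearing H\<close> unfolding bearing_def by blast
    then have "\<exists>t. case t of (a, b, c) \<Rightarrow> coin H x a b c" by auto
    then have "case tri H x of (a, b, c) \<Rightarrow> coin H x a b c" unfolding tri_def by (rule someI_ex)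
    then show ?thesis using that(2) by simp
  qed
  define ok where "ok H v = {x \<in> bearing H. x \<noteq> v \<and> (case tri H x of (a, b, c) \<Rightarrow> v \<notin> {a, b, c})}" for H and v :: nat
  define D where "D = (SIGMA (ts, H, v):switch_data n m d B j. ok H v)"
  define F where "F = (\<lambda>((ts, H, v), x). case tri H x of (a, b, c) \<Rightarrow>
      ((ts @ [a, b, c], {e \<in> H. e \<inter> {a, b, c} = {}}, v :: nat), x))"
  have fb: "finite (bearing H)" if "(ts, H, v) \<in> switch_data n m d B j" for ts H v
    using that bearing_subset[of "{1..n} - set ts" H] finite_subset unfolding switch_data_def by blast
  have cok: "B - (2 * j + 2) \<le> card (ok H v)" if s: "(ts, H, v) \<in> switch_data n m d B j" for ts H v
  proof -
    define Q where "Q = {x \<in> bearing H. case tri H x of (a, b, c) \<Rightarrow> v \<in> {a, b, c}}"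
    have "x = x'" if "x \<in> Q" "x' \<in> Q" for x x'
    proof -
      obtain a b c where t: "tri H x = (a, b, c)" by (metis prod_cases3)
      obtain a' b' c' where t': "tri H x' = (a', b', c')" by (metis prod_cases3)
      have "coin H x a b c" "coin H x' a' b' c'" "v \<in> {a, b, c}" "v \<in> {a', b', c'}"
        using that tri t t' unfolding Q_def by auto
      then show ?thesis using coin_unique by (metis IntI empty_iff)
    qed
    moreover have "finite Q" using fb[OF s] unfolding Q_def by simp
    ultimately have cQ: "card Q \<le> 1" using card_le_Suc0_iff_eq[of Q] by simp
    have "bearing H \<subseteq> ok H v \<union> Q \<union> {v}" unfolding ok_def Q_def by (auto split: prod.splits)
    then have "card (bearing H) \<le> card (ok H v \<union> Q \<union> {v})"
      using fb[OF s] unfolding ok_def Q_def by (intro card_mono) auto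
    also have "\<dots> \<le> card (ok H v) + card Q + card {v}" by (meson add_le_mono1 card_Un_le le_trans)
    finally have "card (bearing H) \<le> card (ok H v) + 2" using cQ by simp
    moreover have "B \<le> card (bearing H) + 2 * j" using s unfolding switch_data_def by simp
    ultimately show ?thesis by linarith
  qed
  have data: "\<exists>ts H v x a b c. d' = ((ts, H, v), x) \<and> (ts, H, v) \<in> switch_data n m d B j \<and> tri H x = (a, b, c) \<and> coin H x a b c \<and> x \<noteq> v \<and> v \<notin> {a, b, c}
      \<and> simple_graph ({1..n} - set ts) H \<and> F d' = ((ts @ [a, b, c], {e \<in> H. e \<inter> {a, b, c} = {}}, v), x)"
    if d': "d' \<in> D" for d'
  proof -
    obtain ts H v x where e: "d' = ((ts, H, v), x)" "(ts, H, v) \<in> switch_data n m d B j" "x \<in> ok H v"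
      using d' unfolding D_def by auto
    obtain a b c where t: "tri H x = (a, b, c)" by (metis prod_cases3)
    have "x \<in> bearing H" "x \<noteq> v" "v \<notin> {a, b, c}" using e(3) t unfolding ok_def by auto
    moreover have "simple_graph ({1..n} - set ts) H" using e(2) unfolding switch_data_def by simp
    moreover have "F d' = ((ts @ [a, b, c], {e \<in> H. e \<inter> {a, b, c} = {}}, v), x)" unfolding F_def e(1) using t by simp
    ultimately show ?thesis using e t tri[of x H a b c] by blast
  qed
  have "card D \<le> card (switch_data n m d B (Suc j) \<times> {1..n})"
  proof (rule card_inj_on_le[where f = F])
    show "inj_on F D"
    proof (rule inj_onI)
      fix p q assume pq: "p \<in> D" "q \<in> D" "F p = F q"
      obtain ts H v x a b c where p: "p = ((ts, H, v), x)" "coin H x a b c" "simple_graph ({1..n} - set ts) H"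
          "F p = ((ts @ [a, b, c], {e \<in> H. e \<inter> {a, b, c} = {}}, v), x)" using data[OF pq(1)] by blast
      obtain ts' H' v' x' a' b' c' where q: "q = ((ts', H', v'), x')" "coin H' x' a' b' c'" "simple_graph ({1..n} - set ts') H'"
          "F q = ((ts' @ [a', b', c'], {e \<in> H'. e \<inter> {a', b', c'} = {}}, v'), x')" using data[OF pq(2)] by blast
      have eq: "ts @ [a, b, c] = ts' @ [a', b', c']" "{e \<in> H. e \<inter> {a, b, c} = {}} = {e \<in> H'. e \<inter> {a', b', c'} = {}}" "v = v'" "x = x'"
        using pq(3) p(4) q(4) by (simp_all only: prod.inject)
      then have abc: "ts = ts'" "a = a'" "b = b'" "c = c'" by auto
      have "H = add_coin {e \<in> H. e \<inter> {a, b, c} = {}} x a b c" by (rule remove_coin(2)[OF p(3,2)])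
      also have "\<dots> = add_coin {e \<in> H'. e \<inter> {a', b', c'} = {}} x' a' b' c'" by (simp only: eq(2)) (simp only: eq(4) abc)
      also have "\<dots> = H'" by (rule remove_coin(2)[OF q(3,2), symmetric])
      finally have "H = H'" .
      then show "p = q" using p(1) q(1) eq(3,4) abc(1) by simp
    qed
    show "F ` D \<subseteq> switch_data n m d B (Suc j) \<times> {1..n}"
    proof
      fix t assume "t \<in> F ` D"
      then obtain d' where d': "d' \<in> D" "t = F d'" by blast
      obtain ts H v x a b c where e0: "(ts, H, v) \<in> switch_data n m d B j" "coin H x a b c" "x \<noteq> v" "v \<notin> {a, b, c}"
          "F d' = ((ts @ [a, b, c], {e \<in> H. e \<inter> {a, b, c} = {}}, v), x)" using data[OF d'(1)] by blast
      note e = e0(1-4) e0(5)[folded d'(2)]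
      define W where "W = {1..n} - set ts"
      define H0 where "H0 = {e \<in> H. e \<inter> {a, b, c} = {}}"
      have s: "distinct ts" "length ts = 3 * j" "set ts \<subseteq> {1..n}" "simple_graph W H" "planar W H" "card H + 4 * j = m"
         "v \<in> W" "card (nb H v) = d" "\<And>u. u \<in> W \<Longrightarrow> card (nb H u) \<le> d" "B \<le> card (bearing H) + 2 * j"
        using e(1) unfolding switch_data_def W_def by auto
      note r = remove_coin[OF s(4) e(2), folded H0_def]
      have finW: "finite W" unfolding W_def by simp
      have ds: "distinct [a, b, c]" using e(2) unfolding coin_def by auto
      have nW: "a \<notin> W - {a, b, c}" "b \<notin> W - {a, b, c}" "c \<notin> W - {a, b, c}" by auto
      note ac = r(1,3) nW ds
      have WW: "{1..n} - set (ts @ [a, b, c]) = W - {a, b, c}" unfolding W_def by auto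
      have "planar (W - {a, b, c}) H0" using planar_subgraph[OF s(4,5) r(1)] unfolding H0_def by blast
      moreover have cH0: "card H = card H0 + 4" using card_add_coin[OF ac] r(2) finW by simp
      moreover have "distinct (ts @ [a, b, c])" using s(1) r(4) ds unfolding W_def by auto
      moreover have "set (ts @ [a, b, c]) \<subseteq> {1..n}" using s(3) r(4) unfolding W_def by auto
      moreover have "nb H0 v = nb H v" using nb_add_coin[OF ac, of v] r(2) e(3,4) by auto
      moreover have "card (nb H0 u) \<le> d" if u: "u \<in> W - {a, b, c}" for u
      proof -
        have "finite (nb H u)" using nb_subset[OF s(4)] finW finite_subset by blast
        then have "card (nb H0 u) \<le> card (nb H u)" by (intro card_mono) (auto simp: H0_def nb_def)
        then show ?thesis using s(9)[of u] u by simp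
      qed
      moreover have cb: "card (bearing H) \<le> card (bearing H0) + 2"
      proof -
        have f0: "finite (bearing H0)" using bearing_subset[OF r(1)] finW finite_subset by (metis finite_Diff)
        have "card (bearing H) \<le> card (bearing H0 \<union> {x, a})"
          using bearing_add_coin[OF ac] r(2) f0 by (intro card_mono) auto
        also have "\<dots> \<le> card (bearing H0) + card {x, a}" by (rule card_Un_le)
        also have "card {x, a} \<le> 2" by (simp add: card_insert_if)
        finally show ?thesis by simp
      qed
      moreover have "length (ts @ [a, b, c]) = 3 * Suc j" using s(2) by simp
      moreover have "v \<in> W - {a, b, c}" using s(7) e(4) by blast
      moreover have "card H0 + 4 * Suc j = m" using cH0 s(6) by simp
      moreover have "B \<le> card (bearing H0) + 2 * Suc j" using cb s(10) by simp
      ultimately have "(ts @ [a, b, c], H0, v) \<in> switch_data n m d B (Suc j)"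
        unfolding switch_data_def mem_Collect_eq prod.case WW using s(8) r(1)
        by (intro conjI ballI; (assumption | simp only:))
      moreover have "x \<in> {1..n}" using r(3) unfolding W_def by auto
      ultimately show "t \<in> switch_data n m d B (Suc j) \<times> {1..n}" unfolding e(5) H0_def by simp
    qed
    show "finite (switch_data n m d B (Suc j) \<times> {1..n})" using finite_sw by simp
  qed
  moreover have "card (switch_data n m d B j) * (B - (2 * j + 2)) \<le> card D"
  proof -
    have fok: "finite (case t of (ts, H, v) \<Rightarrow> ok H v)" if "t \<in> switch_data n m d B j" for t
    proof -
      obtain ts H v where t: "t = (ts, H, v)" by (cases t) auto
      have "finite (bearing H)" using fb that t by blast
      then show ?thesis unfolding t prod.case ok_def by (rule rev_finite_subset) blast
    qed
    have "D = Sigma (switch_data n m d B j) (\<lambda>t. case t of (ts, H, v) \<Rightarrow> ok H v)" unfolding D_def by auto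
    then have "card D = (\<Sum>t\<in>switch_data n m d B j. card (case t of (ts, H, v) \<Rightarrow> ok H v))"
      using finite_sw fok by (simp add: card_SigmaI)
    also have "\<dots> \<ge> (\<Sum>t\<in>switch_data n m d B j. B - (2 * j + 2))" using cok by (intro sum_mono) auto
    finally show ?thesis by simp
  qed
  ultimately show ?thesis by (simp add: card_cartesian_product)
qed

text \<open>The \<open>4 b\<close> edges of the coins are spent on the path, its link and the edges
  to \<open>v\<close>. The conclusions beyond membership and maximum degree serve the
  reconstruction: \<open>v\<close> is the only vertex of largest degree, \<open>zs @ ts\<close> is
  strictly longer than every disjoint path component, and \<open>H\<close> is what avoids
  \<open>ts\<close>.\<close>

lemma switch_data_build:
  assumes s: "(ts, H, v) \<in> switch_data n m d B b" and b: "b \<ge> 4"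
  shows "\<exists>zs E'. E' \<in> pgm {1..n} m \<and> max_degree {1..n} E' \<in> {d + b, d + b + 1} \<and> v \<in> {1..n} \<and>
    (\<forall>u\<in>{1..n}. u \<noteq> v \<longrightarrow> card (nb E' u) < card (nb E' v)) \<and> pcomp E' v (zs @ ts) \<and> set (zs @ ts) \<subseteq> {1..n} \<and>
    (\<forall>ys. pcomp E' v ys \<longrightarrow> set ys \<subseteq> {1..n} \<longrightarrow> set ys \<inter> set (zs @ ts) = {} \<longrightarrow> length ys < length (zs @ ts)) \<and>
    H = {e \<in> E'. e \<inter> set ts = {}}"
proof -
  define W where "W = {1..n} - set ts"
  have s: "distinct ts" "length ts = 3 * b" "set ts \<subseteq> {1..n}" "simple_graph W H" "planar W H" "card H + 4 * b = m"
     "v \<in> W" "card (nb H v) = d" "\<And>u. u \<in> W \<Longrightarrow> card (nb H u) \<le> d"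
    using s unfolding switch_data_def W_def by auto
  have finW: "finite W" unfolding W_def by simp
  have eH: "e \<subseteq> W" "card e = 2" "e \<noteq> {}" if "e \<in> H" for e using s(4) that unfolding simple_graph_def by auto
  have tsne: "ts \<noteq> []" using s(2) b by auto
  define ZS where "ZS = {zs. pcomp H v zs \<and> set zs \<subseteq> W}"
  have "ZS \<subseteq> {zs. set zs \<subseteq> W \<and> distinct zs}" unfolding ZS_def pcomp_def by blast
  then have finZS: "finite (length ` ZS)" using finite_subset_distinct[OF finW] finite_subset by blast
  \<comment> \<open>The empty list counts as a path component, so a longest one exists in any
    case.\<close>
  have "[] \<in> ZS" unfolding ZS_def pcomp_def using eH by auto
  then have "Max (length ` ZS) \<in> length ` ZS" by (intro Max_in[OF finZS]) auto
  then obtain zs where zs: "zs \<in> ZS" "length zs = Max (length ` ZS)" by auto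
  have longest: "length ys \<le> length zs" if "ys \<in> ZS" for ys using zs(2) Max_ge[OF finZS] that by simp
  have zW: "set zs \<subseteq> W" and zp: "distinct zs" "v \<notin> set zs" "\<And>e. e \<in> H \<Longrightarrow> e \<inter> set zs \<noteq> {} \<Longrightarrow> e \<subseteq> insert v (set zs)"
     "{e \<in> H. e \<subseteq> set zs} = path_edges zs"
    using zs(1) unfolding ZS_def pcomp_def by auto
  define L where "L = zs @ ts"
  have dL: "distinct L" unfolding L_def using zp(1) s(1) zW unfolding W_def by auto
  have vL: "v \<notin> set L" unfolding L_def using zp(2) s(7) unfolding W_def by auto
  \<comment> \<open>The path on \<open>ts\<close> takes \<open>3 b - 1\<close> edges, and the link
    to \<open>last zs\<close> takes one more exactly when \<open>zs\<close> is not empty.\<close>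
  define q where "q = (if zs = [] then b + 1 else b)"
  have q: "q \<ge> 4" "q \<le> length ts" unfolding q_def using b s(2) by auto
  define N1 where "N1 = path_edges ts \<union> (if zs \<noteq> [] then {{last zs, hd ts}} else {})"
  define N2 where "N2 = (\<lambda>t. {v, t}) ` set (take q ts)"
  define E' where "E' = H \<union> (N1 \<union> N2)"
  have peL: "path_edges L = path_edges zs \<union> N1" unfolding L_def N1_def path_edges_append using tsne by auto
  have hdts: "hd ts \<in> set ts" using tsne by simp
  have tk: "set (take q ts) \<subseteq> set ts" by (rule set_take_subset)
  have ne2: "e \<noteq> {} \<and> e \<inter> set ts \<noteq> {}" if "e \<in> N1 \<union> N2" for e
  proof -
    from that consider "e \<in> path_edges ts" | "e = {last zs, hd ts}" | "e \<in> N2" unfolding N1_def by (auto split: if_splits)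
    then show ?thesis
    proof cases
      case 1
      then show ?thesis using path_edges_subset[OF 1] path_edges_card2[OF s(1) 1] by (auto simp: card_2_iff)
    next
      case 2
      then show ?thesis using hdts by auto
    next
      case 3
      then show ?thesis using tk unfolding N2_def by auto
    qed
  qed
  have Hts: "e \<inter> set ts = {}" if "e \<in> H" for e using eH[OF that] unfolding W_def by blast
  have Heq: "H = {e \<in> E'. e \<inter> set ts = {}}" unfolding E'_def using ne2 Hts by blast
  have N1L: "e \<subseteq> set L" "v \<notin> e" "card e = 2" if "e \<in> N1" for e
  proof -
    have "e \<in> path_edges L" using peL that by blast
    then show "e \<subseteq> set L" "card e = 2" using path_edges_subset path_edges_card2[OF dL] by auto
    then show "v \<notin> e" using vL by blast
  qed
  have N2L: "v \<in> e" "e \<subseteq> insert v (set L)" "card e = 2" if "e \<in> N2" for e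
    using that tk vL unfolding N2_def L_def by (auto simp: card_insert_if)
  have VL: "insert v (set L) \<subseteq> {1..n}" using s(3,7) zW unfolding L_def W_def by auto
  have sg': "simple_graph {1..n} E'"
    unfolding simple_graph_def
  proof
    fix e assume "e \<in> E'"
    then consider "e \<in> H" | "e \<in> N1" | "e \<in> N2" unfolding E'_def by blast
    then show "e \<subseteq> {1..n} \<and> card e = 2"
    proof cases
      case 1
      then show ?thesis using eH[OF 1] unfolding W_def by auto
    next
      case 2
      then show ?thesis using N1L[OF 2] VL by blast
    next
      case 3
      then show ?thesis using N2L[OF 3] VL by blast
    qed
  qed
  have pl': "planar {1..n} E'"
  proof -
    \<comment> \<open>For planarity \<open>v\<close> is joined to every vertex of the extended path.
      This fan and the part of \<open>H\<close> away from \<open>zs\<close> share only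
      \<open>v\<close>, can be glued there, and together contain \<open>E'\<close>.\<close>
    define E1 where "E1 = {e \<in> H. e \<inter> set zs = {}}"
    define E2 where "E2 = path_edges L \<union> (\<lambda>z. {v, z}) ` set L"
    have s1: "simple_graph (W - set zs) E1" using s(4) unfolding E1_def simple_graph_def by auto
    have p1: "planar (W - set zs) E1" using planar_subgraph[OF s(4,5) s1] unfolding E1_def by blast
    have s2: "simple_graph (insert v (set L)) E2" and p2: "planar (insert v (set L)) E2"
      unfolding E2_def by (rule planar_fan[OF dL vL])+
    have iv: "(W - set zs) \<inter> insert v (set L) = {v}" using s(7) zp(2) unfolding L_def W_def by auto
    have un: "(W - set zs) \<union> insert v (set L) = {1..n}" using VL unfolding L_def W_def by auto
    have fin: "finite (W - set zs)" "finite (insert v (set L))" using finW by auto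
    have pl: "planar {1..n} (E1 \<union> E2)" using planar_glue[OF s1 fin(1) p1 s2 fin(2) p2 iv] un by simp
    have sgu: "simple_graph {1..n} (E1 \<union> E2)" using s1 s2 un unfolding simple_graph_def by blast
    have "e \<in> E1 \<union> E2" if e: "e \<in> E'" for e
    proof -
      from e consider "e \<in> H" "e \<inter> set zs = {}" | "e \<in> H" "e \<inter> set zs \<noteq> {}" | "e \<in> N1" | "e \<in> N2" unfolding E'_def by blast
      then show ?thesis
      proof cases
        case 1
        then show ?thesis unfolding E1_def by blast
      next
        case 2
        have sub: "e \<subseteq> insert v (set zs)" using zp(3)[OF 2] .
        show ?thesis
        proof (cases "v \<in> e")
          case True
          obtain x y where xy: "e = {x, y}" "x \<noteq> y" using simple_graph_edgeE[OF s(4) 2(1)] by metis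
          then obtain z where "e = {v, z}" "z \<noteq> v" using True by auto
          then have "z \<in> set L" "e = {v, z}" using sub unfolding L_def by auto
          then show ?thesis unfolding E2_def by blast
        next
          case False
          then have "e \<in> path_edges zs" using sub 2(1) zp(4) by blast
          then show ?thesis unfolding E2_def peL by blast
        qed
      next
        case 3
        then show ?thesis unfolding E2_def peL by blast
      next
        case 4
        then show ?thesis using tk unfolding E2_def N2_def L_def by auto
      qed
    qed
    then show ?thesis using planar_subgraph[OF sgu pl sg'] by blast
  qed
  have cE: "card E' = m"
  proof -
    have f: "finite H" "finite N1" "finite N2" using finite_edges[OF s(4) finW] finite_pe unfolding N1_def N2_def by auto
    have "card E' = card H + card (N1 \<union> N2)" unfolding E'_def
    proof (rule card_Un_disjoint)
      show "H \<inter> (N1 \<union> N2) = {}" using ne2 Hts by blast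
    qed (use f in auto)
    also have "card (N1 \<union> N2) = card N1 + card N2"
    proof (rule card_Un_disjoint)
      show "N1 \<inter> N2 = {}" using N1L(2) N2L(1) by blast
    qed (use f in auto)
    also have "card N2 = q"
    proof -
      have "card N2 = card (set (take q ts))" unfolding N2_def by (rule card_image) (auto simp: inj_on_def doubleton_eq_iff)
      also have "\<dots> = length (take q ts)" using s(1) by (intro distinct_card) simp
      finally show ?thesis using q(2) by simp
    qed
    also have "card N1 + q = 4 * b"
    proof (cases "zs = []")
      case True
      then show ?thesis unfolding N1_def q_def using card_pe[OF s(1)] s(2) b by simp
    next
      case False
      have "last zs \<notin> set ts" using False zW last_in_set[OF False] unfolding W_def by blast
      then have "{last zs, hd ts} \<notin> path_edges ts" using path_edges_subset[of "{last zs, hd ts}" ts] by blast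
      then have "card N1 = length ts - 1 + 1" unfolding N1_def using False card_pe[OF s(1)] by (simp add: finite_pe)
      then show ?thesis unfolding q_def using False s(2) b by simp
    qed
    finally show ?thesis using s(6) by simp
  qed
  have Epg: "E' \<in> pgm {1..n} m" unfolding pgm_def using sg' pl' cE by blast
  have nbv: "nb E' v = nb H v \<union> set (take q ts)"
  proof -
    have "{v, u} \<notin> N1" for u using N1L(2) by blast
    moreover have "{v, u} \<in> N2 \<longleftrightarrow> u \<in> set (take q ts)" for u
      unfolding N2_def by (auto simp: doubleton_eq_iff)
    ultimately show ?thesis unfolding nb_def E'_def by blast
  qed
  have finnb: "finite (nb H u)" for u using nb_subset[OF s(4)] finW finite_subset by blast
  have cv: "card (nb E' v) = d + q"
  proof -
    have "nb H v \<inter> set (take q ts) = {}" using nb_subset[OF s(4), of v] tk unfolding W_def by blast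
    then have "card (nb E' v) = card (nb H v) + card (set (take q ts))" unfolding nbv using finnb by (intro card_Un_disjoint) auto
    also have "card (set (take q ts)) = q" using s(1) q(2) by (simp add: distinct_card)
    finally show ?thesis using s(8) by simp
  qed
  \<comment> \<open>A vertex of \<open>ts\<close> has at most two path neighbours and
    \<open>v\<close>; any other vertex gains at most the neighbour \<open>hd ts\<close>. As
    \<open>q\<close> is at least 4, both stay below \<open>d + q\<close>, even for
    \<open>d = 0\<close>.\<close>
  have cu: "card (nb E' u) < d + q" if u: "u \<in> {1..n}" "u \<noteq> v" for u
  proof (cases "u \<in> set ts")
    case True
    have "nb E' u \<subseteq> nb (path_edges L) u \<union> {v}"
    proof
      fix w assume "w \<in> nb E' u"
      then have e: "{u, w} \<in> E'" unfolding nb_def by simp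
      then consider "{u, w} \<in> H" | "{u, w} \<in> N1" | "{u, w} \<in> N2" unfolding E'_def by blast
      then show "w \<in> nb (path_edges L) u \<union> {v}"
      proof cases
        case 1
        then show ?thesis using Hts[OF 1] True by auto
      next
        case 2
        then show ?thesis unfolding nb_def peL by blast
      next
        case 3
        then show ?thesis using N2L(1)[OF 3] u(2) by auto
      qed
    qed
    then have "card (nb E' u) \<le> card (nb (path_edges L) u \<union> {v})" using card_nb_pe[OF dL, of u] by (intro card_mono) auto
    also have "\<dots> \<le> card (nb (path_edges L) u) + card {v}" by (rule card_Un_le)
    also have "\<dots> \<le> 3" using card_nb_pe[OF dL, of u] by simp
    finally show ?thesis using q by simp
  next
    case False
    then have uW: "u \<in> W" using u unfolding W_def by simp
    have "nb E' u \<subseteq> nb H u \<union> {hd ts}"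
    proof
      fix w assume "w \<in> nb E' u"
      then have e: "{u, w} \<in> E'" unfolding nb_def by simp
      then consider "{u, w} \<in> H" | "{u, w} \<in> path_edges ts" | "{u, w} = {last zs, hd ts}" | "{u, w} \<in> N2"
        unfolding E'_def N1_def by (auto split: if_splits)
      then show "w \<in> nb H u \<union> {hd ts}"
      proof cases
        case 1
        then show ?thesis unfolding nb_def by blast
      next
        case 2
        then show ?thesis using path_edges_subset[OF 2] False by auto
      next
        case 3
        then show ?thesis using False hdts by (auto simp: doubleton_eq_iff)
      next
        case 4
        then obtain t where "t \<in> set (take q ts)" "{u, w} = {v, t}" unfolding N2_def by blast
        then show ?thesis using False u(2) tk by (auto simp: doubleton_eq_iff)
      qed
    qed
    then have "card (nb E' u) \<le> card (nb H u \<union> {hd ts})" using finnb by (intro card_mono) auto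
    also have "\<dots> \<le> card (nb H u) + card {hd ts}" by (rule card_Un_le)
    also have "\<dots> \<le> d + 1" using s(9)[OF uW] by simp
    finally show ?thesis using q by simp
  qed
  have vn: "v \<in> {1..n}" using s(7) unfolding W_def by blast
  have pcL: "pcomp E' v L"
    unfolding pcomp_def
  proof (intro conjI ballI impI dL vL)
    fix e assume e: "e \<in> E'" "e \<inter> set L \<noteq> {}"
    then consider "e \<in> H" | "e \<in> N1" | "e \<in> N2" unfolding E'_def by blast
    then show "e \<subseteq> insert v (set L)"
    proof cases
      case 1
      then have "e \<inter> set zs \<noteq> {}" using e(2) Hts[OF 1] unfolding L_def by auto
      then show ?thesis using zp(3)[OF 1] unfolding L_def by auto
    next
      case 2
      then show ?thesis using N1L(1)[OF 2] by blast
    next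
      case 3
      then show ?thesis using N2L(2)[OF 3] by blast
    qed
  next
    show "{e \<in> E'. e \<subseteq> set L} = path_edges L"
    proof (intro set_eqI iffI)
      fix e assume e: "e \<in> {e \<in> E'. e \<subseteq> set L}"
      then consider "e \<in> H" | "e \<in> N1" | "e \<in> N2" unfolding E'_def by blast
      then show "e \<in> path_edges L"
      proof cases
        case 1
        then have "e \<subseteq> set zs" using e Hts[OF 1] unfolding L_def by auto
        then show ?thesis using 1 zp(4) peL by blast
      next
        case 2
        then show ?thesis using peL by blast
      next
        case 3
        then show ?thesis using N2L(1)[OF 3] e vL by blast
      qed
    next
      fix e assume e: "e \<in> path_edges L"
      then have "e \<in> path_edges zs \<or> e \<in> N1" using peL by blast
      then have "e \<in> E'" unfolding E'_def using zp(4) by blast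
      then show "e \<in> {e \<in> E'. e \<subseteq> set L}" using path_edges_subset[OF e] by blast
    qed
  qed
  \<comment> \<open>A path component disjoint from the new list was already one of \<open>H\<close>,
    hence is no longer than \<open>zs\<close>, and \<open>ts\<close> is not empty.\<close>
  have long: "length ys < length L" if ys: "pcomp E' v ys" "set ys \<subseteq> {1..n}" "set ys \<inter> set L = {}" for ys
  proof -
    have yW: "set ys \<subseteq> W" using ys(2,3) unfolding W_def L_def by auto
    have "{e \<in> H. e \<subseteq> set ys} = {e \<in> E'. e \<subseteq> set ys}"
    proof -
      have False if "e \<in> N1 \<union> N2" "e \<subseteq> set ys" for e
        using ne2[OF that(1)] that(2) ys(3) unfolding L_def by auto
      then show ?thesis unfolding E'_def by blast
    qed
    then have "pcomp H v ys" using ys(1) unfolding pcomp_def E'_def by simp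
    then have "length ys \<le> length zs" using longest yW unfolding ZS_def by blast
    then show ?thesis unfolding L_def using tsne by (cases ts) auto
  qed
  have md: "max_degree {1..n} E' = d + q"
    unfolding max_degree_def
  proof (rule Max_eqI)
    show "d + q \<in> vertex_degree E' ` {1..n}" using vn cv vertex_degree_nb[OF sg'] by (metis imageI)
    fix y assume "y \<in> vertex_degree E' ` {1..n}"
    then obtain u where "u \<in> {1..n}" "y = card (nb E' u)" using vertex_degree_nb[OF sg'] by auto
    then show "y \<le> d + q" using cu[of u] cv by (cases "u = v") auto
  qed simp
  have "d + q \<in> {d + b, d + b + 1}" unfolding q_def by simp
  moreover have "set (zs @ ts) \<subseteq> {1..n}" using VL unfolding L_def by blast
  moreover have "\<forall>u\<in>{1..n}. u \<noteq> v \<longrightarrow> card (nb E' u) < card (nb E' v)" using cu cv by simp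
  moreover have "\<forall>ys. pcomp E' v ys \<longrightarrow> set ys \<subseteq> {1..n} \<longrightarrow> set ys \<inter> set (zs @ ts) = {} \<longrightarrow> length ys < length (zs @ ts)"
    using long unfolding L_def by blast
  ultimately show ?thesis
    using Epg vn pcL Heq unfolding L_def md[symmetric] by (intro exI[of _ zs] exI[of _ E'] conjI)
qed

text \<open>The result determines \<open>v\<close> as its vertex of largest degree. Two path
  components that are each longer than all disjoint ones must meet, so the extended list is
  determined up to reversal, which is the factor 2. Its last \<open>3 b\<close> entries are
  \<open>ts\<close>, and \<open>H\<close> consists of the edges avoiding them.\<close>

lemma switch_data_final:
  assumes b: "b \<ge> 4"
  shows "card (switch_data n m d B b) \<le> 2 * card {E \<in> pgm {1..n} m. max_degree {1..n} E \<in> {d + b, d + b + 1}}"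
proof -
  define P where "P s zs E' \<longleftrightarrow> (case s of (ts, H, v) \<Rightarrow> E' \<in> pgm {1..n} m \<and> max_degree {1..n} E' \<in> {d + b, d + b + 1} \<and> v \<in> {1..n} \<and>
    (\<forall>u\<in>{1..n}. u \<noteq> v \<longrightarrow> card (nb E' u) < card (nb E' v)) \<and> pcomp E' v (zs @ ts) \<and> set (zs @ ts) \<subseteq> {1..n} \<and>
    (\<forall>ys. pcomp E' v ys \<longrightarrow> set ys \<subseteq> {1..n} \<longrightarrow> set ys \<inter> set (zs @ ts) = {} \<longrightarrow> length ys < length (zs @ ts)) \<and>
    H = {e \<in> E'. e \<inter> set ts = {}})" for s :: "nat list \<times> nat set set \<times> nat" and zs E'
  have "\<exists>zs E'. P s zs E'" if "s \<in> switch_data n m d B b" for s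
    using switch_data_build[OF _ b] that unfolding P_def by (cases s) auto
  then obtain zf Ef where P: "\<And>s. s \<in> switch_data n m d B b \<Longrightarrow> P s (zf s) (Ef s)" by metis
  define F where "F s = (Ef s, zf s @ fst s)" for s
  define R where "R = {E \<in> pgm {1..n} m. max_degree {1..n} E \<in> {d + b, d + b + 1}}"
  define X where "X E = {L. (E, L) \<in> F ` switch_data n m d B b}" for E
  have key: "snd (snd s) = snd (snd s') \<and> (zf s' @ fst s' = zf s @ fst s \<or> zf s' @ fst s' = rev (zf s @ fst s))"
    if s: "s \<in> switch_data n m d B b" "s' \<in> switch_data n m d B b" "Ef s = Ef s'" for s s'
  proof -
    obtain ts H v where e: "s = (ts, H, v)" by (metis prod_cases3)
    obtain ts' H' v' where e': "s' = (ts', H', v')" by (metis prod_cases3)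
    define E where "E = Ef s"
    define L where "L = zf s @ ts"
    define L' where "L' = zf s' @ ts'"
    have p: "v \<in> {1..n}" "\<And>u. u \<in> {1..n} \<Longrightarrow> u \<noteq> v \<Longrightarrow> card (nb E u) < card (nb E v)" "pcomp E v L" "set L \<subseteq> {1..n}"
       "\<And>ys. pcomp E v ys \<Longrightarrow> set ys \<subseteq> {1..n} \<Longrightarrow> set ys \<inter> set L = {} \<Longrightarrow> length ys < length L"
      using P[OF s(1)] unfolding P_def e E_def L_def by auto
    have p': "v' \<in> {1..n}" "\<And>u. u \<in> {1..n} \<Longrightarrow> u \<noteq> v' \<Longrightarrow> card (nb E u) < card (nb E v')" "pcomp E v' L'" "set L' \<subseteq> {1..n}"
       "\<And>ys. pcomp E v' ys \<Longrightarrow> set ys \<subseteq> {1..n} \<Longrightarrow> set ys \<inter> set L' = {} \<Longrightarrow> length ys < length L'"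
      using P[OF s(2)] s(3) unfolding P_def e' E_def L'_def by auto
    have vv: "v = v'" using p(2)[of v'] p'(2)[of v] p(1) p'(1) by (metis less_asym)
    have "set L \<inter> set L' \<noteq> {}"
    proof
      assume dj: "set L \<inter> set L' = {}"
      then have "length L' < length L" using p(5)[of L'] p'(3,4) vv by (simp add: Int_commute)
      moreover have "length L < length L'" using p'(5)[of L] p(3,4) vv dj by simp
      ultimately show False by simp
    qed
    then show ?thesis using pcomp_meet[OF p(3), of L'] p'(3) vv unfolding L_def L'_def e e' by simp
  qed
  have "inj_on F (switch_data n m d B b)"
  proof (rule inj_onI)
    fix s s' assume s: "s \<in> switch_data n m d B b" "s' \<in> switch_data n m d B b" "F s = F s'"
    obtain ts H v where e: "s = (ts, H, v)" by (metis prod_cases3)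
    obtain ts' H' v' where e': "s' = (ts', H', v')" by (metis prod_cases3)
    have eq: "Ef s = Ef s'" "zf s @ ts = zf s' @ ts'" using s(3) unfolding F_def e e' by auto
    have "length ts = length ts'" using s(1,2) unfolding e e' switch_data_def by simp
    then have ts: "ts = ts'" using eq(2) by simp
    have vv: "v = v'" using key[OF s(1,2) eq(1)] unfolding e e' by simp
    have "H = {x \<in> Ef s. x \<inter> set ts = {}}" using P[OF s(1)] unfolding P_def e by auto
    moreover have "H' = {x \<in> Ef s'. x \<inter> set ts' = {}}" using P[OF s(2)] unfolding P_def e' by auto
    ultimately show "s = s'" unfolding e e' using ts vv eq(1) e e' by simp
  qed
  note injF = this
  have X2: "finite (X E) \<and> card (X E) \<le> 2" for E
  proof (cases "X E = {}")
    case False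
    then obtain s where s: "s \<in> switch_data n m d B b" "Ef s = E" unfolding X_def F_def by auto
    have "X E \<subseteq> {zf s @ fst s, rev (zf s @ fst s)}"
    proof
      fix L assume "L \<in> X E"
      then obtain s' where "s' \<in> switch_data n m d B b" "Ef s' = E" "L = zf s' @ fst s'" unfolding X_def F_def by auto
      then show "L \<in> {zf s @ fst s, rev (zf s @ fst s)}" using key[OF s(1), of s'] s(2) by auto
    qed
    moreover have "card {zf s @ fst s, rev (zf s @ fst s)} \<le> 2" by (simp add: card_insert_if)
    ultimately show ?thesis by (meson card_mono finite.emptyI finite.insertI finite_subset le_trans)
  qed simp
  have "card (switch_data n m d B b) = card (F ` switch_data n m d B b)" using injF by (simp add: card_image)
  also have "\<dots> \<le> card (Sigma R X)"
  proof (rule card_mono)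
    have "finite R" unfolding R_def using finite_pgm[of "{1..n}" m] by simp
    then show "finite (Sigma R X)" using X2 by blast
    show "F ` switch_data n m d B b \<subseteq> Sigma R X"
    proof
      fix t assume t: "t \<in> F ` switch_data n m d B b"
      then obtain s where s: "s \<in> switch_data n m d B b" "t = F s" by blast
      have "Ef s \<in> R" using P[OF s(1)] unfolding P_def R_def by (auto split: prod.splits)
      then show "t \<in> Sigma R X" using s t unfolding F_def X_def by auto
    qed
  qed
  also have "\<dots> \<le> 2 * card R"
  proof -
    have "finite R" unfolding R_def using finite_pgm[of "{1..n}" m] by simp
    then have "card (Sigma R X) = (\<Sum>E\<in>R. card (X E))" using X2 by (intro card_SigmaI) auto
    also have "\<dots> \<le> (\<Sum>E\<in>R. 2)" using X2 by (intro sum_mono) auto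
    finally show ?thesis by simp
  qed
  finally show ?thesis unfolding R_def .
qed

section \<open>Growth rates\<close>

definition planar_density :: "nat \<Rightarrow> nat \<Rightarrow> real" where
  "planar_density n m = real (card (pgm {1..n} m)) / fact n"

lemma conn_density_le_pden: "conn_density n (Suc m) \<le> planar_density n m"
proof -
  have "card (cgm {1..n} m) \<le> card (pgm {1..n} m)"
    by (intro card_mono finite_pgm) (auto simp: cgm_def)
  then show ?thesis unfolding conn_density_def planar_density_def by (simp add: divide_right_mono)
qed

lemma planar_density_upper_bound: "\<exists>c\<ge>0. \<forall>n m. planar_density n m \<le> exp (c * real n)"
proof -
  obtain C :: nat where C: "C \<ge> 1" "\<And>n. card (pgraphs {1..n}) \<le> fact n * C ^ n"
    using planar_graphs_small by auto
  have "planar_density n m \<le> exp (ln C * real n)" for n m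
  proof -
    have "card (pgm {1..n} m) \<le> card (pgraphs {1..n})"
      by (intro card_mono finite_pgraphs) (auto simp: pgm_def pgraphs_def)
    then have "card (pgm {1..n} m) \<le> fact n * C ^ n" using C(2)[of n] by linarith
    then have "real (card (pgm {1..n} m)) \<le> real (fact n * C ^ n)" using of_nat_mono by blast
    then have "planar_density n m \<le> real C ^ n" unfolding planar_density_def by (simp add: field_simps)
    also have "real C ^ n = exp (ln C * real n)" using C(1) by (simp add: exp_of_nat2_mult)
    finally show ?thesis .
  qed
  moreover have "ln (real C) \<ge> 0" using C(1) by simp
  ultimately show ?thesis by blast
qed

lemma power_le_fact_exp:
  fixes s :: real
  assumes "s \<ge> 0"
  shows "s ^ q \<le> fact q * exp s"
proof -
  have "(\<Sum>i\<in>{q}. s ^ i /\<^sub>R fact i) \<le> (\<Sum>i. s ^ i /\<^sub>R fact i)"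
    using summable_exp_generic[of s] assms by (intro sum_le_suminf) auto
  then have "s ^ q / fact q \<le> exp s" unfolding exp_def by (simp add: field_simps)
  then show ?thesis by (simp add: field_simps)
qed

text \<open>The number \<open>Suc q\<close> of components is a most frequent one, at a loss of the
  factor \<open>N\<close>. Linking costs \<open>(62 N) ^ q / (q!)^2\<close>, and
  \<open>power_le_fact_exp\<close> with \<open>s = t sqrt (62 N)\<close> bounds this by
  \<open>exp (2 s) / t ^ (2 q)\<close>. The free parameter \<open>t\<close> serves twice:
  \<open>t = 1\<close> bounds the loss, a large \<open>t\<close> bounds \<open>q\<close>.\<close>

lemma link_density:
  assumes N: "N \<ge> 1"
  shows "\<exists>q. \<forall>t>0. planar_density N m * t ^ (2 * q) \<le> real N * conn_density N (m + q + 1) * exp (2 * t * sqrt (62 * real N))"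
proof -
  define V where "V = {1..N}"
  have fin: "finite V" "V \<noteq> {}" "card V = N" using N unfolding V_def by auto
  define a where "a q = card (pgm_comps V m (Suc q))" for q
  have fg: "finite (pgm_comps V m q)" for q unfolding pgm_comps_def using finite_pgm[OF fin(1)] by simp
  have "pgm V m \<subseteq> (\<Union>q<N. pgm_comps V m (Suc q))"
  proof
    fix E assume E: "E \<in> pgm V m"
    have "card (comps V E) \<le> N" unfolding comps_def using card_image_le[OF fin(1)] fin(3) by metis
    moreover have "card (comps V E) > 0" unfolding comps_def using fin by (simp add: card_gt_0_iff)
    ultimately have "card (comps V E) - 1 < N" "E \<in> pgm_comps V m (Suc (card (comps V E) - 1))"
      using E unfolding pgm_comps_def by auto
    then show "E \<in> (\<Union>q<N. pgm_comps V m (Suc q))" by blast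
  qed
  then have "card (pgm V m) \<le> card (\<Union>q<N. pgm_comps V m (Suc q))" using fg by (intro card_mono) auto
  also have "\<dots> \<le> (\<Sum>q<N. a q)" unfolding a_def by (intro card_UN_le) auto
  finally have le: "card (pgm V m) \<le> (\<Sum>q<N. a q)" .
  have "\<exists>q. card (pgm V m) \<le> N * a q"
  proof -
    have im: "finite (a ` {..<N})" "a ` {..<N} \<noteq> {}" using N by (auto simp: lessThan_empty_iff)
    then obtain q where q: "a q = Max (a ` {..<N})" using Max_in[OF im] by (metis imageE)
    have "(\<Sum>i<N. a i) \<le> of_nat (card {..<N}) * a q"
      by (intro sum_bounded_above) (simp add: q im)
    then show ?thesis using le by (intro exI[of _ q]) simp
  qed
  then obtain q where q: "card (pgm V m) \<le> N * a q" by blast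
  define c where "c = card (cgm V (m + q))"
  have link: "real (a q) * (fact q)\<^sup>2 \<le> real c * (62 * real N) ^ q"
  proof -
    have "a q * (fact q)\<^sup>2 \<le> c * (2 * (m + q)) ^ q"
      using card_link_all[OF fin(1), of m q] pgm_comps_one_conn[OF fin(2,1)] unfolding a_def c_def by simp
    also have "\<dots> \<le> c * (62 * N) ^ q"
    proof (cases "cgm V (m + q) = {}")
      case True then show ?thesis unfolding c_def by simp
    next
      case False
      then obtain E where "E \<in> cgm V (m + q)" by blast
      then have "m + q \<le> 31 * N" using cgm_edge_bound[OF _ fin(1)] fin(3) by metis
      then show ?thesis by (intro mult_le_mono2 power_mono) auto
    qed
    finally have "real (a q * (fact q)\<^sup>2) \<le> real (c * (62 * N) ^ q)" using of_nat_mono by blast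
    then show ?thesis by simp
  qed
  show ?thesis
  proof (intro exI[of _ q] allI impI)
    fix t :: real assume t: "t > 0"
    define s where "s = t * sqrt (62 * real N)"
    have s: "s \<ge> 0" unfolding s_def using t by simp
    have "s ^ q * s ^ q \<le> (fact q * exp s) * (fact q * exp s)"
      using power_le_fact_exp[OF s, of q] s by (intro mult_mono) auto
    moreover have "s ^ q * s ^ q = t ^ (2 * q) * (62 * real N) ^ q"
    proof -
      have "s ^ q * s ^ q = (s\<^sup>2) ^ q" by (simp add: power2_eq_square power_mult_distrib)
      also have "s\<^sup>2 = t\<^sup>2 * (62 * real N)" unfolding s_def by (simp add: power_mult_distrib)
      finally show ?thesis by (simp add: power_mult_distrib power_mult)
    qed
    moreover have "(fact q * exp s) * (fact q * exp s) = (fact q)\<^sup>2 * exp (2 * t * sqrt (62 * real N))"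
      unfolding s_def by (simp add: power2_eq_square exp_add[symmetric] algebra_simps)
    ultimately have b: "t ^ (2 * q) * (62 * real N) ^ q \<le> (fact q)\<^sup>2 * exp (2 * t * sqrt (62 * real N))" by simp
    have "real (a q) * t ^ (2 * q) * (fact q)\<^sup>2 = (real (a q) * (fact q)\<^sup>2) * t ^ (2 * q)" by simp
    also have "\<dots> \<le> (real c * (62 * real N) ^ q) * t ^ (2 * q)" using link t by (intro mult_right_mono) auto
    also have "\<dots> = real c * (t ^ (2 * q) * (62 * real N) ^ q)" by simp
    also have "\<dots> \<le> real c * ((fact q)\<^sup>2 * exp (2 * t * sqrt (62 * real N)))" using b by (intro mult_left_mono) auto
    also have "\<dots> = real c * exp (2 * t * sqrt (62 * real N)) * (fact q)\<^sup>2" by simp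
    finally have *: "real (a q) * t ^ (2 * q) \<le> real c * exp (2 * t * sqrt (62 * real N))"
      by (rule mult_right_le_imp_le) simp
    have "real (card (pgm V m)) \<le> real (N * a q)" using q of_nat_mono by blast
    then have "real (card (pgm V m)) * t ^ (2 * q) \<le> real N * (real (a q) * t ^ (2 * q))"
      using mult_right_mono[of "real (card (pgm V m))" "real (N * a q)" "t ^ (2 * q)"] t by simp
    also have "\<dots> \<le> real N * (real c * exp (2 * t * sqrt (62 * real N)))" using * by (intro mult_left_mono) auto
    finally show "planar_density N m * t ^ (2 * q) \<le> real N * conn_density N (m + q + 1) * exp (2 * t * sqrt (62 * real N))"
      unfolding planar_density_def conn_density_def c_def V_def by (simp add: divide_right_mono)
  qed
qed

lemma ln_sqrt_small:
  assumes e: "e > (0 :: real)" and K: "K \<ge> 0"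
  shows "\<exists>N0::nat. \<forall>N\<ge>N0. real N * exp (K * sqrt (62 * real N)) \<le> exp (e * real N)"
proof (intro exI allI impI)
  \<comment> \<open>From \<open>N \<le> exp (2 sqrt N)\<close> and \<open>sqrt 62 \<le> 8\<close>
    the exponent is at most \<open>(2 + 8 K) sqrt N\<close>, which this threshold keeps below
    \<open>e N\<close>.\<close>
  fix N :: nat assume N: "N \<ge> nat \<lceil>((2 + 8 * K) / e)\<^sup>2\<rceil> + 1"
  define s where "s = sqrt (real N)"
  have s2: "s * s = real N" unfolding s_def by simp
  have s0: "s > 0" using N unfolding s_def by simp
  have "((2 + 8 * K) / e)\<^sup>2 \<le> real N" using N by linarith
  then have "(2 + 8 * K) / e \<le> s" unfolding s_def by (rule real_le_rsqrt)
  then have "2 + 8 * K \<le> e * s" using e by (simp add: field_simps)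
  then have 1: "(2 + 8 * K) * s \<le> e * real N" using s0 s2 mult_right_mono[of "2 + 8 * K" "e * s" s] by (simp add: mult.assoc)
  have "s \<le> exp s" using exp_ge_add_one_self[of s] by linarith
  then have "real N \<le> exp s * exp s" using s2 s0 mult_mono[of s "exp s" s "exp s"] by simp
  also have "\<dots> = exp (2 * s)" by (simp add: exp_add[symmetric])
  finally have 2: "real N \<le> exp (2 * s)" .
  have "sqrt (62 * real N) \<le> sqrt (64 * real N)" by simp
  also have "\<dots> = 8 * s" unfolding s_def by (simp add: real_sqrt_mult)
  finally have "exp (K * sqrt (62 * real N)) \<le> exp (K * (8 * s))" using K by (simp add: mult_left_mono)
  then have "real N * exp (K * sqrt (62 * real N)) \<le> exp (2 * s) * exp (K * (8 * s))"
    using 2 by (intro mult_mono) auto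
  also have "\<dots> = exp ((2 + 8 * K) * s)" by (simp add: exp_add[symmetric] algebra_simps)
  also have "\<dots> \<le> exp (e * real N)" using 1 by simp
  finally show "real N * exp (K * sqrt (62 * real N)) \<le> exp (e * real N)" .
qed

text \<open>The loss is subexponential by \<open>link_density\<close> with \<open>t = 1\<close>. Few
  edges are added, because for a large \<open>q\<close> the factor \<open>t ^ (2 q)\<close> would
  beat the exponential upper bound on densities.\<close>

lemma connect_density:
  assumes e: "e > (0 :: real)" and a: "a \<ge> 0"
  shows "\<exists>N0. \<forall>N\<ge>N0. \<forall>m. exp (- (a * real N)) \<le> planar_density N m \<longrightarrow>
    (\<exists>q. real q \<le> e * real N \<and> planar_density N m * exp (- (e * real N)) \<le> conn_density N (m + q + 1))"
proof -
  obtain c where c: "c \<ge> 0" "\<And>n m. planar_density n m \<le> exp (c * real n)" using planar_density_upper_bound by blast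
  \<comment> \<open>Chosen so that \<open>t ^ (2 q)\<close> is
    \<open>exp (q (a + c + 1) / e)\<close>, which exceeds the admissible
    \<open>exp ((a + c + 1) N)\<close> once \<open>q > e N\<close>.\<close>
  define t where "t = exp ((a + c + 1) / (2 * e))"
  have t0: "t > 0" unfolding t_def by simp
  obtain N1 where N1: "\<And>N. N \<ge> N1 \<Longrightarrow> real N * exp ((2 * t) * sqrt (62 * real N)) \<le> exp (1 * real N)"
    using ln_sqrt_small[of 1 "2 * t"] t0 by auto
  obtain N2 where N2: "\<And>N. N \<ge> N2 \<Longrightarrow> real N * exp (2 * sqrt (62 * real N)) \<le> exp (e * real N)"
    using ln_sqrt_small[OF e, of 2] by auto
  show ?thesis
  proof (rule exI[of _ "max 1 (max N1 N2)"], intro allI impI)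
    fix N m assume N: "N \<ge> max 1 (max N1 N2)" and low: "exp (- (a * real N)) \<le> planar_density N m"
    obtain q where q: "\<And>t. t > 0 \<Longrightarrow> planar_density N m * t ^ (2 * q) \<le> real N * conn_density N (m + q + 1) * exp (2 * t * sqrt (62 * real N))"
      using link_density[of N m] N by auto
    have conn_density_up: "conn_density N (m + q + 1) \<le> exp (c * real N)" using conn_density_le_pden[of N "m + q"] c(2)[of N "m + q"] by simp
    have tq: "t ^ (2 * q) = exp (real q * ((a + c + 1) / e))"
      unfolding t_def by (simp add: exp_of_nat_mult[symmetric])
    have "exp (- (a * real N)) * t ^ (2 * q) \<le> planar_density N m * t ^ (2 * q)" using low t0 by (intro mult_right_mono) auto
    also have "\<dots> \<le> real N * conn_density N (m + q + 1) * exp (2 * t * sqrt (62 * real N))" by (rule q[OF t0])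
    also have "\<dots> = conn_density N (m + q + 1) * (real N * exp ((2 * t) * sqrt (62 * real N)))" by simp
    also have "\<dots> \<le> exp (c * real N) * exp (1 * real N)"
      using conn_density_up N1[of N] N by (intro mult_mono) auto
    finally have "exp (real q * ((a + c + 1) / e) - a * real N) \<le> exp (c * real N + real N)"
      unfolding tq by (simp add: exp_add[symmetric] algebra_simps)
    then have "real q * ((a + c + 1) / e) \<le> (a + c + 1) * real N" by (simp add: algebra_simps)
    then have "(a + c + 1) * real q \<le> (a + c + 1) * (e * real N)" using e by (simp add: field_simps)
    then have qe: "real q \<le> e * real N" using a c(1) by (simp add: mult_le_cancel_left)
    have "planar_density N m \<le> conn_density N (m + q + 1) * (real N * exp (2 * sqrt (62 * real N)))"
      using q[of 1] by (simp add: mult_ac)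
    also have "\<dots> \<le> conn_density N (m + q + 1) * exp (e * real N)" using N2[of N] N conn_density_nonneg by (intro mult_left_mono) auto
    finally have "planar_density N m * exp (- (e * real N)) \<le> conn_density N (m + q + 1) * exp (e * real N) * exp (- (e * real N))"
      by (intro mult_right_mono) auto
    also have "\<dots> = conn_density N (m + q + 1)" by (simp add: exp_minus)
    finally show "\<exists>q. real q \<le> e * real N \<and> planar_density N m * exp (- (e * real N)) \<le> conn_density N (m + q + 1)" using qe by blast
  qed
qed

section \<open>Growth rates after attaching coins, and their extension to larger graphs\<close>

text \<open>The choices of three labels match the growth of the factorial, so each attachment gains
  the free vertices, at least \<open>n - k\<close>, divided by the ways to undo it, at most
  \<open>6 k\<close>.\<close>

lemma attach_coins:
  assumes k: "k \<ge> 1" "k \<le> n" and j: "j \<le> k"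
  shows "real (card (few {1..n} m k)) / fact n * (real (n - k) / (6 * real k)) ^ j
    \<le> real (card (few {1..n + 3 * j} (m + 4 * j) (k + 2 * j))) / fact (n + 3 * j)"
  using j
proof (induction j)
  case (Suc j)
  define n' where "n' = n + 3 * j"
  define B where "B = k + 2 * j"
  define f where "f = card (few {1..n'} (m + 4 * j) B)"
  define g where "g = card (few {1..n' + 3} (m + 4 * j + 4) (B + 2))"
  have at: "f * ((n' - B) * ((n' + 3) * ((n' + 2) * (n' + 1)))) \<le> g * ((B + 2) * 2)"
    unfolding f_def g_def by (rule attach_coin)
  \<comment> \<open>At most \<open>k - 1\<close> coins were attached before, so \<open>B\<close> is
    at most \<open>3 k - 2\<close>; this gives the \<open>6 k\<close>.\<close>
  have nB: "n - k \<le> n' - B" "(B + 2) * 2 \<le> 6 * k" unfolding n'_def B_def using Suc.prems by auto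
  have "f * ((n - k) * ((n' + 3) * ((n' + 2) * (n' + 1)))) \<le> f * ((n' - B) * ((n' + 3) * ((n' + 2) * (n' + 1))))"
    using nB(1) by (intro mult_le_mono) auto
  also note at
  also have "g * ((B + 2) * 2) \<le> g * (6 * k)" using nB(2) by (rule mult_le_mono2)
  finally have "real (f * ((n - k) * ((n' + 3) * ((n' + 2) * (n' + 1))))) \<le> real (g * (6 * k))"
    using of_nat_mono by blast
  then have 1: "real f * real (n - k) * (real (n' + 3) * (real (n' + 2) * real (n' + 1))) \<le> real g * (6 * real k)"
    by (simp only: of_nat_mult mult.assoc of_nat_numeral)
  have fct: "(fact (n' + 3) :: real) = (real (n' + 3) * (real (n' + 2) * real (n' + 1))) * fact n'"
  proof -
    have "n' + 3 = Suc (Suc (Suc n'))" by simp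
    then have "(fact (n' + 3) :: real) = real (Suc (Suc (Suc n'))) * (real (Suc (Suc n')) * (real (Suc n') * fact n'))"
      by (simp only: fact_Suc)
    then show ?thesis by (simp add: add.commute)
  qed
  define F where "F = (real (n' + 3) * (real (n' + 2) * real (n' + 1)))"
  have F0: "F > 0" unfolding F_def by simp
  have step: "real f / fact n' * (real (n - k) / (6 * real k)) \<le> real g / fact (n' + 3)"
    using 1[folded F_def] k(1) F0 unfolding fct F_def[symmetric] by (simp add: field_simps)
  have "real (card (few {1..n} m k)) / fact n * (real (n - k) / (6 * real k)) ^ Suc j
      = (real (card (few {1..n} m k)) / fact n * (real (n - k) / (6 * real k)) ^ j) * (real (n - k) / (6 * real k))" by simp
  also have "\<dots> \<le> real f / fact n' * (real (n - k) / (6 * real k))"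
    using Suc unfolding f_def n'_def B_def by (intro mult_right_mono) auto
  also note step
  finally show ?case unfolding g_def n'_def B_def by (simp add: algebra_simps)
qed simp

lemma conn_density_power:
  assumes "N \<ge> 124" "M \<ge> 1" "x \<ge> 1"
  shows "conn_density N M ^ x \<le> conn_density (x * N) (x * M)"
  using assms(3)
proof (induction x rule: dec_induct)
  case (step x)
  have "124 \<le> x * N" using assms(1) step(1) by (metis le_trans mult_le_mono nat_mult_1)
  moreover have "1 \<le> x * M" using assms(2) step(1) by simp
  ultimately have "conn_density N M * conn_density (x * N) (x * M) \<le> conn_density (N + x * N) (M + x * M)"
    using conn_density_superadditive assms by blast
  moreover have "conn_density N M * conn_density N M ^ x \<le> conn_density N M * conn_density (x * N) (x * M)"
    using step conn_density_nonneg by (intro mult_left_mono) auto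
  ultimately show ?case by simp
qed simp

text \<open>As \<open>r\<close> lies strictly between the slopes 1 of trees and 3 of triangulations,
  all slopes within \<open>2 h\<close> of it are reached at an exponential loss \<open>L\<close>.
  This slack lets a filler graph correct the number of edges in
  \<open>conn_density_extend\<close>.\<close>

lemma conn_density_filler:
  assumes r: "1 < r" "r < (3 :: real)"
  shows "\<exists>h>0. h \<le> 1 \<and> (\<exists>L\<ge>0. \<exists>n0\<ge>124. \<forall>n\<ge>n0. \<forall>M. \<bar>real M - r * real n\<bar> \<le> 2 * h * real n \<longrightarrow> exp (- (L * real n)) \<le> conn_density n M \<and> M \<ge> 1)"
proof -
  define h where "h = min ((3 - r) / 4) ((r - 1) / 2)"
  \<comment> \<open>This makes the largest slope \<open>3 - 5 / b\<close> of
    \<open>conn_density_lower_bound\<close> at least \<open>3 - (3 - r) / 2\<close>, hence at least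
    \<open>r + 2 h\<close>.\<close>
  define b where "b = max 124 (nat \<lceil>10 / (3 - r)\<rceil>)"
  have h: "h > 0" "2 * h \<le> (3 - r) / 2" "2 * h \<le> r - 1" "h \<le> 1" using r unfolding h_def by (auto simp: min_def)
  have b: "b \<ge> 124" unfolding b_def by simp
  have "10 / (3 - r) \<le> real b" unfolding b_def by linarith
  then have b10: "10 \<le> real b * (3 - r)" using r by (simp add: field_simps)
  define L where "L = ln (fact (2 * b) :: real)"
  have L: "L \<ge> 0" unfolding L_def by simp
  have "exp (- (L * real n)) \<le> conn_density n M \<and> M \<ge> 1" if n: "n \<ge> b" and M: "\<bar>real M - r * real n\<bar> \<le> 2 * h * real n" for n M
  proof -
    have "real n * 1 \<le> real n * (r - 2 * h)" using h by (intro mult_left_mono) auto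
    then have nM: "n \<le> M" using M by (simp add: algebra_simps abs_le_iff)
    have "real M \<le> (r + 2 * h) * real n" using M by (simp add: algebra_simps abs_le_iff)
    then have "real b * real M \<le> real b * ((r + 2 * h) * real n)" by (intro mult_left_mono) auto
    also have "\<dots> = (real b * (r + 2 * h)) * real n" by simp
    also have "\<dots> \<le> (3 * real b - 5) * real n"
    proof (rule mult_right_mono)
      have "r + 2 * h \<le> 3 - (3 - r) / 2" using h(2) by (simp add: field_simps)
      then have "real b * (r + 2 * h) \<le> real b * (3 - (3 - r) / 2)" by (intro mult_left_mono) auto
      also have "\<dots> \<le> 3 * real b - 5" using b10 by (simp add: algebra_simps)
      finally show "real b * (r + 2 * h) \<le> 3 * real b - 5" .
    qed simp
    also have "\<dots> = real ((3 * b - 5) * n)" using b by (simp add: of_nat_diff)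
    finally have "b * M \<le> (3 * b - 5) * n" by (metis of_nat_le_iff of_nat_mult)
    then have "(1 / fact (2 * b)) ^ n \<le> conn_density n M" using conn_density_lower_bound[OF b n nM] by simp
    moreover have "(1 / fact (2 * b)) ^ n = exp (- (L * real n))"
    proof -
      have "exp (- (L * real n)) = exp (- L) ^ n" by (simp add: exp_of_nat2_mult[symmetric])
      also have "exp (- L) = 1 / fact (2 * b)" unfolding L_def by (simp add: exp_minus inverse_eq_divide)
      finally show ?thesis by simp
    qed
    ultimately show ?thesis using nM n b by simp
  qed
  then show ?thesis using h(1,4) L b by blast
qed

lemma conn_density_lower:
  assumes r: "1 < r" "r < (3 :: real)"
  shows "\<exists>L\<ge>0. \<exists>n0. \<forall>n\<ge>n0. exp (- (L * real n)) \<le> conn_density n (Suc (nat \<lfloor>r * real n\<rfloor>))"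
proof -
  obtain h L n0 where h: "h > 0" "L \<ge> 0"
    and F: "\<And>n M. n \<ge> n0 \<Longrightarrow> \<bar>real M - r * real n\<bar> \<le> 2 * h * real n \<Longrightarrow> exp (- (L * real n)) \<le> conn_density n M"
    using conn_density_filler[OF r] by blast
  have "exp (- (L * real n)) \<le> conn_density n (Suc (nat \<lfloor>r * real n\<rfloor>))" if n: "n \<ge> max n0 (nat \<lceil>1 / h\<rceil>)" for n
  proof (rule F)
    have "1 / h \<le> real n" using n by linarith
    then have "1 \<le> h * real n" using h by (simp add: field_simps)
    moreover have "0 \<le> r * real n" using r by simp
    then have "\<bar>real (Suc (nat \<lfloor>r * real n\<rfloor>)) - r * real n\<bar> \<le> 1" by linarith
    ultimately show "\<bar>real (Suc (nat \<lfloor>r * real n\<rfloor>)) - r * real n\<bar> \<le> 2 * h * real n" by linarith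
  qed (use n in simp)
  then show ?thesis using h(2) by blast
qed

text \<open>Disjoint copies of a good pair \<open>(N, M)\<close> fill most of \<open>n\<close>; the remaining vertices take a slightly
  different edge density, which corrects the total number of edges.\<close>

lemma conn_density_extend:
  assumes r: "1 < r" "r < (3 :: real)"
  shows "\<exists>h>0. \<exists>L\<ge>0. \<exists>n0. \<forall>s N M g G n. 0 < s \<longrightarrow> s \<le> 1 \<longrightarrow> N \<ge> n0 \<longrightarrow> M \<ge> 1 \<longrightarrow>
    \<bar>real M - r * real N\<bar> \<le> h * s * real N \<longrightarrow> exp (g * real N) \<le> conn_density N M \<longrightarrow> \<bar>g\<bar> \<le> G \<longrightarrow> 2 * real N \<le> s * real n \<longrightarrow>
    exp ((g - 2 * s * (G + L)) * real n) \<le> conn_density n (Suc (nat \<lfloor>r * real n\<rfloor>))"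
proof -
  obtain h L n0 where h: "h > 0" "h \<le> 1" "L \<ge> 0" "n0 \<ge> 124"
    and F: "\<And>n M. n \<ge> n0 \<Longrightarrow> \<bar>real M - r * real n\<bar> \<le> 2 * h * real n \<Longrightarrow> exp (- (L * real n)) \<le> conn_density n M \<and> M \<ge> 1"
    using conn_density_filler[OF r] by blast
  define n1 where "n1 = max n0 (nat \<lceil>1 / h\<rceil>)"
  have "exp ((g - 2 * s * (G + L)) * real n) \<le> conn_density n (Suc (nat \<lfloor>r * real n\<rfloor>))"
    if s: "0 < s" "s \<le> 1" and N: "N \<ge> n1" and M: "M \<ge> 1" "\<bar>real M - r * real N\<bar> \<le> h * s * real N"
      and g: "exp (g * real N) \<le> conn_density N M" "\<bar>g\<bar> \<le> G" and n: "2 * real N \<le> s * real n" for s g G :: real and N M n :: nat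
  proof -
    have N124: "N \<ge> 124" "N \<ge> n0" using N h(4) unfolding n1_def by auto
    have "1 / h \<le> real N" using N unfolding n1_def by linarith
    then have hN: "1 \<le> h * real N" using h by (simp add: field_simps)
    have N0: "real N > 0" using N124 by simp
    \<comment> \<open>Each copy of \<open>N\<close> vertices comes with a reserve of
      \<open>s N\<close> vertices for the filler. The edge error is at most \<open>h s N\<close> per
      copy, hence at most \<open>h f\<close> in all, where \<open>f\<close> is the size of the
      filler.\<close>
    define D where "D = real N * (1 + s)"
    have D0: "D > 0" unfolding D_def using N0 s by simp
    define x where "x = nat \<lfloor>real n / D\<rfloor>"
    have sn: "s * real n \<le> real n" using s by (simp add: mult_left_le_one_le)
    have "D \<le> 2 * real N" unfolding D_def using s N0 by simp
    then have "D \<le> real n" using n sn by linarith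
    then have y1: "1 \<le> real n / D" using D0 by simp
    then have x1: "x \<ge> 1" unfolding x_def by linarith
    have xy: "real x \<le> real n / D" "real n / D - 1 \<le> real x" unfolding x_def using y1 by linarith+
    have xD: "real x * D \<le> real n" "real n - D \<le> real x * D" using xy D0 by (simp_all add: field_simps)
    define z where "z = real x * real N"
    have z0: "z \<ge> 0" unfolding z_def by simp
    have zD: "z + s * z \<le> real n" "real n - real N - s * real N \<le> z + s * z"
      using xD unfolding D_def z_def by (simp_all add: algebra_simps)
    have sz: "s * z \<ge> 0" using s z0 by simp
    have "real (x * N) \<le> real n" using zD(1) sz unfolding z_def by simp
    then have xN: "x * N \<le> n" by linarith
    define f where "f = n - x * N"
    have fz: "real f = real n - z" unfolding f_def z_def using xN by (simp add: of_nat_diff)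
    have f1: "s * z \<le> real f" using zD fz by linarith
    have sf: "s * real f = s * real n - s * z" unfolding fz by (simp add: algebra_simps)
    have sfle: "s * real f \<le> real f" using s by (simp add: mult_left_le_one_le)
    have f2: "real N \<le> real f" using sf sfle n f1 zD(1) fz by linarith
    \<comment> \<open>The filler is small, so its exponential loss lowers the growth rate only by
      order \<open>s\<close>.\<close>
    have f3: "real f \<le> 2 * s * real n"
    proof -
      have "(1 + s) * real f \<le> (1 + s) * (s * real n + real N)"
      proof -
        have "(1 + s) * real f = real f + s * real f" by (simp add: algebra_simps)
        also have "\<dots> \<le> s * real n + real N + s * real N" using sf fz zD(2) by linarith
        also have "\<dots> \<le> s * real n + real N + s * real N + s * (s * real n)" using s by simp
        also have "\<dots> = (1 + s) * (s * real n + real N)" by (simp add: algebra_simps)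
        finally show ?thesis .
      qed
      then have "real f \<le> s * real n + real N" using s by (simp add: mult_le_cancel_left)
      then show ?thesis using n by linarith
    qed
    define T where "T = Suc (nat \<lfloor>r * real n\<rfloor>)"
    have rn: "0 \<le> r * real n" using r by simp
    have T: "r * real n \<le> real T" "real T \<le> r * real n + 1" unfolding T_def using rn by linarith+
    \<comment> \<open>The surplus of edges in the copies compared with slope \<open>r\<close>; the
      filler receives the remaining \<open>K\<close>.\<close>
    define dd where "dd = real x * (real M - r * real N)"
    have ddb: "\<bar>dd\<bar> \<le> h * (s * z)"
    proof -
      have "\<bar>dd\<bar> = real x * \<bar>real M - r * real N\<bar>" unfolding dd_def by (simp add: abs_mult)
      also have "\<dots> \<le> real x * (h * s * real N)" using M(2) by (intro mult_left_mono) auto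
      also have "\<dots> = h * (s * z)" unfolding z_def by simp
      finally show ?thesis .
    qed
    have hf: "h * (s * z) \<le> h * real f" using f1 h by (intro mult_left_mono) auto
    have hNf: "h * real N \<le> h * real f" using f2 h by (intro mult_left_mono) auto
    have xM: "real x * real M = r * z + dd" unfolding dd_def z_def by (simp add: algebra_simps)
    have rf: "r * real f = r * real n - r * z" unfolding fz by (simp add: algebra_simps)
    have "h * real f \<le> r * real f" using h r by (intro mult_right_mono) auto
    then have "real (x * M) \<le> real T" using xM rf T ddb hf by simp
    then have xMT: "x * M \<le> T" by linarith
    define K where "K = T - x * M"
    have K: "real K = real T - (r * z + dd)" unfolding K_def using xMT xM by (simp add: of_nat_diff)
    have "\<bar>real K - r * real f\<bar> \<le> 1 + \<bar>dd\<bar>" unfolding K rf using T by linarith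
    then have "\<bar>real K - r * real f\<bar> \<le> 2 * h * real f" using ddb hf hNf hN by linarith
    moreover have fn0: "f \<ge> n0" using f2 N124 by linarith
    ultimately have fil: "exp (- (L * real f)) \<le> conn_density f K" "K \<ge> 1" using F by auto
    have "exp (g * z) = exp (g * real N) ^ x" unfolding z_def by (simp add: exp_of_nat_mult[symmetric] mult_ac)
    also have "\<dots> \<le> conn_density N M ^ x" using g(1) by (intro power_mono) auto
    also have "\<dots> \<le> conn_density (x * N) (x * M)" by (rule conn_density_power[OF N124(1) M(1) x1])
    finally have cp: "exp (g * z) \<le> conn_density (x * N) (x * M)" .
    have "124 \<le> x * N" using N124(1) x1 by (metis le_trans mult_le_mono nat_mult_1)
    moreover have "124 \<le> f" using fn0 h(4) by simp
    moreover have "1 \<le> x * M" using x1 M(1) by simp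
    ultimately have "conn_density (x * N) (x * M) * conn_density f K \<le> conn_density (x * N + f) (x * M + K)"
      using fil(2) by (intro conn_density_superadditive) auto
    moreover have "x * N + f = n" "x * M + K = T" unfolding f_def K_def using xN xMT by auto
    ultimately have "conn_density (x * N) (x * M) * conn_density f K \<le> conn_density n T" by simp
    moreover have "exp (g * z) * exp (- (L * real f)) \<le> conn_density (x * N) (x * M) * conn_density f K"
      using cp fil(1) conn_density_nonneg by (intro mult_mono) auto
    ultimately have fin: "exp (g * z - L * real f) \<le> conn_density n T" by (simp add: exp_diff exp_minus divide_inverse)
    have "g * real f \<le> G * real f" using g(2) by (intro mult_right_mono) auto
    moreover have "(G + L) * real f \<le> (G + L) * (2 * s * real n)" using f3 g(2) h(3) by (intro mult_left_mono) auto
    moreover have "g * z = g * real n - g * real f" unfolding fz by (simp add: algebra_simps)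
    ultimately have "(g - 2 * s * (G + L)) * real n \<le> g * z - L * real f" by (simp add: algebra_simps)
    then show ?thesis using fin unfolding T_def by (meson exp_le_cancel_iff order_trans)
  qed
  then show ?thesis using h by blast
qed

text \<open>If at least half of the graphs had few coins, then attaching \<open>k\<close> coins to them would
  raise the growth rate by a factor \<open>(1 / (12 d)) ^ k\<close>, a definite amount that by superadditivity survives at all
  larger \<open>n\<close>; since growth rates are bounded, this can happen only finitely often.\<close>

lemma few_bearing_rare:
  assumes r: "1 < r" "r < (3 :: real)"
  shows "\<exists>d>0. \<exists>n0. \<forall>n\<ge>n0. 2 * card (few {1..n} (nat \<lfloor>r * real n\<rfloor>) (nat \<lfloor>d * real n\<rfloor>)) < card (pgm {1..n} (nat \<lfloor>r * real n\<rfloor>))"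
proof -
  obtain c where c: "c \<ge> 0" "\<And>n m. planar_density n m \<le> exp (c * real n)" using planar_density_upper_bound by blast
  obtain L0 n1 where L0: "L0 \<ge> 0" "\<And>n. n \<ge> n1 \<Longrightarrow> exp (- (L0 * real n)) \<le> conn_density n (Suc (nat \<lfloor>r * real n\<rfloor>))"
    using conn_density_lower[OF r] by blast
  obtain h L n2 where h: "h > 0" "L \<ge> 0" and ext: "\<And>s N M g G n. 0 < s \<Longrightarrow> s \<le> 1 \<Longrightarrow> N \<ge> n2 \<Longrightarrow> M \<ge> 1 \<Longrightarrow>
      \<bar>real M - r * real N\<bar> \<le> h * s * real N \<Longrightarrow> exp (g * real N) \<le> conn_density N M \<Longrightarrow> \<bar>g\<bar> \<le> G \<Longrightarrow> 2 * real N \<le> s * real n \<Longrightarrow>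
      exp ((g - 2 * s * (G + L)) * real n) \<le> conn_density n (Suc (nat \<lfloor>r * real n\<rfloor>))"
    using conn_density_extend[OF r] by blast
  define G0 where "G0 = c + L0"
  define G where "G = 4 * G0 + 3"
  have G0: "G0 \<ge> 0" unfolding G0_def using c L0 by simp
  have GL: "G + L \<ge> 0" unfolding G_def using G0 h by simp
  \<comment> \<open>Losses and gain are all proportional to \<open>d\<close>. The gain from the
    coins is at least \<open>d l / 4\<close> with \<open>l = ln (1 / (12 d))\<close>, which grows
    without bound as \<open>d\<close> shrinks. From \<open>l0\<close> on it covers the loss
    \<open>(3 G0 + 2) d\<close> on the way to a connected graph, the loss
    \<open>14 d (G + L) / h\<close> of the extension, and a net gain of \<open>d\<close>.\<close>
  define l0 where "l0 = 4 * (3 * G0 + 3 + 14 * (G + L) / h)"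
  \<comment> \<open>The first bound ensures \<open>l \<ge> l0\<close>, the second ensures
    \<open>s \<le> 1\<close>.\<close>
  define d where "d = min (exp (- l0) / 12) (h / 7)"
  have l0: "l0 \<ge> 0" unfolding l0_def using G0 GL h by simp
  have "exp (- l0) \<le> 1" using l0 by simp
  moreover have "d > 0" "d \<le> exp (- l0) / 12" "d \<le> h / 7" unfolding d_def using h by (auto simp: min_def)
  ultimately have d: "d > 0" "d \<le> 1 / 12" "d \<le> exp (- l0) / 12" "d \<le> h / 7" by linarith+
  \<comment> \<open>The gain per coin: for \<open>k \<le> d n \<le> n / 12\<close> the ratio
    \<open>(n - k) / (6 k)\<close> is at least \<open>1 / (12 d)\<close>.\<close>
  define A where "A = 1 / (12 * d)"
  define l where "l = ln A"
  have A0: "A > 0" unfolding A_def using d by simp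
  have expl: "exp l = A" unfolding l_def using A0 by simp
  have "exp l0 \<le> A"
  proof -
    have "12 * d \<le> exp (- l0)" using d(3) by simp
    then have "12 * d * exp l0 \<le> exp (- l0) * exp l0" by (intro mult_right_mono) auto
    then have "12 * d * exp l0 \<le> 1" by (simp add: exp_minus)
    then show ?thesis unfolding A_def using d(1) by (simp add: field_simps)
  qed
  then have ll: "l0 \<le> l" using expl by (metis exp_le_cancel_iff)
  have l_ge: "l \<ge> 0" using ll l0 by simp
  have "l \<le> A" unfolding l_def using ln_le_minus_one[OF A0] by simp
  then have "d * l \<le> d * A" using d by (intro mult_left_mono) auto
  also have "\<dots> = 1 / 12" unfolding A_def using d(1) by simp
  finally have dl: "d * l \<le> 1" by simp
  \<comment> \<open>After attaching and connecting, the number of edges is off by at most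
    \<open>7 d\<close> per vertex, and \<open>conn_density_extend\<close> tolerates
    \<open>h s\<close>.\<close>
  define s where "s = 7 * d / h"
  have s: "s > 0" "s \<le> 1" "h * s = 7 * d" unfolding s_def using d h by (simp_all add: field_simps)
  obtain N0 where N0: "\<And>N m. N \<ge> N0 \<Longrightarrow> exp (- ((G0 + 1) * real N)) \<le> planar_density N m \<Longrightarrow>
      \<exists>q. real q \<le> d * real N \<and> planar_density N m * exp (- (d * real N)) \<le> conn_density N (m + q + 1)"
    using connect_density[OF d(1), of "G0 + 1"] G0 by (metis add_nonneg_nonneg zero_le_one)
  define m where "m n = nat \<lfloor>r * real n\<rfloor>" for n :: nat
  define \<beta> where "\<beta> n = ln (planar_density n (m n)) / real n" for n
  have bd: "exp (\<beta> n * real n) = planar_density n (m n) \<and> \<bar>\<beta> n\<bar> \<le> G0" if n: "n \<ge> max 1 n1" for n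
  proof -
    have low: "exp (- (L0 * real n)) \<le> planar_density n (m n)"
      using L0(2)[of n] conn_density_le_pden[of n "m n"] n unfolding m_def by simp
    then have pos: "planar_density n (m n) > 0" by (meson exp_gt_zero less_le_trans)
    have e: "exp (\<beta> n * real n) = planar_density n (m n)" unfolding \<beta>_def using n pos by simp
    have "exp (- (L0 * real n)) \<le> exp (\<beta> n * real n)" "exp (\<beta> n * real n) \<le> exp (c * real n)"
      unfolding e using low c(2) by auto
    then have "(- L0) * real n \<le> \<beta> n * real n" "\<beta> n * real n \<le> c * real n" by simp_all
    moreover have "real n > 0" using n by simp
    ultimately have "- L0 \<le> \<beta> n" "\<beta> n \<le> c" using mult_right_le_imp_le by blast+
    then show ?thesis using e unfolding G0_def using c L0 by simp
  qed
  define n3 where "n3 = max (max 1 n1) (max (max n2 N0) (nat \<lceil>2 / d\<rceil>))"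
  \<comment> \<open>A bad \<open>n\<close> raises the rate at every sufficiently larger
    \<open>n'\<close> by the fixed amount \<open>d\<close>. The ratio of sizes comes from the
    extension, which needs \<open>2 N \<le> s n'\<close> for \<open>N \<le> 2 n\<close>.\<close>
  have gain: "\<beta> n + d \<le> \<beta> n'"
    if n: "n \<ge> n3" and bad: "card (pgm {1..n} (m n)) \<le> 2 * card (few {1..n} (m n) (nat \<lfloor>d * real n\<rfloor>))"
      and n': "n' \<ge> n3" "4 * real n \<le> s * real n'" for n n'
  proof -
    have n1: "n \<ge> max 1 n1" "n \<ge> n2" "n \<ge> N0" using n unfolding n3_def by auto
    have "2 / d \<le> real n" using n unfolding n3_def by linarith
    then have dn: "2 \<le> d * real n" using d by (simp add: field_simps)
    define k where "k = nat \<lfloor>d * real n\<rfloor>"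
    have k: "real k \<le> d * real n" "d * real n / 2 \<le> real k" "k \<ge> 1" unfolding k_def using dn by linarith+
    have "d * real n \<le> 1 / 12 * real n" using d by (intro mult_right_mono) auto
    then have k12: "12 * real k \<le> real n" using k by simp
    then have kn: "k \<le> n" by linarith
    define N where "N = n + 3 * k"
    have Nr: "real N = real n + 3 * real k" unfolding N_def by simp
    have N2: "real N \<le> 2 * real n" "real n \<le> real N" using Nr k12 by linarith+
    have dN: "d * real n \<le> d * real N" "d * real N \<le> 2 * (d * real n)"
      using d N2 mult_left_mono[of "real N" "2 * real n" d] by (simp_all add: mult_left_mono)
    have A: "A \<le> real (n - k) / (6 * real k)"
    proof -
      define u where "u = real (n - k)"
      have "real n \<le> 2 * u" unfolding u_def using kn k12 by (simp add: of_nat_diff)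
      then have "d * real n \<le> d * (2 * u)" using d by (intro mult_left_mono) auto
      then have "6 * real k \<le> 12 * (d * u)" using k(1) by simp
      then show ?thesis unfolding A_def u_def[symmetric] using d k by (simp add: field_simps)
    qed
    have \<beta>: "exp (\<beta> n * real n) = planar_density n (m n)" "\<bar>\<beta> n\<bar> \<le> G0" using bd[OF n1(1)] by auto
    have "real (card (pgm {1..n} (m n))) \<le> real (2 * card (few {1..n} (m n) k))"
      using bad of_nat_mono unfolding k_def by blast
    then have few: "planar_density n (m n) \<le> 2 * (real (card (few {1..n} (m n) k)) / fact n)"
      unfolding planar_density_def by (simp add: field_simps)
    define F where "F = real (card (few {1..n} (m n) k)) / fact n"
    have F: "exp (\<beta> n * real n) / 2 \<le> F" using few[folded F_def] unfolding \<beta>(1) by simp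
    have "exp 1 \<ge> (2 :: real)" using exp_ge_add_one_self[of "1 :: real"] by simp
    then have e1: "exp (- 1) \<le> (1 / 2 :: real)" by (simp add: exp_minus field_simps)
    \<comment> \<open>A lower bound for the logarithm of the density after attaching
      \<open>k\<close> coins; the 1 pays for the graphs that have many coins already, at most half
      of all.\<close>
    define w where "w = \<beta> n * real n + real k * l - 1"
    have "exp w = exp (\<beta> n * real n) * exp (- 1) * A ^ k"
    proof -
      have "A ^ k = exp (real k * l)" unfolding expl[symmetric] by (simp add: exp_of_nat_mult)
      then show ?thesis unfolding w_def by (simp add: exp_add[symmetric])
    qed
    also have "\<dots> \<le> exp (\<beta> n * real n) * (1 / 2) * A ^ k"
      using e1 A0 by (intro mult_right_mono mult_left_mono) auto
    also have "\<dots> \<le> F * (real (n - k) / (6 * real k)) ^ k"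
      by (intro mult_mono power_mono A) (use F A0 in \<open>simp_all add: F_def\<close>)
    also have "\<dots> \<le> real (card (few {1..N} (m n + 4 * k) (k + 2 * k))) / fact N"
      unfolding F_def N_def by (rule attach_coins[OF k(3) kn order_refl])
    also have "\<dots> \<le> planar_density N (m n + 4 * k)"
    proof -
      have "card (few {1..N} (m n + 4 * k) (k + 2 * k)) \<le> card (pgm {1..N} (m n + 4 * k))"
        by (intro card_mono finite_pgm) (auto simp: few_def)
      then show ?thesis unfolding planar_density_def by (simp add: divide_right_mono)
    qed
    finally have w: "exp w \<le> planar_density N (m n + 4 * k)" .
    have kl: "0 \<le> real k * l" using l_ge by simp
    have "- (G0 * real n) \<le> \<beta> n * real n"
      using \<beta>(2) mult_right_mono[of "- G0" "\<beta> n" "real n"] by simp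
    moreover have "G0 * real n \<le> G0 * real N" using G0 N2 by (intro mult_left_mono) auto
    moreover have "1 \<le> real N" using n1(1) N2 by simp
    ultimately have "- ((G0 + 1) * real N) \<le> w" unfolding w_def using kl by (simp add: algebra_simps)
    then have "exp (- ((G0 + 1) * real N)) \<le> planar_density N (m n + 4 * k)" using w by (meson exp_le_cancel_iff order_trans)
    moreover have "N \<ge> N0" "N \<ge> n2" using n1 unfolding N_def by auto
    ultimately obtain q where q: "real q \<le> d * real N"
        "planar_density N (m n + 4 * k) * exp (- (d * real N)) \<le> conn_density N (m n + 4 * k + q + 1)" using N0 by blast
    define M where "M = m n + 4 * k + q + 1"
    have "exp (w - d * real N) \<le> planar_density N (m n + 4 * k) * exp (- (d * real N))"
      using w by (simp add: exp_diff exp_minus divide_inverse mult_right_mono)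
    then have crM: "exp (w - d * real N) \<le> conn_density N M" using q(2) unfolding M_def by linarith
    \<comment> \<open>The rate relative to the new size \<open>N = n + 3 k\<close>: changing the
      size costs \<open>3 G0 d\<close>, connecting costs \<open>d\<close>, the 1 in \<open>w\<close>
      costs at most another \<open>d\<close>, and \<open>k\<close> is at least
      \<open>d N / 4\<close>.\<close>
    define g where "g = \<beta> n + d * l / 4 - (3 * G0 + 2) * d"
    have gN: "g * real N \<le> w - d * real N"
    proof -
      have "\<beta> n * (3 * real k) \<le> G0 * (3 * real k)" using \<beta>(2) by (intro mult_right_mono) auto
      also have "\<dots> \<le> G0 * (3 * (d * real N))" using G0 k dN by (intro mult_left_mono) auto
      finally have "\<beta> n * real N \<le> \<beta> n * real n + 3 * G0 * d * real N" unfolding Nr by (simp add: algebra_simps)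
      moreover have "d * l / 4 * real N \<le> real k * l"
      proof -
        have "d * real N / 4 \<le> real k" using dN k by simp
        then have "d * real N / 4 * l \<le> real k * l" using l_ge by (intro mult_right_mono) auto
        then show ?thesis by (simp add: mult_ac)
      qed
      moreover have "2 \<le> d * real N" using dn dN by simp
      moreover have "g * real N = \<beta> n * real N + d * l / 4 * real N - 3 * G0 * d * real N - 2 * (d * real N)"
        unfolding g_def by (simp add: algebra_simps)
      ultimately show ?thesis unfolding w_def by linarith
    qed
    then have g1: "exp (g * real N) \<le> conn_density N M" using crM by (meson exp_le_cancel_iff order_trans)
    have g2: "\<bar>g\<bar> \<le> G"
    proof -
      define u v where "u = d * l" and "v = (3 * G0 + 2) * d"
      have "0 \<le> u" "u \<le> 1" unfolding u_def using d l_ge dl by simp_all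
      moreover have "v \<le> (3 * G0 + 2) * 1" unfolding v_def using G0 d by (intro mult_left_mono) auto
      moreover have "0 \<le> v" unfolding v_def using G0 d by simp
      moreover have "\<beta> n \<le> G0" "- \<beta> n \<le> G0" using \<beta>(2) unfolding abs_le_iff by blast+
      ultimately have "\<beta> n + u / 4 - v \<le> 4 * G0 + 3" "- (\<beta> n + u / 4 - v) \<le> 4 * G0 + 3" by argo+
      then show ?thesis unfolding g_def G_def u_def[symmetric] v_def[symmetric] abs_le_iff by blast
    qed
    \<comment> \<open>The coins add \<open>4 k\<close> edges on \<open>3 k\<close> vertices, an
      error of at most \<open>5 k\<close> because \<open>r\<close> is between 1 and 3; linking and
      rounding add \<open>q + 2\<close>. With \<open>k\<close>, \<open>q\<close> and 2 each at most
      \<open>d N\<close> the sum is at most \<open>7 d N\<close>.\<close>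
    have g3: "\<bar>real M - r * real N\<bar> \<le> h * s * real N"
    proof -
      have "0 \<le> r * real n" using r by simp
      then have mn: "real (m n) \<le> r * real n" "r * real n - 1 \<le> real (m n)" unfolding m_def by linarith+
      have rk: "r * (3 * real k) \<le> 3 * (3 * real k)" "1 * (3 * real k) \<le> r * (3 * real k)"
        using r by (intro mult_right_mono; simp)+
      have rN: "r * real N = r * real n + r * (3 * real k)" unfolding Nr by (simp add: algebra_simps)
      have "real M = real (m n) + 4 * real k + real q + 1" unfolding M_def by simp
      then have "\<bar>real M - r * real N\<bar> \<le> 5 * real k + real q + 2" using rN rk mn by linarith
      also have "\<dots> \<le> 7 * (d * real N)" using k q dN dn by linarith
      finally show ?thesis unfolding s(3) by simp
    qed
    have "2 * real N \<le> s * real n'" using n'(2) N2 by linarith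
    then have "exp ((g - 2 * s * (G + L)) * real n') \<le> conn_density n' (Suc (m n'))"
      using ext[OF s(1,2) \<open>N \<ge> n2\<close> _ g3 g1 g2] unfolding m_def M_def by simp
    also have "\<dots> \<le> planar_density n' (m n')" by (rule conn_density_le_pden)
    also have "\<dots> = exp (\<beta> n' * real n')" using bd[of n'] n'(1) unfolding n3_def by simp
    finally have "(g - 2 * s * (G + L)) * real n' \<le> \<beta> n' * real n'" by simp
    moreover have "real n' > 0" using n'(1) unfolding n3_def by simp
    ultimately have "g - 2 * s * (G + L) \<le> \<beta> n'" by (simp add: mult_le_cancel_right)
    moreover have "g - 2 * s * (G + L) = \<beta> n + d * (l / 4 - (3 * G0 + 2) - 14 * (G + L) / h)"
      unfolding g_def s_def using h by (simp add: field_simps)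
    moreover have "d * 1 \<le> d * (l / 4 - (3 * G0 + 2) - 14 * (G + L) / h)"
    proof (rule mult_left_mono)
      show "1 \<le> l / 4 - (3 * G0 + 2) - 14 * (G + L) / h" using ll unfolding l0_def by argo
    qed (use d in simp)
    ultimately show ?thesis by linarith
  qed
  \<comment> \<open>If the set \<open>S\<close> of bad sizes were unbounded, some bad size would
    have a rate within \<open>d\<close> of the supremum over \<open>S\<close>, and a much larger bad
    size would exceed the supremum.\<close>
  define S where "S = {n. n \<ge> n3 \<and> card (pgm {1..n} (m n)) \<le> 2 * card (few {1..n} (m n) (nat \<lfloor>d * real n\<rfloor>))}"
  have "\<exists>n0. \<forall>n\<ge>n0. 2 * card (few {1..n} (m n) (nat \<lfloor>d * real n\<rfloor>)) < card (pgm {1..n} (m n))"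
  proof (rule ccontr)
    assume c: "\<not> ?thesis"
    have inf: "\<exists>n\<ge>k. n \<in> S" for k
    proof -
      obtain n where "n \<ge> max k n3" "\<not> 2 * card (few {1..n} (m n) (nat \<lfloor>d * real n\<rfloor>)) < card (pgm {1..n} (m n))"
        using c by blast
      then show ?thesis unfolding S_def by (intro exI[of _ n]) auto
    qed
    have ne: "\<beta> ` S \<noteq> {}" using inf by blast
    have bdd: "bdd_above (\<beta> ` S)"
    proof (rule bdd_aboveI[of _ G0])
      fix y assume "y \<in> \<beta> ` S"
      then obtain n where "n \<ge> n3" "y = \<beta> n" unfolding S_def by blast
      then show "y \<le> G0" using bd[of n] unfolding n3_def by auto
    qed
    have "Sup (\<beta> ` S) - d < Sup (\<beta> ` S)" using d by simp
    then obtain y where "y \<in> \<beta> ` S" "Sup (\<beta> ` S) - d < y" using less_cSup_iff[OF ne bdd] by blast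
    then obtain n where n: "n \<in> S" "Sup (\<beta> ` S) - d < \<beta> n" by blast
    obtain n' where n': "n' \<ge> nat \<lceil>4 * real n / s\<rceil>" "n' \<in> S" using inf by blast
    have "4 * real n / s \<le> real n'" using n'(1) by linarith
    then have "4 * real n \<le> s * real n'" using s by (simp add: field_simps)
    then have "\<beta> n + d \<le> \<beta> n'" using gain n(1) n'(2) unfolding S_def by blast
    moreover have "\<beta> n' \<le> Sup (\<beta> ` S)" using n'(2) bdd by (intro cSup_upper) auto
    ultimately show False using n(2) by linarith
  qed
  then show ?thesis using d(1) unfolding m_def by blast
qed

section \<open>The switch applied to the distribution of the maximum degree\<close>

text \<open>Choosing one vertex of maximum degree for each graph turns it into switching data from
  which no coin has been removed.\<close>

lemma switch_data_zero:
  assumes n: "n \<ge> 1"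
  shows "card {E \<in> pgm {1..n} m. max_degree {1..n} E = d \<and> B \<le> card (bearing E)} \<le> card (switch_data n m d B 0)"
proof -
  define A where "A = {E \<in> pgm {1..n} m. max_degree {1..n} E = d \<and> B \<le> card (bearing E)}"
  have "\<exists>v. ([], E, v) \<in> switch_data n m d B 0" if "E \<in> A" for E
  proof -
    have E: "simple_graph {1..n} E" "planar {1..n} E" "card E = m" "max_degree {1..n} E = d" "B \<le> card (bearing E)"
      using that unfolding A_def pgm_def by auto
    have vd: "vertex_degree E v = card (nb E v)" for v by (rule vertex_degree_nb[OF E(1)])
    define D where "D = vertex_degree E ` {1..n}"
    have D: "finite D" "D \<noteq> {}" "Max D = d" using n E(4) unfolding D_def max_degree_def by auto
    obtain v where v: "v \<in> {1..n}" "vertex_degree E v = d" using Max_in[OF D(1,2)] unfolding D(3) unfolding D_def by auto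
    have "vertex_degree E u \<le> d" if "u \<in> {1..n}" for u using Max_ge[OF D(1)] D(3) that unfolding D_def by blast
    then have "([], E, v) \<in> switch_data n m d B 0" unfolding switch_data_def using E v vd by simp
    then show ?thesis by blast
  qed
  then obtain f where f: "\<And>E. E \<in> A \<Longrightarrow> ([], E, f E) \<in> switch_data n m d B 0" by metis
  show ?thesis unfolding A_def[symmetric]
  proof (rule card_inj_on_le[where f = "\<lambda>E. ([], E, f E)"])
    show "inj_on (\<lambda>E. ([], E, f E)) A" by (rule inj_onI) simp
  qed (use f finite_sw in auto)
qed

text \<open>Each of the \<open>b\<close> removals costs a factor \<open>n / (B - (2 j + 2))\<close>,
  which is at most \<open>1 / t\<close> by the assumption on \<open>B\<close>; the 2 is the reading
  direction in \<open>switch_data_final\<close>.\<close>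

lemma shift_max_degree:
  assumes n: "n \<ge> 1" and b: "b \<ge> 4" and t: "t \<ge> 0" "t * real n + 2 * real b \<le> real B"
  shows "real (card {E \<in> pgm {1..n} m. max_degree {1..n} E = d \<and> B \<le> card (bearing E)}) * t ^ b
    \<le> 2 * real (card {E \<in> pgm {1..n} m. max_degree {1..n} E \<in> {d + b, d + b + 1}})"
proof -
  have it: "real (card (switch_data n m d B 0)) * t ^ j \<le> real (card (switch_data n m d B j))" if "j \<le> b" for j
    using that
  proof (induction j)
    case (Suc j)
    have "real (card (switch_data n m d B j) * (B - (2 * j + 2))) \<le> real (card (switch_data n m d B (Suc j)) * n)"
      using switch_data_step of_nat_mono by blast
    moreover have "t * real n \<le> real (B - (2 * j + 2))"
    proof -
      have "0 \<le> t * real n" using t by simp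
      then have "2 * b \<le> B" using t(2) by linarith
      then show ?thesis using Suc.prems t(2) by (simp add: of_nat_diff)
    qed
    then have "real (card (switch_data n m d B j)) * (t * real n) \<le> real (card (switch_data n m d B j)) * real (B - (2 * j + 2))"
      by (intro mult_left_mono) auto
    ultimately have "(real (card (switch_data n m d B j)) * t) * real n \<le> real (card (switch_data n m d B (Suc j))) * real n"
      by (simp only: of_nat_mult mult.assoc)
    then have 1: "real (card (switch_data n m d B j)) * t \<le> real (card (switch_data n m d B (Suc j)))"
      using n by (simp add: mult_le_cancel_right)
    have "real (card (switch_data n m d B 0)) * t ^ Suc j = (real (card (switch_data n m d B 0)) * t ^ j) * t" by simp
    also have "\<dots> \<le> real (card (switch_data n m d B j)) * t" using Suc t by (intro mult_right_mono) auto
    finally show ?case using 1 by linarith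
  qed simp
  have "real (card {E \<in> pgm {1..n} m. max_degree {1..n} E = d \<and> B \<le> card (bearing E)}) * t ^ b
      \<le> real (card (switch_data n m d B 0)) * t ^ b"
    using switch_data_zero[OF n, of m d B] t(1) by (intro mult_right_mono of_nat_mono) auto
  also have "\<dots> \<le> real (card (switch_data n m d B b))" by (rule it) simp
  also have "\<dots> \<le> real (2 * card {E \<in> pgm {1..n} m. max_degree {1..n} E \<in> {d + b, d + b + 1}})"
    by (rule of_nat_mono[OF switch_data_final[OF b]])
  finally show ?thesis by simp
qed

lemma prob_random_planar_graph:
  assumes "pgm {1..n} m \<noteq> {}"
  shows "measure_pmf.prob (random_planar_graph n m) {E. max_degree {1..n} E \<in> I}
    = real (card {E \<in> pgm {1..n} m. max_degree {1..n} E \<in> I}) / real (card (pgm {1..n} m))"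
proof -
  have "planar_graphs n m = pgm {1..n} m" unfolding planar_graphs_def pgm_def ..
  then show ?thesis unfolding random_planar_graph_def using assms finite_pgm[of "{1..n}" m]
    by (simp add: measure_pmf_of_set Int_def)
qed

theorem theorem1p10:
  fixes r :: real and m :: "nat \<Rightarrow> nat" and I :: "nat \<Rightarrow> nat set"
  assumes "1 < r" and "r < 3"
    and "\<And>n. m n = nat \<lfloor>r * real n\<rfloor>"
    and "\<And>n. I n \<subseteq> {1..n}"
    and "(\<lambda>n. measure_pmf.prob (random_planar_graph n (m n)) {E. max_degree {1..n} E \<in> I n})
           \<longlonglongrightarrow> 1"
  shows "filterlim (\<lambda>n. card (I n)) at_top sequentially"
proof (rule ccontr)
  assume "\<not> ?thesis"
  then obtain Z where "\<not> (\<forall>\<^sub>F n in sequentially. Z \<le> card (I n))" unfolding filterlim_at_top by blast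
  then have freq: "\<exists>n\<ge>k. card (I n) < Z" for k unfolding eventually_sequentially by (meson not_le)
  have Z: "Z > 0" using freq[of 0] by auto
  obtain \<delta> n0 where \<delta>: "\<delta> > 0"
    and rare: "\<And>n. n \<ge> n0 \<Longrightarrow> 2 * card (few {1..n} (m n) (nat \<lfloor>\<delta> * real n\<rfloor>)) < card (pgm {1..n} (m n))"
    using few_bearing_rare[OF assms(1,2)] unfolding assms(3) by blast
  define t where "t = min (\<delta> / 2) 1"
  have t: "t > 0" "t \<le> 1" "t \<le> \<delta> / 2" unfolding t_def using \<delta> by auto
  \<comment> \<open>Some degree in \<open>I n\<close> is the maximum degree, together with many
    coins, in a fraction \<open>1 / (4 Z)\<close> of the graphs. A shift by
    \<open>b \<le> 2 Z + 4\<close> keeps at least \<open>t ^ (2 Z + 4) / 2\<close> of it.\<close>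
  define c where "c = t ^ (2 * Z + 4) / (8 * real Z)"
  have c: "c > 0" unfolding c_def using t Z by simp
  \<comment> \<open>Graphs with few coins make up less than a half and degrees outside
    \<open>I n\<close> at most a quarter, which leaves a quarter to fewer than \<open>Z\<close>
    degrees. Being below \<open>c\<close> prevents a shifted pair of degrees from missing
    \<open>I n\<close>.\<close>
  define \<epsilon> where "\<epsilon> = min (1 / 4) (c / 2)"
  have \<epsilon>: "\<epsilon> > 0" "\<epsilon> \<le> 1 / 4" "\<epsilon> < c" unfolding \<epsilon>_def using c by auto
  obtain n1 where n1: "\<And>n. n \<ge> n1 \<Longrightarrow>
      1 - \<epsilon> < measure_pmf.prob (random_planar_graph n (m n)) {E. max_degree {1..n} E \<in> I n}"
    using order_tendstoD(1)[OF assms(5), of "1 - \<epsilon>"] \<epsilon> unfolding eventually_sequentially by auto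
  obtain n where n: "n \<ge> max (max 1 n0) (max n1 (nat \<lceil>(8 * real Z + 16) / \<delta>\<rceil>))" "card (I n) < Z" using freq by blast
  define X where "X = pgm {1..n} (m n)"
  define P where "P = real (card X)"
  define k where "k = nat \<lfloor>\<delta> * real n\<rfloor>"
  define md where "md E = max_degree {1..n} E" for E :: "nat set set"
  have finX: "finite X" unfolding X_def by (simp add: finite_pgm)
  have finI: "finite (I n)" using assms(4) finite_subset by blast
  have few: "2 * card (few {1..n} (m n) k) < card X" using rare[of n] n(1) unfolding X_def k_def by simp
  then have P: "P > 0" unfolding P_def by simp
  then have Xne: "X \<noteq> {}" unfolding P_def by auto
  have out: "real (card {E \<in> X. md E \<notin> I n}) < \<epsilon> * P"
  proof -
    have "1 - \<epsilon> < real (card {E \<in> X. md E \<in> I n}) / P"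
      using n1[of n] n(1) prob_random_planar_graph[OF Xne[unfolded X_def]] unfolding P_def X_def md_def by simp
    then have 1: "(1 - \<epsilon>) * P < real (card {E \<in> X. md E \<in> I n})" using P by (simp add: field_simps)
    have "card X = card ({E \<in> X. md E \<in> I n} \<union> {E \<in> X. md E \<notin> I n})" by (rule arg_cong[of _ _ card]) auto
    also have "\<dots> = card {E \<in> X. md E \<in> I n} + card {E \<in> X. md E \<notin> I n}" using finX by (intro card_Un_disjoint) auto
    finally have "P = real (card {E \<in> X. md E \<in> I n}) + real (card {E \<in> X. md E \<notin> I n})" unfolding P_def by simp
    then show ?thesis using 1 by (simp add: algebra_simps)
  qed
  define a where "a d = card {E \<in> X. md E = d \<and> k + 1 \<le> card (bearing E)}" for d
  have "\<exists>d\<in>I n. P / (4 * real Z) \<le> real (a d)"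
  proof (rule ccontr)
    assume neg: "\<not> ?thesis"
    have "X \<subseteq> few {1..n} (m n) k \<union> {E \<in> X. md E \<notin> I n} \<union> (\<Union>d\<in>I n. {E \<in> X. md E = d \<and> k + 1 \<le> card (bearing E)})"
      unfolding few_def X_def by auto
    then have "card X \<le> card (few {1..n} (m n) k \<union> {E \<in> X. md E \<notin> I n} \<union> (\<Union>d\<in>I n. {E \<in> X. md E = d \<and> k + 1 \<le> card (bearing E)}))"
      using finX finI by (intro card_mono) (auto simp: few_def X_def)
    also have "\<dots> \<le> card (few {1..n} (m n) k) + card {E \<in> X. md E \<notin> I n} + (\<Sum>d\<in>I n. a d)"
      unfolding a_def by (intro order_trans[OF card_Un_le] add_mono order_refl card_Un_le card_UN_le finI)
    finally have "P \<le> real (card (few {1..n} (m n) k)) + real (card {E \<in> X. md E \<notin> I n}) + (\<Sum>d\<in>I n. real (a d))"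
      unfolding P_def of_nat_add[symmetric] of_nat_sum[symmetric] by (rule of_nat_mono)
    moreover have "2 * real (card (few {1..n} (m n) k)) < P" using few unfolding P_def by linarith
    moreover have "\<epsilon> * P \<le> 1 / 4 * P" using \<epsilon> P by (intro mult_right_mono) auto
    ultimately have low: "P / 4 < (\<Sum>d\<in>I n. real (a d))" using out by linarith
    have "(\<Sum>d\<in>I n. real (a d)) \<le> of_nat (card (I n)) * (P / (4 * real Z))"
      using neg by (intro sum_bounded_above) auto
    also have "\<dots> \<le> real Z * (P / (4 * real Z))" using n(2) P by (intro mult_right_mono) auto
    also have "\<dots> = P / 4" using Z by simp
    finally show False using low by linarith
  qed
  then obtain d where d: "d \<in> I n" "P / (4 * real Z) \<le> real (a d)" by blast
  \<comment> \<open>The shifts start at 4, as \<open>shift_max_degree\<close> requires, and advance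
    by 2, so that the pairs \<open>d + b\<close> and \<open>d + b + 1\<close> are disjoint for
    different \<open>i\<close>. Thus \<open>Z\<close> pairs yield \<open>Z\<close> elements of
    \<open>I n\<close>.\<close>
  have hit: "d + (2 * i + 4) \<in> I n \<or> d + (2 * i + 4) + 1 \<in> I n" if i: "i < Z" for i
  proof (rule ccontr)
    assume neg: "\<not> ?thesis"
    define b where "b = 2 * i + 4"
    have bZ: "b \<ge> 4" "b \<le> 2 * Z + 4" unfolding b_def using i by auto
    have "(8 * real Z + 16) / \<delta> \<le> real n" using n(1) by linarith
    then have "8 * real Z + 16 \<le> \<delta> * real n" using \<delta> by (simp add: field_simps)
    moreover have "t * real n \<le> \<delta> / 2 * real n" using t by (intro mult_right_mono) auto
    moreover have "\<delta> * real n \<le> real (k + 1)" unfolding k_def using \<delta> by linarith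
    moreover have "real b \<le> 2 * real Z + 4" using bZ(2) by linarith
    ultimately have "t * real n + 2 * real b \<le> real (k + 1)" by simp
    then have sh: "real (a d) * t ^ b \<le> 2 * real (card {E \<in> X. md E \<in> {d + b, d + b + 1}})"
      using shift_max_degree[of n b t "k + 1" "m n" d] bZ(1) t n(1) unfolding a_def X_def md_def by simp
    have "2 * c * P = P / (4 * real Z) * t ^ (2 * Z + 4)" unfolding c_def by simp
    also have "\<dots> \<le> real (a d) * t ^ b"
      using d(2) t bZ(2) P Z by (intro mult_mono power_decreasing) auto
    also note sh
    also have "card {E \<in> X. md E \<in> {d + b, d + b + 1}} \<le> card {E \<in> X. md E \<notin> I n}"
      using neg finX unfolding b_def by (intro card_mono) auto
    finally have "c * P \<le> real (card {E \<in> X. md E \<notin> I n})" by simp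
    moreover have "\<epsilon> * P < c * P" using \<epsilon> P by simp
    ultimately show False using out by linarith
  qed
  define f where "f i = (if d + (2 * i + 4) \<in> I n then d + (2 * i + 4) else d + (2 * i + 4) + 1)" for i
  have "inj_on f {..<Z}"
  proof (rule inj_onI)
    fix i j assume "f i = f j"
    then have "(f i - d) div 2 = (f j - d) div 2" by simp
    moreover have "(f i - d) div 2 = i + 2" for i unfolding f_def by simp
    ultimately show "i = j" by simp
  qed
  moreover have "f ` {..<Z} \<subseteq> I n" using hit unfolding f_def by auto
  ultimately have "card {..<Z} \<le> card (I n)" by (intro card_inj_on_le finI)
  then show False using n(2) by simp
qed

end
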